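(* Consider the Gaussian Unitary Ensemble, i.e. the probability measure on $N\times N$ hermitian matrices proportional to $dM\,\exp(-N\,\mathrm{Tr}\,\tfrac{M^2}{2})$. For any $g\ge0$, $n\ge1$ and any partition $\mu=(\mu_1,\dots,\mu_n)$ with $n$ parts, $$\frac{\kappa_n^{[g]}(\mathrm{Tr}\,M^{\mu_1},\dots,\mathrm{Tr}\,M^{\mu_n})}{|\mathrm{Aut}\,\mu|}=[E^{\circ,g}]_{\mu,(2,\dots,2)},$$ where $[E^{\circ,g}]_{\mu,(2,\dots,2)}$ are the connected double strictly monotone Hurwitz numbers of genus $g$ with ramification profiles $\mu$ and $(2,\dots,2)$.
   Context: The cumulants (joint classical cumulants $\kappa_n$ of random variables) of the GUE have a finite topological expansion $\kappa_n(\mathrm{Tr}\,M^{\mu_1},\dots,\mathrm{Tr}\,M^{\mu_n})=\sum_{g\ge0}N^{2-2g-n}\,\kappa_n^{[g]}(\mathrm{Tr}\,M^{\mu_1},\dots,\mathrm{Tr}\,M^{\mu_n})$ with $\kappa_n^{[g]}$ independent of $N$; this defines $\kappa_n^{[g]}$. For a partition $\mu$ of an even integer $L$, write $(2,\dots,2)$ for the partition of $L$ with $L/2$ parts, and $|\mathrm{Aut}\,\mu|=L!/|C_\mu|$, where $C_\mu\subset\mathfrak S_L$ is the conjugacy class of cycle type $\mu$. Fix $\sigma\in C_{(2,\dots,2)}$. A strictly monotone $k$-step path from $C_\mu$ to $\sigma$ is a tuple $(\tau_1,\dots,\tau_k,\rho)$ with $\rho\in C_\mu$, $\tau_i=(a_i\;b_i)$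 transpositions with $\max(a_1,b_1)<\dots<\max(a_k,b_k)$, and $\tau_1\cdots\tau_k\rho=\sigma$. It is connected if the group generated by all permutations met along the path (equivalently by $\rho,\tau_1,\dots,\tau_k$) acts transitively on $\{1,\dots,L\}$. Then $2^{L/2}(L/2)!\,[E^{\circ,g}]_{\mu,(2,\dots,2)}$ is the number of connected such paths with $k=2g-2+\ell(\mu)+L/2$ (independent of the choice of $\sigma$). If $|\mu|$ is odd, $[E^{\circ,g}]_{\mu,(2,\dots,2)}$ is $0$ by convention. *)

theory Defs
  imports
    "HOL-Analysis.Analysis"
    "HOL-Combinatorics.Combinatorics"
    "HOL-Library.Disjoint_Sets"
    "HOL-Algebra.Sym_Groups"
    "HOL-Algebra.Generated_Groups"
    "Jordan_Normal_Form.Matrix"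
    "Jordan_Normal_Form.Schur_Decomposition"
begin

section \<open>The Gaussian Unitary Ensemble\<close>

definition mat_trace :: "'a :: comm_monoid_add mat \<Rightarrow> 'a" where
  "mat_trace A = (\<Sum>i<dim_row A. A $$ (i, i))"

definition hermitian_mats :: "nat \<Rightarrow> complex mat set" where
  "hermitian_mats N = {A \<in> carrier_mat N N. mat_adjoint A = A}"

text \<open>The sigma-algebra on the Hermitian matrices generated by the matrix entries; this
  structure only carries the measurable sets.\<close>

definition hermitian_borel :: "nat \<Rightarrow> complex mat measure" where
  "hermitian_borel N =
     vimage_algebra (hermitian_mats N) (\<lambda>A. \<lambda>p\<in>{..<N} \<times> {..<N}. A $$ p)
       (PiM ({..<N} \<times> {..<N}) (\<lambda>_. borel))"

text \<open>Real linear coordinates: \<open>x (i, i)\<close> is the diagonal entry, and for \<open>i < j\<close> the numbers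
  \<open>x (i, j)\<close> and \<open>x (j, i)\<close> are the real and the imaginary part of the \<open>(i, j)\<close> entry.\<close>

definition hermitian_of_coords :: "nat \<Rightarrow> (nat \<times> nat \<Rightarrow> real) \<Rightarrow> complex mat" where
  "hermitian_of_coords N x = mat N N (\<lambda>(i, j).
     if i = j then complex_of_real (x (i, i))
     else if i < j then Complex (x (i, j)) (x (j, i))
     else Complex (x (j, i)) (- x (i, j)))"

text \<open>The Lebesgue measure \<open>dM = \<Prod>\<^sub>i dM\<^sub>i\<^sub>i \<Prod>\<^sub>i\<^sub><\<^sub>j d(Re M\<^sub>i\<^sub>j) d(Im M\<^sub>i\<^sub>j)\<close>.\<close>

definition hermitian_lebesgue :: "nat \<Rightarrow> complex mat measure" where
  "hermitian_lebesgue N =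
     distr (PiM ({..<N} \<times> {..<N}) (\<lambda>_. lborel)) (hermitian_borel N) (hermitian_of_coords N)"

definition gue_weight :: "nat \<Rightarrow> complex mat \<Rightarrow> real" where
  "gue_weight N A = exp (- real N * Re (mat_trace (A ^\<^sub>m 2)) / 2)"

definition GUE :: "nat \<Rightarrow> complex mat measure" where
  "GUE N = density (hermitian_lebesgue N)
     (\<lambda>A. ennreal (gue_weight N A / (\<integral>B. gue_weight N B \<partial>hermitian_lebesgue N)))"

section \<open>Cumulants and their topological expansion\<close>

text \<open>Joint cumulant of \<open>X 0, \<dots>, X (n - 1)\<close>, by Moebius inversion of the moment-cumulant
  relation over the set partitions of the index set.\<close>

definition joint_cumulant :: "'a measure \<Rightarrow> nat \<Rightarrow> (nat \<Rightarrow> 'a \<Rightarrow> real) \<Rightarrow> real" where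
  "joint_cumulant M n X =
     (\<Sum>P | partition_on {..<n} P.
        (- 1) ^ (card P - 1) * fact (card P - 1) *
        (\<Prod>B\<in>P. \<integral>\<omega>. (\<Prod>i\<in>B. X i \<omega>) \<partial>M))"

text \<open>The trace of a power of a Hermitian matrix is real, so \<open>Re\<close> loses nothing.\<close>

definition gue_cumulant :: "nat \<Rightarrow> nat list \<Rightarrow> real" where
  "gue_cumulant N \<mu> =
     joint_cumulant (GUE N) (length \<mu>) (\<lambda>i A. Re (mat_trace (A ^\<^sub>m (\<mu> ! i))))"

definition topological_expansion :: "nat list \<Rightarrow> (nat \<Rightarrow> real) \<Rightarrow> bool" where
  "topological_expansion \<mu> c \<longleftrightarrow>
     finite {g. c g \<noteq> 0} \<and>
     (\<forall>N\<ge>1. gue_cumulant N \<mu> =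
        (\<Sum>g | c g \<noteq> 0. real N powi (2 - 2 * int g - int (length \<mu>)) * c g))"

definition gue_cumulant_genus :: "nat \<Rightarrow> nat list \<Rightarrow> real" where
  "gue_cumulant_genus g \<mu> = (THE c. topological_expansion \<mu> c) g"

section \<open>Strictly monotone Hurwitz numbers\<close>

definition is_partition :: "nat list \<Rightarrow> bool" where
  "is_partition \<mu> \<longleftrightarrow> sorted_wrt (\<ge>) \<mu> \<and> (\<forall>m\<in>set \<mu>. 1 \<le> m)"

text \<open>Fixed points are orbits of size one, so they contribute parts equal to 1.\<close>

definition cycle_type :: "nat \<Rightarrow> (nat \<Rightarrow> nat) \<Rightarrow> nat multiset" where
  "cycle_type L p = image_mset card (mset_set (orbit p ` {1..L}))"

definition conj_class :: "nat list \<Rightarrow> (nat \<Rightarrow> nat) set" where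
  "conj_class \<mu> = {p. p permutes {1..sum_list \<mu>} \<and> cycle_type (sum_list \<mu>) p = mset \<mu>}"

definition aut_order :: "nat list \<Rightarrow> real" where
  "aut_order \<mu> = fact (sum_list \<mu>) / real (card (conj_class \<mu>))"

text \<open>The transpositions are kept as permutations, so that \<open>(a b)\<close> and \<open>(b a)\<close> are not counted
  twice.\<close>

definition strictly_monotone_paths ::
    "nat list \<Rightarrow> nat \<Rightarrow> (nat \<Rightarrow> nat) \<Rightarrow> ((nat \<Rightarrow> nat) list \<times> (nat \<Rightarrow> nat)) set" where
  "strictly_monotone_paths \<mu> k \<sigma> =
     {(\<tau>s, \<rho>). \<rho> \<in> conj_class \<mu> \<and> length \<tau>s = k \<and>
        (\<exists>ps. (\<forall>(a, b)\<in>set ps. a \<in> {1..sum_list \<mu>} \<and> b \<in> {1..sum_list \<mu>} \<and> a \<noteq> b) \<and>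
              \<tau>s = map (\<lambda>(a, b). Transposition.transpose a b) ps \<and>
              sorted_wrt (<) (map (\<lambda>(a, b). max a b) ps)) \<and>
        foldr (\<circ>) \<tau>s \<rho> = \<sigma>}"

definition connected_path :: "nat \<Rightarrow> (nat \<Rightarrow> nat) list \<times> (nat \<Rightarrow> nat) \<Rightarrow> bool" where
  "connected_path L = (\<lambda>(\<tau>s, \<rho>).
     \<forall>x\<in>{1..L}. \<forall>y\<in>{1..L}. \<exists>p\<in>generate (sym_group L) (insert \<rho> (set \<tau>s)). p x = y)"

text \<open>The base point \<open>\<sigma>\<close> of cycle type \<open>(2, \<dots>, 2)\<close> is kept as an argument.  The number of steps
  \<open>2g - 2 + \<ell>(\<mu>) + L/2\<close> is nonnegative for nonempty \<open>\<mu>\<close> with even \<open>L\<close>, so the truncated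
  subtraction is exact.\<close>

definition connected_monotone_hurwitz :: "nat \<Rightarrow> nat list \<Rightarrow> (nat \<Rightarrow> nat) \<Rightarrow> real" where
  "connected_monotone_hurwitz g \<mu> \<sigma> =
     (let L = sum_list \<mu> in
      if even L then
        real (card {w \<in> strictly_monotone_paths \<mu> (2 * g + length \<mu> + L div 2 - 2) \<sigma>.
                     connected_path L w}) / (2 ^ (L div 2) * fact (L div 2))
      else 0)"

section \<open>Well-definedness\<close>

lemma hermitian_of_coords_in: "hermitian_of_coords N x \<in> hermitian_mats N"
proof -
  have "mat_adjoint (hermitian_of_coords N x) = hermitian_of_coords N x"
    by (rule eq_matI)
       (auto simp: mat_adjoint_def hermitian_of_coords_def mat_of_rows_def complex_eq_iff)
  then show ?thesis
    by (simp add: hermitian_mats_def hermitian_of_coords_def)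
qed

lemma measurable_hermitian_of_coords:
  "hermitian_of_coords N \<in>
     measurable (PiM ({..<N} \<times> {..<N}) (\<lambda>_. lborel)) (hermitian_borel N)"
  unfolding hermitian_borel_def
proof (rule measurable_vimage_algebra2)
  show "hermitian_of_coords N \<in> space (PiM ({..<N} \<times> {..<N}) (\<lambda>_. lborel)) \<rightarrow> hermitian_mats N"
    using hermitian_of_coords_in by auto
  have C: "(\<lambda>x. Complex (f x) (g x)) \<in> borel_measurable M"
    if "f \<in> borel_measurable M" "g \<in> borel_measurable M"
    for f g :: "(nat \<times> nat \<Rightarrow> real) \<Rightarrow> real" and M
  proof -
    have "(\<lambda>x. complex_of_real (f x) + \<i> * complex_of_real (g x)) \<in> borel_measurable M"
      using that by measurable
    then show ?thesis by (simp add: Complex_eq)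
  qed
  show "(\<lambda>x. \<lambda>p\<in>{..<N} \<times> {..<N}. hermitian_of_coords N x $$ p) \<in>
     measurable (PiM ({..<N} \<times> {..<N}) (\<lambda>_. lborel)) (PiM ({..<N} \<times> {..<N}) (\<lambda>_. borel))"
  proof (rule measurable_restrict)
    fix p assume p: "p \<in> {..<N} \<times> {..<N}"
    obtain i j where ij: "p = (i, j)" by force
    have m: "(\<lambda>x :: nat \<times> nat \<Rightarrow> real. x q) \<in> borel_measurable (PiM ({..<N} \<times> {..<N}) (\<lambda>_. lborel))"
      if "q \<in> {..<N} \<times> {..<N}" for q :: "nat \<times> nat"
      using measurable_component_singleton[OF that, of "\<lambda>_. lborel :: real measure"] by simp
    consider "i = j" | "i < j" | "j < i" by linarith
    then show "(\<lambda>x. hermitian_of_coords N x $$ p) \<in>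
        borel_measurable (PiM ({..<N} \<times> {..<N}) (\<lambda>_. lborel))"
    proof cases
      case 1
      then show ?thesis
        using p ij m[of "(i, i)"] by (simp add: hermitian_of_coords_def)
    next
      case 2
      then show ?thesis
        using p ij C[OF m[of "(i, j)"] m[of "(j, i)"]] by (simp add: hermitian_of_coords_def)
    next
      case 3
      then show ?thesis
        using p ij C[OF m[of "(j, i)"] borel_measurable_uminus[OF m[of "(i, j)"]]]
        by (simp add: hermitian_of_coords_def)
    qed
  qed
qed

lemma topological_expansion_unique:
  assumes "topological_expansion \<mu> c" "topological_expansion \<mu> d"
  shows "c = d"
proof -
  define F where "F = {g. c g \<noteq> 0} \<union> {g. d g \<noteq> 0}"
  have fin: "finite F"
    using assms by (auto simp: F_def topological_expansion_def)
  then obtain m where m: "\<And>g. g \<in> F \<Longrightarrow> g \<le> m"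
    using finite_nat_set_iff_bounded_le by auto
  define p where "p = (\<Sum>g\<in>F. monom (c g - d g) (2 * (m - g)))"
  have root: "poly p (real N) = 0" if "N \<ge> 1" for N
  proof -
    have ext: "(\<Sum>g | e g \<noteq> 0. real N powi (2 - 2 * int g - int (length \<mu>)) * e g) =
          (\<Sum>g\<in>F. real N powi (2 - 2 * int g - int (length \<mu>)) * e g)"
      if "{g. e g \<noteq> 0} \<subseteq> F" for e
      by (rule sum.mono_neutral_left) (use fin that in auto)
    have "(\<Sum>g\<in>F. real N powi (2 - 2 * int g - int (length \<mu>)) * c g) =
          (\<Sum>g\<in>F. real N powi (2 - 2 * int g - int (length \<mu>)) * d g)"
      using assms \<open>N \<ge> 1\<close> ext[of c] ext[of d]
      unfolding topological_expansion_def F_def by auto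
    then have "0 = (\<Sum>g\<in>F. real N powi (2 - 2 * int g - int (length \<mu>)) * (c g - d g))"
      by (simp add: right_diff_distrib sum_subtractf)
    also have "\<dots> * real N powi (2 * int m + int (length \<mu>) - 2) = poly p (real N)"
      unfolding p_def poly_sum poly_monom sum_distrib_right
    proof (rule sum.cong, goal_cases)
      case (2 g)
      have "real N powi (2 - 2 * int g - int (length \<mu>)) *
            real N powi (2 * int m + int (length \<mu>) - 2) = real N powi int (2 * (m - g))"
        using \<open>N \<ge> 1\<close> m[OF 2] by (subst power_int_add[symmetric]) (auto simp: of_nat_diff)
      then show ?case
        by (simp only: power_int_of_nat) (simp add: mult_ac)
    qed simp
    finally show ?thesis by simp
  qed
  have "p = 0"
  proof (rule ccontr)
    assume "p \<noteq> 0"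
    then have "finite {x. poly p x = 0}" by (rule poly_roots_finite)
    moreover have "real ` {1..} \<subseteq> {x. poly p x = 0}" using root by auto
    ultimately have "finite (real ` {1..})" by (rule rev_finite_subset)
    then have "finite {1 :: nat..}" by (rule finite_imageD) (simp add: inj_on_def)
    then show False by (simp add: infinite_Ici)
  qed
  show "c = d"
  proof
    fix h
    show "c h = d h"
    proof (cases "h \<in> F")
      case True
      have "0 = coeff p (2 * (m - h))" using \<open>p = 0\<close> by simp
      also have "\<dots> = (\<Sum>g\<in>F. if g = h then c g - d g else 0)"
        unfolding p_def coeff_sum coeff_monom
      proof (rule sum.cong)
        fix g assume "g \<in> F"
        then have "2 * (m - g) = 2 * (m - h) \<longleftrightarrow> g = h"
          using m[of g] m[of h] True by auto
        then show "(if 2 * (m - g) = 2 * (m - h) then c g - d g else 0) =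
            (if g = h then c g - d g else 0)" by simp
      qed simp
      also have "\<dots> = c h - d h" using fin True by simp
      finally show ?thesis by simp
    qed (auto simp: F_def)
  qed
qed

end

theory Submission
  imports Defs "HOL-Probability.Distributions"
begin

text \<open>Wick's formula turns each moment of the traces into a sum over pairings (fixed-point free
  involutions) \<open>\<alpha>\<close> of the union of the corresponding cycles of a fixed \<open>\<rho> \<in> C\<^sub>\<mu>\<close>, weighted by a power
  of \<open>N\<close> whose exponent is the number of cycles of \<open>\<rho> \<circ> \<alpha>\<close> minus half the number of points. Moebius
  inversion over set partitions keeps exactly the pairings for which \<open>\<rho>\<close> and \<open>\<alpha>\<close> generate a
  transitive group, and for these the Riemann-Hurwitz count shows that the exponent is
  \<open>2 - 2g - n\<close> with \<open>g \<ge> 0\<close>. On the other side every permutation has exactly one strictly monotone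
  factorisation, whose length is the number of points minus the number of cycles and whose factors
  preserve the same sets, so paths from \<open>C\<^sub>\<mu>\<close> to \<open>\<sigma>\<close> are counted by their starting points \<open>\<rho>\<close>.
  Counting the pairs \<open>(\<rho>, \<alpha>)\<close> in two ways compares the two numbers.\<close>

section \<open>Cycles and transpositions\<close>

text \<open>The step number \<open>k\<close> carries the genus throughout. View the cycles of \<rho>
  as vertices, the pairs of \<alpha> as edges and the cycles of
  \<open>\<rho> \<circ> \<alpha>\<close> as faces: Euler's relation says that
  \<open>k = 2g - 2 + n + L/2\<close> holds exactly when \<open>\<rho> \<circ> \<alpha>\<close> has
  \<open>L - k\<close> cycles, and \<open>L - k\<close> is also the cycle number forced on the other
  side by \<open>k\<close> factors. The two sides hold different members of a pair fixed: the
  cumulant fixes \<rho> and varies \<alpha>, the Hurwitz number fixes the pairing \<sigma> and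
  varies \<rho>. Double counting therefore needs both kinds of fibres to have constant size. For
  pairings this holds because all of them are conjugate; for \<rho> it comes from the uniqueness of
  the topological expansion, since the cumulant knows \<mu> only. As \<open>L = 2m\<close> points
  have \<open>L! / (2^m m!)\<close> pairings, dividing by \<open>L!\<close> leaves
  \<open>|C|/L! = 1/|Aut|\<close> on one side and \<open>1/(2^m m!)\<close> on the other.
  Transitivity is phrased through preserved subsets because the Moebius inversion and the monotone
  factorisation both control sets, not group elements.\<close>

abbreviation swp :: "'a \<Rightarrow> 'a \<Rightarrow> 'a \<Rightarrow> 'a" where
  "swp \<equiv> Transposition.transpose"

abbreviation pinv :: "('a \<Rightarrow> 'a) \<Rightarrow> 'a \<Rightarrow> 'a" where
  "pinv \<equiv> inv_into UNIV"

abbreviation swps :: "'a \<times> 'a \<Rightarrow> ('a \<Rightarrow> 'b) \<Rightarrow> 'a \<Rightarrow> 'b" where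
  "swps \<equiv> \<lambda>(a, b) f. f \<circ> swp a b"

text \<open>Fixed points count as cycles. The library's \<open>orbit f x\<close> is generated from
  \<open>f x\<close>, so it contains \<open>x\<close> only when \<open>x\<close> is periodic; this
  is why \<open>permutation\<close> is assumed so often.\<close>

definition cyc :: "('a \<Rightarrow> 'a) \<Rightarrow> 'a set \<Rightarrow> nat" where
  "cyc f A = card (orbit f ` A)"

lemma orbit_subset_invariant: "f ` U \<subseteq> U \<Longrightarrow> x \<in> U \<Longrightarrow> orbit f x \<subseteq> U"
proof
  fix y assume "f ` U \<subseteq> U" "x \<in> U" "y \<in> orbit f x"
  from this(3,1,2) show "y \<in> U" by induction auto
qed

lemma orbit_eq_orbit: "permutation f \<Longrightarrow> y \<in> orbit f x \<Longrightarrow> orbit f y = orbit f x"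
  using cyclic_on_orbit'[of f x] orbit_cyclic_eq3 by metis

lemma orbit_eq_iff: "permutation f \<Longrightarrow> orbit f y = orbit f x \<longleftrightarrow> y \<in> orbit f x"
  using orbit_eq_orbit permutation_self_in_orbit by metis

lemma permutation_comp_transpose: "permutation q \<Longrightarrow> permutation (q \<circ> swp a b)"
  by (simp add: permutation_compose permutation_swap_id)

text \<open>The new map sends \<open>a\<close> to \<open>q b\<close>, runs along the cycle of
  \<open>b\<close> until it reaches \<open>b\<close>, is sent from there to \<open>q a\<close>, and
  returns along the cycle of \<open>a\<close>. The inclusion of the cycle of \<open>b\<close> comes
  before the other one, which starts from \<open>b\<close>.\<close>

lemma orbit_comp_transpose_merge:
  assumes q: "permutation q" and ab: "b \<notin> orbit q a"
  shows "orbit (q \<circ> swp a b) a = orbit q a \<union> orbit q b"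
proof -
  let ?q = "q \<circ> swp a b"
  have q': "permutation ?q" using q by (rule permutation_comp_transpose)
  have sa: "a \<in> orbit q a" and sb: "b \<in> orbit q b"
    using permutation_self_in_orbit[OF q] by auto
  have ba: "a \<notin> orbit q b" using ab orbit_eq_orbit[OF q] sb by metis
  have B: "orbit q b \<subseteq> orbit ?q a"
  proof
    fix y assume "y \<in> orbit q b"
    then show "y \<in> orbit ?q a"
    proof induction
      case base
      have "?q a = q b" by simp
      then show ?case using orbit.base[of ?q a] by metis
    next
      case (step y)
      show ?case
      proof (cases "y = b")
        case True
        have "?q a = q b" by simp
        then show ?thesis using orbit.base[of ?q a] True by metis
      next
        case False
        moreover have "y \<noteq> a" using step.hyps ba by auto
        ultimately have "?q y = q y" by simp
        then show ?thesis using orbit.step[OF step.IH] by metis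
      qed
    qed
  qed
  have A: "orbit q a \<subseteq> orbit ?q a"
  proof
    fix y assume "y \<in> orbit q a"
    then show "y \<in> orbit ?q a"
    proof induction
      case base
      have "?q b = q a" by simp
      then show ?case using orbit.step[OF subsetD[OF B sb]] by metis
    next
      case (step y)
      show ?case
      proof (cases "y = a")
        case True
        have "?q b = q a" by simp
        then show ?thesis using orbit.step[OF subsetD[OF B sb]] True by metis
      next
        case False
        moreover have "y \<noteq> b" using step.hyps ab by auto
        ultimately have "?q y = q y" by simp
        then show ?thesis using orbit.step[OF step.IH] by metis
      qed
    qed
  qed
  have "?q ` (orbit q a \<union> orbit q b) \<subseteq> orbit q a \<union> orbit q b"
    by (auto simp: Transposition.transpose_def orbit.intros)
  then have "orbit ?q a \<subseteq> orbit q a \<union> orbit q b"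
    by (rule orbit_subset_invariant) (use sa in auto)
  then show ?thesis using A B by auto
qed

text \<open>The new map closes the stretch of the cycle from \<open>q a\<close> to \<open>b\<close>,
  because it sends \<open>b\<close> back to \<open>q a\<close>; this stretch does not contain
  \<open>a\<close>.\<close>

lemma orbit_comp_transpose_split:
  assumes q: "permutation q" and "a \<noteq> b" and ab: "b \<in> orbit q a"
  shows "b \<notin> orbit (q \<circ> swp a b) a"
proof -
  let ?q = "q \<circ> swp a b"
  have q': "permutation ?q" using q by (rule permutation_comp_transpose)
  \<comment> \<open>The number of steps until \<open>a\<close> reaches \<open>b\<close> for the
    first time.\<close>
  define k where "k = (LEAST i. 0 < i \<and> (q ^^ i) a = b)"
  have "\<exists>i. 0 < i \<and> (q ^^ i) a = b" using ab by (auto simp: orbit_altdef)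
  then have k: "0 < k \<and> (q ^^ k) a = b" unfolding k_def by (rule LeastI_ex)
  have least: "(q ^^ i) a \<noteq> b" if "0 < i" "i < k" for i
    using that not_less_Least[of i "\<lambda>i. 0 < i \<and> (q ^^ i) a = b"] by (auto simp: k_def)
  define U where "U = (\<lambda>i. (q ^^ i) a) ` {1..k}"
  have bU: "b \<in> U" using k by (force simp: U_def)
  \<comment> \<open>A return to \<open>a\<close> after \<open>i\<close> steps would let
    \<open>b\<close> be reached already after \<open>k - i\<close> steps.\<close>
  have ne: "(q ^^ i) a \<noteq> a" if "0 < i" "i \<le> k" for i
  proof
    assume e: "(q ^^ i) a = a"
    then have "i < k" using k \<open>a \<noteq> b\<close> that by (metis le_neq_implies_less)
    have "(q ^^ (k - i)) a = (q ^^ (k - i)) ((q ^^ i) a)" using e by simp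
    also have "\<dots> = (q ^^ (k - i + i)) a" by (simp only: funpow_add o_apply)
    also have "\<dots> = b" using k \<open>i < k\<close> by simp
    finally show False using least[of "k - i"] \<open>i < k\<close> that by auto
  qed
  have "?q ` U \<subseteq> U"
  proof
    fix y assume "y \<in> ?q ` U"
    then obtain i where "i \<in> {1..k}" "y = ?q ((q ^^ i) a)" unfolding U_def by blast
    then have i: "0 < i" "i \<le> k" "y = ?q ((q ^^ i) a)" by auto
    show "y \<in> U"
    proof (cases "i = k")
      case True
      then have "y = q a" using i k by simp
      moreover have "q a = (q ^^ 1) a" by simp
      ultimately show ?thesis unfolding U_def using k by (metis One_nat_def Suc_leI atLeastAtMost_iff image_eqI le_refl)
    next
      case False
      then have "y = q ((q ^^ i) a)" using i ne[of i] least[of i] by simp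
      then have "y = (q ^^ Suc i) a" by simp
      moreover have "Suc i \<in> {1..k}" using False i by auto
      ultimately show ?thesis unfolding U_def by (rule image_eqI)
    qed
  qed
  then have "orbit ?q b \<subseteq> U" using bU by (rule orbit_subset_invariant)
  moreover have "a \<notin> U" using ne by (auto simp: U_def) (metis ne One_nat_def Suc_le_lessD)
  ultimately have "a \<notin> orbit ?q b" by auto
  then show ?thesis using orbit_eq_iff[OF q'] permutation_self_in_orbit[OF q'] by metis
qed

text \<open>The cycles of \<open>a\<close> and \<open>b\<close> are replaced by their union, and all
  other cycles are untouched.\<close>

lemma cyc_merge:
  assumes q: "q permutes S" and S: "finite S" "a \<in> S" "b \<in> S" and ab: "b \<notin> orbit q a"
  shows "cyc q S = Suc (cyc (q \<circ> swp a b) S)"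
proof -
  let ?q = "q \<circ> swp a b"
  have p: "permutation q" using q S by (auto simp: permutation_permutes)
  have ba: "a \<notin> orbit q b" using ab orbit_eq_orbit[OF p] permutation_self_in_orbit[OF p] by metis
  let ?A = "orbit q a" and ?B = "orbit q b"
  have sa: "a \<in> ?A" and sb: "b \<in> ?B" using permutation_self_in_orbit[OF p] by auto
  have oa: "orbit ?q a = ?A \<union> ?B" by (rule orbit_comp_transpose_merge[OF p ab])
  have ob: "orbit ?q b = ?A \<union> ?B"
    using orbit_comp_transpose_merge[OF p ba] by (simp add: transpose_commute Un_commute)
  have pq: "permutation ?q" using p by (rule permutation_comp_transpose)
  have oab: "orbit ?q x = ?A \<union> ?B" if "x \<in> ?A \<union> ?B" for x
    using orbit_eq_orbit[OF pq, of x a] that oa by simp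
  have other: "orbit ?q x = orbit q x" if "x \<notin> ?A \<union> ?B" for x
  proof (rule orbit_cong)
    show "x \<in> orbit q x" by (rule permutation_self_in_orbit[OF p])
    fix s assume s: "s \<in> orbit q x"
    have "s \<noteq> a" "s \<noteq> b" using that s orbit_eq_orbit[OF p] permutation_self_in_orbit[OF p] by (metis UnI1, metis UnI2)
    then show "?q s = q s" by simp
  qed
  have "orbit ?q ` S = insert (?A \<union> ?B) (orbit q ` S - {?A, ?B})"
  proof (intro equalityI subsetI)
    fix X assume "X \<in> orbit ?q ` S"
    then obtain x where x: "x \<in> S" "X = orbit ?q x" by auto
    show "X \<in> insert (?A \<union> ?B) (orbit q ` S - {?A, ?B})"
    proof (cases "x \<in> ?A \<union> ?B")
      case True then show ?thesis using oab x by simp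
    next
      case False
      then have "orbit q x \<noteq> ?A" "orbit q x \<noteq> ?B" using orbit_eq_iff[OF p] by auto
      then show ?thesis using False other x by auto
    qed
  next
    fix X assume "X \<in> insert (?A \<union> ?B) (orbit q ` S - {?A, ?B})"
    then consider "X = ?A \<union> ?B" | x where "x \<in> S" "X = orbit q x" "X \<noteq> ?A" "X \<noteq> ?B" by auto
    then show "X \<in> orbit ?q ` S"
    proof cases
      case 1 then show ?thesis using oa S by (metis image_eqI)
    next
      case 2
      then have "x \<notin> ?A \<union> ?B" using orbit_eq_iff[OF p] by auto
      then show ?thesis using other 2 by (metis image_eqI)
    qed
  qed
  moreover have "?A \<union> ?B \<notin> orbit q ` S"
  proof
    assume "?A \<union> ?B \<in> orbit q ` S"
    then obtain x where "orbit q x = ?A \<union> ?B" by auto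
    then have "orbit q a = ?A \<union> ?B" using orbit_eq_orbit[OF p, of a x] sa by auto
    then show False using ab sb by auto
  qed
  moreover have "?A \<noteq> ?B" using ab sb by auto
  ultimately have "cyc ?q S = Suc (card (orbit q ` S - {?A, ?B}))" using S by (simp add: cyc_def)
  also have "card (orbit q ` S - {?A, ?B}) = cyc q S - 2"
    using S \<open>?A \<noteq> ?B\<close> by (subst card_Diff_subset) (auto simp: cyc_def)
  finally have e: "cyc ?q S = Suc (cyc q S - 2)" .
  have "2 \<le> cyc q S"
    using card_mono[of "orbit q ` S" "{?A,?B}"] S \<open>?A \<noteq> ?B\<close> by (simp add: cyc_def)
  then show ?thesis using e by simp
qed

text \<open>After the split the two points lie on different cycles, so \<open>cyc_merge\<close>
  applies to \<open>q \<circ> swp a b\<close>, and the second transposition undoes the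
  first.\<close>

lemma cyc_split:
  assumes q: "q permutes S" and S: "finite S" "a \<in> S" "b \<in> S" and "a \<noteq> b" and ab: "b \<in> orbit q a"
  shows "cyc (q \<circ> swp a b) S = Suc (cyc q S)"
proof -
  have p: "permutation q" using q S by (auto simp: permutation_permutes)
  have "q \<circ> swp a b permutes S"
    using q S by (intro permutes_compose permutes_swap_id)
  from cyc_merge[OF this S orbit_comp_transpose_split[OF p \<open>a \<noteq> b\<close> ab]]
  show ?thesis by (simp add: o_assoc[symmetric])
qed

lemma cyc_id: "cyc id S = card S"
proof -
  have "orbit (id :: 'a \<Rightarrow> 'a) = (\<lambda>x. {x})" by (rule ext) (simp add: orbit_eq_singleton_iff)
  then show ?thesis by (simp add: cyc_def card_image)
qed

lemma cyc_inv: "permutation q \<Longrightarrow> cyc (pinv q) S = cyc q S"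
  by (simp add: cyc_def orbit_inv_eq)

lemma cyc_comp_transpose_le:
  assumes "q permutes S" "finite S" "a \<in> S" "b \<in> S"
  shows "cyc (q \<circ> swp a b) S \<le> Suc (cyc q S)"
proof (cases "a = b")
  case False
  then show ?thesis
    using cyc_split[OF assms] cyc_merge[OF assms] by (cases "b \<in> orbit q a") auto
qed simp

section \<open>Partitions of the points into invariant blocks\<close>

lemma partition_on_orbits:
  assumes p: "p permutes S" and S: "finite S"
  shows "partition_on S (orbit p ` S)"
proof (rule partition_onI)
  have pp: "permutation p" using p S by (auto simp: permutation_permutes)
  show "\<Union> (orbit p ` S) = S"
    using permutation_self_in_orbit[OF pp] permutes_orbit_subset[OF p] by auto
  fix X Y assume XY: "X \<in> orbit p ` S" "Y \<in> orbit p ` S" "X \<noteq> Y"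
  show "disjnt X Y"
  proof (rule ccontr)
    assume "\<not> disjnt X Y"
    then obtain z where "z \<in> X" "z \<in> Y" by (auto simp: disjnt_iff)
    then have "X = orbit p z" "Y = orbit p z" using XY orbit_eq_orbit[OF pp] by auto
    then show False using XY by simp
  qed
qed (use orbit_nonempty[of p] in auto)

lemma partition_on_join:
  assumes P: "partition_on S P" and AB: "A \<in> P" "B \<in> P"
  shows "partition_on S (insert (A \<union> B) (P - {A, B}))"
proof (rule partition_onI)
  show "\<Union> (insert (A \<union> B) (P - {A, B})) = S" using partition_onD1[OF P] AB by blast
  have d: "disjnt X Y" if "X \<in> P" "Y \<in> P" "X \<noteq> Y" for X Y
    using partition_onD2[OF P] that by (simp add: disjoint_def disjnt_def)
  have e: "disjnt (A \<union> B) X" if "X \<in> P - {A, B}" for X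
    using d[of A X] d[of B X] AB that by (metis DiffD1 DiffD2 disjnt_Un1 insertCI)
  fix X Y assume XY: "X \<in> insert (A \<union> B) (P - {A, B})" "Y \<in> insert (A \<union> B) (P - {A, B})" "X \<noteq> Y"
  show "disjnt X Y"
  proof (cases "X = A \<union> B \<or> Y = A \<union> B")
    case True
    then show ?thesis using e XY disjnt_sym by (metis insertE)
  next
    case False
    then show ?thesis using d XY by simp
  qed
next
  show "{} \<notin> insert (A \<union> B) (P - {A, B})" using partition_onD3[OF P] AB by (metis DiffD1 Un_empty insertE)
qed

text \<open>Each transposition joins at most two blocks of the partition; a join of two blocks also joins
  two cycles, which makes the inequality exact in that case.\<close>

lemma cyc_fold_transpose_partition:
  assumes p: "p permutes S" and S: "finite S" and ts: "\<forall>(a, b)\<in>set ts. a \<in> S \<and> b \<in> S"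
  defines "w \<equiv> \<lambda>us. fold swps us p"
  shows "\<exists>P. partition_on S P \<and> (\<forall>B\<in>P. \<forall>x\<in>B. p x \<in> B) \<and>
    (\<forall>B\<in>P. \<forall>(a, b)\<in>set ts. a \<in> B \<longleftrightarrow> b \<in> B) \<and> w ts permutes S \<and> (\<forall>B\<in>P. \<forall>x\<in>B. w ts x \<in> B) \<and>
    cyc (w ts) S + cyc p S \<le> 2 * card P + length ts"
  using ts
proof (induction ts rule: rev_induct)
  case Nil
  have "p x \<in> B" if "B \<in> orbit p ` S" "x \<in> B" for B x using that by (auto intro: orbit.intros)
  \<comment> \<open>The blocks are the cycles of \<open>p\<close>, and both cycle numbers equal
    \<open>card P\<close>, so the bound starts as an equality.\<close>
  then show ?case using p partition_on_orbits[OF p S]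
    by (intro exI[of _ "orbit p ` S"]) (simp add: cyc_def w_def)
next
  case (snoc t ts)
  obtain a b where t: "t = (a, b)" by force
  have abS: "a \<in> S" "b \<in> S" using snoc.prems t by auto
  have "\<exists>P. partition_on S P \<and> (\<forall>B\<in>P. \<forall>x\<in>B. p x \<in> B) \<and>
    (\<forall>B\<in>P. \<forall>(a, b)\<in>set ts. a \<in> B \<longleftrightarrow> b \<in> B) \<and> w ts permutes S \<and> (\<forall>B\<in>P. \<forall>x\<in>B. w ts x \<in> B) \<and>
    cyc (w ts) S + cyc p S \<le> 2 * card P + length ts"
    by (rule snoc.IH) (use snoc.prems in auto)
  then obtain P where P: "partition_on S P" "\<And>B x. B \<in> P \<Longrightarrow> x \<in> B \<Longrightarrow> p x \<in> B"
    "\<And>B c d. B \<in> P \<Longrightarrow> (c, d) \<in> set ts \<Longrightarrow> c \<in> B \<longleftrightarrow> d \<in> B"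
    "w ts permutes S" "\<And>B x. B \<in> P \<Longrightarrow> x \<in> B \<Longrightarrow> w ts x \<in> B"
    "cyc (w ts) S + cyc p S \<le> 2 * card P + length ts"
    by (elim exE conjE) (rule that; blast)
  have eq: "w (ts @ [t]) = w ts \<circ> swp a b" by (simp add: w_def t)
  obtain A B where AB: "A \<in> P" "a \<in> A" "B \<in> P" "b \<in> B"
    using abS unfolding partition_onD1[OF P(1)] by (elim UnionE) (rule that)
  have finP: "finite P" using P(1) S by (rule finite_elements[rotated])
  have dis: "X = Y" if "X \<in> P" "Y \<in> P" "z \<in> X" "z \<in> Y" for X Y z
    using disjointD[OF partition_onD2[OF P(1)] that(1,2)] that(3,4) by blast
  have perm: "w (ts @ [t]) permutes S"
    unfolding eq using P(4) abS by (intro permutes_compose permutes_swap_id)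
  show ?case
  proof (cases "A = B")
    case True
    have ab: "a \<in> X \<longleftrightarrow> b \<in> X" if "X \<in> P" for X
    proof -
      have "a \<in> X \<longleftrightarrow> X = A" using dis[OF that AB(1), of a] AB(2) by blast
      moreover have "b \<in> X \<longleftrightarrow> X = B" using dis[OF that AB(3), of b] AB(4) by blast
      ultimately show ?thesis using True by simp
    qed
    have inv: "w (ts @ [t]) x \<in> X" if "X \<in> P" "x \<in> X" for X x
    proof -
      have "swp a b x \<in> X" using ab[OF that(1)] that(2) by (metis transpose_apply_first transpose_apply_other transpose_apply_second)
      then show ?thesis unfolding eq o_apply by (rule P(5)[OF that(1)])
    qed
    have a1: "\<forall>X\<in>P. \<forall>x\<in>X. p x \<in> X" using P(2) by blast
    have a2: "\<forall>X\<in>P. \<forall>(c, d)\<in>set (ts @ [t]). c \<in> X \<longleftrightarrow> d \<in> X"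
    proof (intro ballI, clarify)
      fix X c d assume "X \<in> P" "(c, d) \<in> set (ts @ [t])"
      then show "c \<in> X \<longleftrightarrow> d \<in> X" using ab[of X] P(3)[of X c d] t by (cases "(c, d) = t") auto
    qed
    have a3: "\<forall>X\<in>P. \<forall>x\<in>X. w (ts @ [t]) x \<in> X" using inv by blast
    \<comment> \<open>Inside a block the transposition may cut a cycle; the gain of at most one is
      paid for by the longer list.\<close>
    have a4: "cyc (w (ts @ [t])) S + cyc p S \<le> 2 * card P + length (ts @ [t])"
      using P(6) cyc_comp_transpose_le[OF P(4) S abS] by (simp add: eq)
    show ?thesis by (intro exI[of _ P] conjI P(1) a1 a2 a3 a4 perm)
  next
    case False
    \<comment> \<open>Points of different invariant blocks lie on different cycles, so the
      transposition joins cycles. The left side drops by one; the right side loses two for the block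
      and gains one for the list.\<close>
    have "orbit (w ts) a \<subseteq> A" by (rule orbit_subset_invariant) (use P(5) AB in auto)
    then have "b \<notin> orbit (w ts) a" using dis[OF AB(1,3) _ AB(4)] False by auto
    then have c: "cyc (w ts) S = Suc (cyc (w (ts @ [t])) S)"
      unfolding eq by (rule cyc_merge[OF P(4) S abS])
    let ?P = "insert (A \<union> B) (P - {A, B})"
    have "A \<union> B \<notin> P - {A, B}"
    proof
      assume "A \<union> B \<in> P - {A, B}"
      then show False using dis[of "A \<union> B" A a] AB by auto
    qed
    then have "card ?P = Suc (card P - 2)" using finP AB False by (simp add: card_Diff_subset)
    moreover have "2 \<le> card P" using card_mono[OF finP, of "{A, B}"] AB False by auto
    ultimately have card: "card P = Suc (card ?P)" by simp
    have inv: "p x \<in> X" "w ts x \<in> X" if "X \<in> ?P" "x \<in> X" for X x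
      using that P(2,5)[OF AB(1)] P(2,5)[OF AB(3)] P(2,5)[of X] by blast+
    have ab: "a \<in> X \<longleftrightarrow> b \<in> X" if "X \<in> ?P" for X
      using that dis[of X A a] dis[of X B b] AB by blast
    have tsX: "c \<in> X \<longleftrightarrow> d \<in> X" if "X \<in> ?P" "(c, d) \<in> set ts" for X c d
      using that(1) P(3)[OF AB(1) that(2)] P(3)[OF AB(3) that(2)] P(3)[OF _ that(2), of X] by blast
    have inv2: "w (ts @ [t]) x \<in> X" if "X \<in> ?P" "x \<in> X" for X x
    proof -
      have "swp a b x \<in> X" using ab[OF that(1)] that(2) by (metis transpose_apply_first transpose_apply_other transpose_apply_second)
      then show ?thesis unfolding eq o_apply by (rule inv(2)[OF that(1)])
    qed
    have a1: "\<forall>X\<in>?P. \<forall>x\<in>X. p x \<in> X" using inv(1) by blast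
    have a2: "\<forall>X\<in>?P. \<forall>(c, d)\<in>set (ts @ [t]). c \<in> X \<longleftrightarrow> d \<in> X"
    proof (intro ballI, clarify)
      fix X c d assume "X \<in> ?P" "(c, d) \<in> set (ts @ [t])"
      then show "c \<in> X \<longleftrightarrow> d \<in> X" using ab[of X] tsX[of X c d] t by (cases "(c, d) = t") auto
    qed
    have a3: "\<forall>X\<in>?P. \<forall>x\<in>X. w (ts @ [t]) x \<in> X" using inv2 by blast
    have a4: "cyc (w (ts @ [t])) S + cyc p S \<le> 2 * card ?P + length (ts @ [t])"
      using card c P(6) by simp
    show ?thesis by (intro exI[of _ ?P] conjI partition_on_join[OF P(1) AB(1,3)] a1 a2 a3 a4 perm)
  qed
qed

section \<open>Pairings and the genus\<close>

text \<open>Transitivity of the generated group, expressed without the group. For permutations of a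
  finite set a forward invariant subset is also invariant under inverses, so both notions agree (see
  \<open>connected_path_iff\<close>).\<close>

definition transitive_on :: "'a set \<Rightarrow> ('a \<Rightarrow> 'a) set \<Rightarrow> bool" where
  "transitive_on S H \<longleftrightarrow> (\<forall>U\<subseteq>S. U \<noteq> {} \<longrightarrow> (\<forall>h\<in>H. h ` U \<subseteq> U) \<longrightarrow> U = S)"

lemma transitive_onD:
  "transitive_on S H \<Longrightarrow> U \<subseteq> S \<Longrightarrow> U \<noteq> {} \<Longrightarrow> \<forall>h\<in>H. h ` U \<subseteq> U \<Longrightarrow> U = S"
  by (simp add: transitive_on_def)

definition pairings :: "'a set \<Rightarrow> ('a \<Rightarrow> 'a) set" where
  "pairings A = {\<alpha>. \<alpha> permutes A \<and> (\<forall>x\<in>A. \<alpha> x \<noteq> x \<and> \<alpha> (\<alpha> x) = x)}"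

lemma pairings_permutes: "\<alpha> \<in> pairings A \<Longrightarrow> \<alpha> permutes A"
  by (simp add: pairings_def)

lemma pairings_apply_apply: "\<alpha> \<in> pairings A \<Longrightarrow> \<alpha> (\<alpha> x) = x"
  by (cases "x \<in> A") (auto simp: pairings_def permutes_not_in)

lemma pairings_in: "\<alpha> \<in> pairings A \<Longrightarrow> x \<in> A \<Longrightarrow> \<alpha> x \<in> A"
  by (auto simp: pairings_def permutes_in_image)

lemma pairings_neq: "\<alpha> \<in> pairings A \<Longrightarrow> x \<in> A \<Longrightarrow> \<alpha> x \<noteq> x"
  by (simp add: pairings_def)

lemma pairings_comp_self: "\<alpha> \<in> pairings A \<Longrightarrow> \<alpha> \<circ> \<alpha> = id"
  by (simp add: fun_eq_iff pairings_apply_apply)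

lemma finite_pairings: "finite A \<Longrightarrow> finite (pairings A)"
  by (rule finite_subset[OF _ finite_permutations]) (auto simp: pairings_def)

lemma pairings_empty: "pairings {} = {id}"
  by (auto simp: pairings_def permutes_empty permutes_id)

text \<open>Composing with the transposition of a pair turns both its points into fixed points. The
  smaller pairing is thus again a total map that is the identity off its set, and inductions need no
  redefinition of functions.\<close>

lemma pairings_remove_pair:
  assumes al: "\<alpha> \<in> pairings A" and x: "x \<in> A"
  shows "\<alpha> \<circ> swp x (\<alpha> x) \<in> pairings (A - {x, \<alpha> x})"
proof -
  let ?y = "\<alpha> x" and ?b = "\<alpha> \<circ> swp x (\<alpha> x)"
  have y: "?y \<in> A" "?y \<noteq> x" "\<alpha> ?y = x"
    using al x by (auto intro: pairings_in pairings_apply_apply dest: pairings_neq)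
  have p: "?b permutes A" using pairings_permutes[OF al] x y by (intro permutes_compose permutes_swap_id)
  have bx: "?b x = x" "?b ?y = ?y" using y by simp_all
  have other: "?b z = \<alpha> z" if "z \<noteq> x" "z \<noteq> ?y" for z using that by simp
  have b: "?b permutes (A - {x, ?y})"
    using p bx by (intro permutes_superset[OF p]) auto
  moreover have "?b z \<noteq> z \<and> ?b (?b z) = z" if "z \<in> A - {x, ?y}" for z
  proof -
    have "?b z \<in> A - {x, ?y}" using b that by (simp only: permutes_in_image)
    then show ?thesis using that other[of z] other[of "?b z"] pairings_neq[OF al, of z] pairings_apply_apply[OF al, of z]
      by (metis DiffD1 DiffD2 insertCI)
  qed
  ultimately show ?thesis by (simp add: pairings_def)
qed

lemma pairings_insert_pair:
  assumes b: "\<beta> \<in> pairings (A - {x, y})" and xy: "x \<in> A" "y \<in> A" "x \<noteq> y"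
  shows "\<beta> \<circ> swp x y \<in> pairings A"
proof -
  let ?a = "\<beta> \<circ> swp x y"
  have bp: "\<beta> permutes (A - {x, y})" using b by (rule pairings_permutes)
  have bxy: "\<beta> x = x" "\<beta> y = y" using bp by (auto intro!: permutes_not_in)
  have p: "?a permutes A"
    using xy permutes_subset[OF bp, of A] by (intro permutes_compose permutes_swap_id) auto
  have ax: "?a x = y" "?a y = x" using bxy by simp_all
  have other: "?a z = \<beta> z" if "z \<noteq> x" "z \<noteq> y" for z using that by simp
  have "?a z \<noteq> z \<and> ?a (?a z) = z" if z: "z \<in> A" for z
  proof (cases "z = x \<or> z = y")
    case True then show ?thesis using ax xy by metis
  next
    case False
    then have zA: "z \<in> A - {x, y}" using z by simp
    then have "\<beta> z \<in> A - {x, y}" by (rule pairings_in[OF b])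
    then show ?thesis using zA other[of z] other[of "\<beta> z"] pairings_neq[OF b zA] pairings_apply_apply[OF b, of z]
      by (metis DiffD2 insertCI)
  qed
  then show ?thesis using p by (simp add: pairings_def)
qed

lemma pairings_even_card: "finite A \<Longrightarrow> \<alpha> \<in> pairings A \<Longrightarrow> even (card A)"
proof (induction "card A" arbitrary: A \<alpha> rule: less_induct)
  case less
  show ?case
  proof (cases "A = {}")
    case False
    then obtain x where x: "x \<in> A" by auto
    have y: "\<alpha> x \<in> A" "\<alpha> x \<noteq> x" using less.prems x by (auto intro: pairings_in dest: pairings_neq)
    have c: "card (A - {x, \<alpha> x}) = card A - 2" using x y less.prems by (subst card_Diff_subset) auto
    have c2: "2 \<le> card A" using card_mono[of A "{x, \<alpha> x}"] x y less.prems by simp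
    have "even (card (A - {x, \<alpha> x}))"
      by (rule less.hyps) (use c c2 less.prems pairings_remove_pair[OF less.prems(2) x] in auto)
    then show ?thesis using c c2 by simp
  qed simp
qed

text \<open>Prepares \<open>cyc_fold_transpose_partition\<close>: right multiplication by \<alpha>
  becomes a walk with one transposition per pair. The clause that each pair occurs in
  \<open>ts\<close> makes every block respected by \<open>ts\<close> invariant under
  \<alpha>.\<close>

lemma pairings_fold_transpose:
  assumes "finite A" "(\<alpha> :: 'a \<Rightarrow> 'a) \<in> pairings A"
  shows "\<exists>ts :: ('a \<times> 'a) list. length ts = card A div 2 \<and> (\<forall>(a, b)\<in>set ts. a \<in> A \<and> b \<in> A \<and> a \<noteq> b) \<and>
    (\<forall>x\<in>A. (x, \<alpha> x) \<in> set ts \<or> (\<alpha> x, x) \<in> set ts) \<and>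
    (\<forall>p :: 'a \<Rightarrow> 'a. fold swps ts p = p \<circ> \<alpha>)"
  using assms
proof (induction "card A" arbitrary: A \<alpha> rule: less_induct)
  case less
  show ?case
  proof (cases "A = {}")
    case True
    then have "\<alpha> = id" using less.prems by (simp add: pairings_empty)
    then show ?thesis using True by (intro exI[of _ "[]"]) simp
  next
    case False
    then obtain x where x: "x \<in> A" by auto
    let ?y = "\<alpha> x" and ?b = "\<alpha> \<circ> swp x (\<alpha> x)"
    have y: "?y \<in> A" "?y \<noteq> x" "\<alpha> ?y = x"
      using less.prems x by (auto intro: pairings_in pairings_apply_apply dest: pairings_neq)
    have c: "card (A - {x, ?y}) = card A - 2" using x y less.prems by (subst card_Diff_subset) auto
    have c2: "2 \<le> card A" using card_mono[of A "{x, ?y}"] x y less.prems by simp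
    have "card (A - {x, ?y}) < card A" "finite (A - {x, ?y})" using c c2 less.prems by auto
    from less.hyps[OF this pairings_remove_pair[OF less.prems(2) x]]
    obtain ts where ts: "length ts = card (A - {x, ?y}) div 2"
      "\<forall>(a, b)\<in>set ts. a \<in> A - {x, ?y} \<and> b \<in> A - {x, ?y} \<and> a \<noteq> b"
      "\<forall>z\<in>A - {x, ?y}. (z, ?b z) \<in> set ts \<or> (?b z, z) \<in> set ts"
      "\<forall>p :: 'a \<Rightarrow> 'a. fold swps ts p = p \<circ> ?b"
      by (elim exE conjE) (rule that, assumption+)
    have "length (ts @ [(x, ?y)]) = card A div 2" using ts(1) c c2 by simp
    moreover have "\<forall>(a, b)\<in>set (ts @ [(x, ?y)]). a \<in> A \<and> b \<in> A \<and> a \<noteq> b"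
      using ts(2) x y by auto
    moreover have "(z, \<alpha> z) \<in> set (ts @ [(x, ?y)]) \<or> (\<alpha> z, z) \<in> set (ts @ [(x, ?y)])" if "z \<in> A" for z
    proof (cases "z = x \<or> z = ?y")
      case True then show ?thesis using y by auto
    next
      case False
      then have "?b z = \<alpha> z" by simp
      moreover have "z \<in> A - {x, ?y}" using False that by simp
      ultimately show ?thesis using ts(3) by (metis UnCI set_append)
    qed
    moreover have "fold swps (ts @ [(x, ?y)]) p = p \<circ> \<alpha>" for p :: "'a \<Rightarrow> 'a"
    proof -
      have "fold swps (ts @ [(x, ?y)]) p = p \<circ> ?b \<circ> swp x ?y"
        using ts(4) by simp
      also have "\<dots> = p \<circ> \<alpha>" by (rule ext) simp
      finally show ?thesis .
    qed
    ultimately show ?thesis by (intro exI[of _ "ts @ [(x, ?y)]"] conjI) blast+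
  qed
qed

lemma orbit_fixed: "f x = x \<Longrightarrow> orbit f x = {x}"
  by (simp add: orbit_eq_singleton_iff)

text \<open>Each transposition flips the sign and changes the number of cycles by exactly
  one.\<close>

lemma sign_eq_cyc:
  assumes "p permutes S" "finite S"
  shows "sign p = (-1) ^ (card S + cyc p S)"
proof -
  \<comment> \<open>The induction rule multiplies by transpositions on the left, the cycle lemmas on
    the right; passing to the inverse, which has the same cycles, reconciles them.\<close>
  have "sign p = (-1) ^ (card S + cyc (pinv p) S)"
    using assms
  proof (induction rule: permutes_induct)
    case id
    have "pinv (id :: 'a \<Rightarrow> 'a) = id" by simp
    then show ?case by (simp only: cyc_id sign_id) (simp flip: mult_2)
  next
    case (swap a b p)
    have pp: "permutation p" using swap assms by (auto simp: permutation_permutes)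
    have "bij p" using swap by (auto intro: permutes_bij)
    then have eq: "pinv (swp a b \<circ> p) = pinv p \<circ> swp a b"
      by (simp add: o_inv_distrib)
    have ip: "pinv p permutes S" using swap by (intro permutes_inv)
    have "sign (swp a b \<circ> p) = - sign p"
      using swap pp by (simp add: sign_compose permutation_swap_id sign_swap_id)
    moreover have "cyc (pinv p \<circ> swp a b) S = Suc (cyc (pinv p) S) \<or>
      cyc (pinv p) S = Suc (cyc (pinv p \<circ> swp a b) S)"
      using cyc_split[OF ip assms(2) swap(1,2,3)] cyc_merge[OF ip assms(2) swap(1,2)] by blast
    then have "(-1 :: int) ^ (card S + cyc (pinv p \<circ> swp a b) S) =
        - ((-1) ^ (card S + cyc (pinv p) S))" by (elim disjE) simp_all
    ultimately show ?case using swap.IH unfolding eq by (simp only:)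
  qed
  then show ?thesis using assms by (simp add: cyc_inv permutation_permutes[THEN iffD2, OF exI])
qed

text \<open>Every block of the partition from \<open>cyc_fold_transpose_partition\<close> is
  nonempty and invariant under \<open>p\<close> and \<alpha>, so transitivity leaves at most one
  block and the bound becomes \<open>card S div 2 + 2\<close>. Comparing signs shows that the defect
  is even; half of it is the genus.\<close>

lemma genus_exists:
  fixes p \<alpha> :: "'a \<Rightarrow> 'a"
  assumes p: "p permutes S" and S: "finite S" "S \<noteq> {}" and al: "\<alpha> \<in> pairings S"
    and conn: "transitive_on S {p, \<alpha>}"
  shows "\<exists>g. cyc (p \<circ> \<alpha>) S + cyc p S + 2 * g = card S div 2 + 2"
proof -
  obtain ts where ts: "length ts = card S div 2" "\<forall>(a, b)\<in>set ts. a \<in> S \<and> b \<in> S \<and> a \<noteq> b"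
    "\<forall>x\<in>S. (x, \<alpha> x) \<in> set ts \<or> (\<alpha> x, x) \<in> set ts"
    "\<And>q :: 'a \<Rightarrow> 'a. fold swps ts q = q \<circ> \<alpha>"
    using pairings_fold_transpose[OF S(1) al] by blast
  have tsS: "\<forall>(a, b)\<in>set ts. a \<in> S \<and> b \<in> S" using ts(2) by auto
  from cyc_fold_transpose_partition[OF p S(1) tsS]
  obtain P where P: "partition_on S P" "\<forall>B\<in>P. \<forall>x\<in>B. p x \<in> B"
    "\<forall>B\<in>P. \<forall>(a, b)\<in>set ts. a \<in> B \<longleftrightarrow> b \<in> B"
    "cyc (p \<circ> \<alpha>) S + cyc p S \<le> 2 * card P + length ts"
    unfolding ts(4) by (elim exE conjE) (rule that, assumption+)
  have "B = S" if B: "B \<in> P" for B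
  proof -
    have BS: "B \<subseteq> S" using partition_onD1[OF P(1)] B by blast
    have Bn: "B \<noteq> {}" using partition_onD3[OF P(1)] B by auto
    have "\<alpha> x \<in> B" if "x \<in> B" for x
      using ts(3)[rule_format, of x] P(3)[rule_format, OF B, of "(x, \<alpha> x)"]
        P(3)[rule_format, OF B, of "(\<alpha> x, x)"] BS that by auto
    moreover have "p x \<in> B" if "x \<in> B" for x using P(2) B that by blast
    ultimately have "\<forall>h\<in>{p, \<alpha>}. h ` B \<subseteq> B" by auto
    then show ?thesis using conn[unfolded transitive_on_def, rule_format, OF BS Bn] by blast
  qed
  then have "P \<subseteq> {S}" by blast
  then have "card P \<le> 1" using card_mono[of "{S}" P] by simp
  then have le: "cyc (p \<circ> \<alpha>) S + cyc p S \<le> 2 + card S div 2" using P(4) ts(1) by simp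
  have pp: "permutation p" "permutation \<alpha>"
    using p pairings_permutes[OF al] S(1) by (auto simp: permutation_permutes)
  have "sign \<alpha> = (-1) ^ length ts"
  proof -
    have "sign (fold swps us id) = (-1) ^ length us \<and>
      permutation (fold swps us id)"
      if "\<forall>(a, b)\<in>set us. a \<noteq> b" for us :: "('a \<times> 'a) list"
      using that
      by (induction us rule: rev_induct)
        (auto simp: sign_compose permutation_swap_id sign_swap_id permutation_compose)
    note * = this
    have "\<forall>(a, b)\<in>set ts. a \<noteq> b" using ts(2) by auto
    from *[OF this] show ?thesis by (simp only: ts(4) id_o)
  qed
  moreover have "sign (p \<circ> \<alpha>) = sign p * sign \<alpha>" using pp by (rule sign_compose)
  moreover have pa: "p \<circ> \<alpha> permutes S" using p pairings_permutes[OF al] by (rule permutes_compose[rotated])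
  ultimately have "(-1 :: int) ^ (card S + cyc (p \<circ> \<alpha>) S) = (-1) ^ (card S + cyc p S) * (-1) ^ length ts"
    using sign_eq_cyc[OF p S(1)] sign_eq_cyc[OF pa S(1)] by simp
  then have "even (card S + cyc (p \<circ> \<alpha>) S) \<longleftrightarrow> even (card S + cyc p S + length ts)"
    by (simp add: minus_one_power_iff flip: power_add split: if_splits)
  then have "even (card S div 2 + 2 - (cyc (p \<circ> \<alpha>) S + cyc p S))"
    using le ts(1) by auto
  then obtain g where "card S div 2 + 2 - (cyc (p \<circ> \<alpha>) S + cyc p S) = 2 * g" by blast
  then show ?thesis using le by (intro exI[of _ g]) simp
qed

section \<open>Strictly monotone factorisations\<close>

text \<open>The terms of the product of all \<open>1 + J_i\<close>, where the Jucys-Murphy element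
  \<open>J_i\<close> is the sum of the transpositions with larger entry \<open>i\<close>. The shape
  follows \<open>strictly_monotone_paths\<close>, without the starting point.\<close>

definition monotone_factorizations :: "nat \<Rightarrow> (nat \<Rightarrow> nat) \<Rightarrow> (nat \<Rightarrow> nat) list set" where
  "monotone_factorizations n \<omega> = {map (case_prod swp) ps | ps.
     (\<forall>(a, b)\<in>set ps. a \<in> {1..n} \<and> b \<in> {1..n} \<and> a \<noteq> b) \<and>
     sorted_wrt (<) (map (\<lambda>(a, b). max a b) ps) \<and>
     foldr (\<circ>) (map (case_prod swp) ps) id = \<omega>}"

lemma foldr_comp: "foldr (\<circ>) xs g = foldr (\<circ>) xs id \<circ> g" for g :: "'a \<Rightarrow> 'a"
  by (induction xs) (simp_all add: o_assoc)

lemma foldr_transpose_permutes: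
  "\<forall>(a, b)\<in>set ps. a \<in> S \<and> b \<in> S \<Longrightarrow>
    foldr (\<circ>) (map (case_prod swp) ps) id permutes S"
proof (induction ps)
  case Nil
  have "foldr (\<circ>) (map (case_prod swp) []) id = id" by simp
  then show ?case by (metis permutes_id)
next
  case (Cons t ps)
  obtain a b where t: "t = (a, b)" by force
  have "foldr (\<circ>) (map (case_prod swp) (t # ps)) id =
      swp a b \<circ> foldr (\<circ>) (map (case_prod swp) ps) id"
    by (simp add: t)
  moreover have "foldr (\<circ>) (map (case_prod swp) ps) id permutes S"
    by (rule Cons.IH) (use Cons.prems in simp)
  moreover have "swp a b permutes S"
    by (rule permutes_swap_id) (use Cons.prems t in simp_all)
  ultimately show ?case using permutes_compose by metis
qed

text \<open>Since the larger entries increase strictly, only the last factor can move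
  \<open>Suc n\<close>. The product applies it before all others, which fix \<open>Suc n\<close>, so
  its smaller entry is the preimage \<open>c\<close> of \<open>Suc n\<close> under \<omega>; if
  \<open>Suc n\<close> is fixed, no factor moves it.\<close>

lemma monotone_factorizations_Suc:
  assumes c: "\<omega> c = Suc n" and w: "\<omega> permutes {1..Suc n}"
  shows "monotone_factorizations (Suc n) \<omega> =
    (if c = Suc n then monotone_factorizations n \<omega>
     else (\<lambda>\<tau>s. \<tau>s @ [swp c (Suc n)]) `
       monotone_factorizations n (\<omega> \<circ> swp c (Suc n)))" (is "?L = ?R")
proof (intro equalityI subsetI)
  let ?T = "map (case_prod swp) :: (nat \<times> nat) list \<Rightarrow> _"
  let ?M = "map (\<lambda>(a, b). max a b) :: (nat \<times> nat) list \<Rightarrow> _"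
  have c_in: "c \<in> {1..Suc n}" using c w permutes_in_image[OF w, of c] by simp
  fix \<tau>s assume "\<tau>s \<in> ?L"
  then obtain ps where ps: "\<tau>s = ?T ps" "\<forall>(a, b)\<in>set ps. a \<in> {1..Suc n} \<and> b \<in> {1..Suc n} \<and> a \<noteq> b"
    "sorted_wrt (<) (?M ps)" "foldr (\<circ>) (?T ps) id = \<omega>"
    unfolding monotone_factorizations_def by blast
  show "\<tau>s \<in> ?R"
  proof (cases "\<forall>(a, b)\<in>set ps. a \<in> {1..n} \<and> b \<in> {1..n}")
    case True
    have "\<omega> permutes {1..n}" using foldr_transpose_permutes[OF True] ps(4) by simp
    then have "\<omega> (Suc n) = Suc n" by (auto intro: permutes_not_in)
    then have "c = Suc n" using c permutes_inj[OF w] by (metis injD)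
    moreover have "\<forall>(a, b)\<in>set ps. a \<in> {1..n} \<and> b \<in> {1..n} \<and> a \<noteq> b" using True ps(2) by fast
    then have "\<tau>s \<in> monotone_factorizations n \<omega>"
      unfolding monotone_factorizations_def using ps(1,3,4) by blast
    ultimately show ?thesis by simp
  next
    case False
    then obtain a b where ab1: "(a, b) \<in> set ps" "\<not> (a \<in> {1..n} \<and> b \<in> {1..n})" by auto
    then have "a \<in> {1..Suc n} \<and> b \<in> {1..Suc n}" using ps(2) by auto
    then have ab: "(a, b) \<in> set ps" "max a b = Suc n" using ab1 by auto
    then have "ps \<noteq> []" by auto
    then obtain qs a' b' where qs: "ps = qs @ [(a', b')]" by (metis rev_exhaust surj_pair)
    have qs_less: "max x y < max a' b'" if "(x, y) \<in> set qs" for x y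
      using ps(3) that unfolding qs by (auto simp: sorted_wrt_append)
    have ab': "a' \<in> {1..Suc n}" "b' \<in> {1..Suc n}" "a' \<noteq> b'" using ps(2) qs by auto
    then have "max a' b' \<le> Suc n" by simp
    then have max': "max a' b' = Suc n" using ab qs_less[of a b] unfolding qs by auto
    obtain d where d: "swp a' b' = swp d (Suc n)" "d \<in> {1..n}"
    proof (cases "b' = Suc n")
      case True then show ?thesis using that[of a'] ab' by auto
    next
      case False
      then have "a' = Suc n" using max' by (auto simp: max_def split: if_splits)
      then show ?thesis using that[of b'] ab' by (auto simp: transpose_commute)
    qed
    have qs_in: "\<forall>(x, y)\<in>set qs. x \<in> {1..n} \<and> y \<in> {1..n} \<and> x \<noteq> y"
    proof (intro ballI, clarify)
      fix x y assume xy: "(x, y) \<in> set qs"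
      then have "x \<in> {1..Suc n} \<and> y \<in> {1..Suc n} \<and> x \<noteq> y" using ps(2) qs by auto
      then show "x \<in> {1..n} \<and> y \<in> {1..n} \<and> x \<noteq> y" using qs_less[OF xy] max' by auto
    qed
    have w': "\<omega> = foldr (\<circ>) (?T qs) id \<circ> swp d (Suc n)"
      using ps(4) foldr_comp[of "?T qs" "swp a' b'"] unfolding qs by (simp add: d(1))
    have "foldr (\<circ>) (?T qs) id permutes {1..n}"
      by (rule foldr_transpose_permutes) (use qs_in in fast)
    then have "foldr (\<circ>) (?T qs) id (Suc n) = Suc n" by (rule permutes_not_in) simp
    then have "\<omega> d = Suc n" unfolding w' by simp
    then have "d = c" using c permutes_inj[OF w] by (metis injD)
    have "?T qs \<in> monotone_factorizations n (\<omega> \<circ> swp c (Suc n))"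
      unfolding monotone_factorizations_def
    proof (rule CollectI, intro exI conjI)
      show "sorted_wrt (<) (?M qs)" using ps(3) unfolding qs by (simp add: sorted_wrt_append)
      show "foldr (\<circ>) (?T qs) id = \<omega> \<circ> swp c (Suc n)"
        unfolding w' \<open>d = c\<close> by (rule ext) simp
    qed (use qs_in in simp_all)
    moreover have "\<tau>s = ?T qs @ [swp c (Suc n)]"
      using ps(1) qs d(1) \<open>d = c\<close> by simp
    moreover have "c \<noteq> Suc n" using d(2) \<open>d = c\<close> by auto
    ultimately show ?thesis by auto
  qed
next
  let ?T = "map (case_prod swp) :: (nat \<times> nat) list \<Rightarrow> _"
  let ?M = "map (\<lambda>(a, b). max a b) :: (nat \<times> nat) list \<Rightarrow> _"
  have c_in: "c \<in> {1..Suc n}" using c w permutes_in_image[OF w, of c] by simp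
  fix \<tau>s assume R: "\<tau>s \<in> ?R"
  show "\<tau>s \<in> ?L"
  proof (cases "c = Suc n")
    case True
    then obtain ps where ps: "\<tau>s = ?T ps" "\<forall>(a, b)\<in>set ps. a \<in> {1..n} \<and> b \<in> {1..n} \<and> a \<noteq> b"
      "sorted_wrt (<) (?M ps)" "foldr (\<circ>) (?T ps) id = \<omega>"
      using R unfolding monotone_factorizations_def by auto
    have "\<forall>(a, b)\<in>set ps. a \<in> {1..Suc n} \<and> b \<in> {1..Suc n} \<and> a \<noteq> b" using ps(2) by force
    then show ?thesis unfolding monotone_factorizations_def using ps by blast
  next
    case False
    then have "\<tau>s \<in> (\<lambda>\<tau>s. \<tau>s @ [swp c (Suc n)]) `
       monotone_factorizations n (\<omega> \<circ> swp c (Suc n))" using R by simp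
    then obtain ps where ps: "\<tau>s = ?T ps @ [swp c (Suc n)]"
      "\<forall>(a, b)\<in>set ps. a \<in> {1..n} \<and> b \<in> {1..n} \<and> a \<noteq> b"
      "sorted_wrt (<) (?M ps)" "foldr (\<circ>) (?T ps) id = \<omega> \<circ> swp c (Suc n)"
      unfolding monotone_factorizations_def by auto
    let ?ps = "ps @ [(c, Suc n)]"
    have 1: "\<tau>s = ?T ?ps" using ps(1) by simp
    have 2: "\<forall>(a, b)\<in>set ?ps. a \<in> {1..Suc n} \<and> b \<in> {1..Suc n} \<and> a \<noteq> b"
      using ps(2) c_in False by force
    have 3: "sorted_wrt (<) (?M ?ps)" using ps(2,3) c_in by (fastforce simp: sorted_wrt_append)
    have "foldr (\<circ>) (?T ?ps) id = \<omega> \<circ> swp c (Suc n) \<circ> swp c (Suc n)"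
      using ps(4) foldr_comp[of "?T ps" "swp c (Suc n)"] by simp
    then have 4: "foldr (\<circ>) (?T ?ps) id = \<omega>" by (simp add: fun_eq_iff)
    show ?thesis unfolding monotone_factorizations_def using 1 2 3 4 by blast
  qed
qed

lemma cyc_fixed_Suc:
  assumes "\<omega> (Suc n) = Suc n" "\<omega> permutes {1..n}"
  shows "cyc \<omega> {1..Suc n} = Suc (cyc \<omega> {1..n})"
proof -
  have "orbit \<omega> (Suc n) = {Suc n}" using assms by (intro orbit_fixed)
  moreover have "{Suc n} \<notin> orbit \<omega> ` {1..n}"
    using permutes_orbit_subset[OF assms(2)] by fastforce
  moreover have "{1..Suc n} = insert (Suc n) {1..n}" by auto
  ultimately show ?thesis by (simp add: cyc_def)
qed

text \<open>By the recursion above, the last factor is determined and what remains permutes fewer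
  points. The clause on invariant sets is what later transfers connectedness from the path to its
  end points.\<close>

theorem monotone_factorization_unique:
  assumes "\<omega> permutes {1..n}"
  shows "\<exists>\<tau>s. monotone_factorizations n \<omega> = {\<tau>s} \<and> length \<tau>s + cyc \<omega> {1..n} = n \<and>
    (\<forall>U. \<omega> ` U \<subseteq> U \<longrightarrow> (\<forall>\<tau>\<in>set \<tau>s. \<tau> ` U \<subseteq> U))"
  using assms
proof (induction n arbitrary: \<omega>)
  case 0
  then have "\<omega> = id" by simp
  moreover have "ps = []" if "\<forall>(a, b)\<in>set ps. a \<in> {1..0} \<and> b \<in> {1..0} \<and> a \<noteq> b" for ps :: "(nat \<times> nat) list"
    using that by (cases ps) auto
  then have "monotone_factorizations 0 id = {[]}" unfolding monotone_factorizations_def by fastforce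
  moreover have "cyc id {1..0::nat} = 0" by (simp add: cyc_def)
  ultimately have "monotone_factorizations 0 \<omega> = {[]} \<and> length ([] :: (nat \<Rightarrow> nat) list) + cyc \<omega> {1..0} = 0 \<and>
    (\<forall>U. \<omega> ` U \<subseteq> U \<longrightarrow> (\<forall>\<tau>\<in>set []. \<tau> ` U \<subseteq> U))" by simp
  then show ?case by blast
next
  case (Suc n)
  obtain c where c: "\<omega> c = Suc n" using permutes_surj[OF Suc.prems] by (metis surjD)
  have cin: "c \<in> {1..Suc n}" using c permutes_in_image[OF Suc.prems, of c] by simp
  show ?case
  proof (cases "c = Suc n")
    case True
    then have "\<omega> permutes {1..n}" using c Suc.prems
      by (intro permutes_superset[OF Suc.prems]) (auto simp: le_Suc_eq)
    with Suc.IH[OF this] show ?thesis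
      unfolding monotone_factorizations_Suc[OF c Suc.prems] using True c cyc_fixed_Suc[of \<omega> n]
      by auto
  next
    case False
    let ?t = "swp c (Suc n)"
    let ?w = "\<omega> \<circ> ?t"
    have pw: "permutation \<omega>" using Suc.prems by (auto simp: permutation_permutes)
    have fix_n: "?w (Suc n) = Suc n" using c by simp
    have w1: "?w permutes {1..Suc n}" using cin Suc.prems by (intro permutes_compose permutes_swap_id) auto
    have w: "?w permutes {1..n}"
      by (rule permutes_superset[OF w1]) (use fix_n in \<open>auto simp: le_Suc_eq\<close>)
    obtain \<tau>s where t: "monotone_factorizations n ?w = {\<tau>s}" "length \<tau>s + cyc ?w {1..n} = n"
      "\<And>U. ?w ` U \<subseteq> U \<Longrightarrow> \<forall>\<tau>\<in>set \<tau>s. \<tau> ` U \<subseteq> U"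
      using Suc.IH[OF w] by blast
    have orb: "Suc n \<in> orbit \<omega> c" using c orbit.base[of \<omega> c] by simp
    have "cyc ?w {1..Suc n} = Suc (cyc \<omega> {1..Suc n})"
      by (rule cyc_split[OF Suc.prems]) (use cin False orb in auto)
    \<comment> \<open>Cutting off \<open>Suc n\<close> adds a cycle, and forgetting this fixed point
      removes it again. The cycle number stays, while the number of points and the length both grow
      by one.\<close>
    then have len: "cyc \<omega> {1..Suc n} = cyc ?w {1..n}" using cyc_fixed_Suc[OF fix_n w] by simp
    have inv: "\<tau> ` U \<subseteq> U" if U: "\<omega> ` U \<subseteq> U" and \<tau>: "\<tau> \<in> set (\<tau>s @ [?t])" for U \<tau>
    proof -
      have "Suc n \<in> U" if "c \<in> U" using U that c by force
      moreover have "c \<in> U" if "Suc n \<in> U"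
      \<comment> \<open>An invariant set contains the whole cycle of each of its points, and
        \<open>c\<close> and \<open>Suc n\<close> lie on the same cycle, so the transposition
        preserves the set.\<close>
      proof -
        have "c \<in> orbit \<omega> (Suc n)" using orb orbit_eq_iff[OF pw] by metis
        then show ?thesis using orbit_subset_invariant[OF U that] by blast
      qed
      ultimately have tU: "?t ` U \<subseteq> U" by (auto simp: Transposition.transpose_def)
      have "?w ` U = \<omega> ` ?t ` U" by (simp only: image_comp)
      also have "\<dots> \<subseteq> U" using U tU by blast
      finally have "\<forall>\<tau>\<in>set \<tau>s. \<tau> ` U \<subseteq> U" by (rule t(3))
      moreover have "\<tau> \<in> set \<tau>s \<or> \<tau> = ?t" using \<tau> by auto
      ultimately show ?thesis using tU by blast
    qed
    show ?thesis
      unfolding monotone_factorizations_Suc[OF c Suc.prems] using False t(1,2) len inv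
      by (intro exI[of _ "\<tau>s @ [?t]"]) simp
  qed
qed

lemma invariant_inv:
  assumes p: "p permutes S" and "finite U" and U: "p ` U \<subseteq> U"
  shows "pinv p ` U \<subseteq> U"
proof -
  have inj: "inj p" using p by (rule permutes_inj)
  have "p ` U = U" using endo_inj_surj[OF \<open>finite U\<close> U] inj by (meson inj_on_subset subset_UNIV)
  then have "pinv p ` U = pinv p ` (p ` U)" by simp
  then show ?thesis using inj by (simp add: image_comp inv_o_cancel)
qed

text \<open>From left to right, sets preserved by the generators are preserved by the whole group,
  by induction over \<open>generate\<close>; finiteness is what covers the inverses. From right to
  left, the set of all images of a point under the group is itself preserved, hence
  everything.\<close>

lemma connected_path_iff:
  assumes \<rho>: "\<rho> permutes {1..L}" and \<tau>: "\<forall>\<tau>\<in>set \<tau>s. \<tau> permutes {1..L}"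
  shows "connected_path L (\<tau>s, \<rho>) \<longleftrightarrow> transitive_on {1..L} (insert \<rho> (set \<tau>s))"
proof -
  let ?H = "insert \<rho> (set \<tau>s)"
  have H: "h permutes {1..L}" if "h \<in> ?H" for h using that \<rho> \<tau> by auto
  define I where "I U \<longleftrightarrow> U \<subseteq> {1..L} \<and> (\<forall>h\<in>?H. h ` U \<subseteq> U)" for U
  have IH: "h ` U \<subseteq> U" if "I U" "h \<in> ?H" for U h using that unfolding I_def by blast
  have Ifin: "finite U" if "I U" for U using that finite_subset[of U "{1..L}"] unfolding I_def by blast
  have gen: "p permutes {1..L} \<and> (\<forall>U. I U \<longrightarrow> p ` U \<subseteq> U)"
    if "p \<in> generate (sym_group L) ?H" for p
    using that
  proof induction
    case one
    have "id ` U \<subseteq> U" for U :: "nat set" by simp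
    then show ?case unfolding sym_group_one using permutes_id by blast
  next
    case (incl h)
    have "h permutes {1..L}" by (rule H) (rule incl.hyps)
    moreover have "h ` U \<subseteq> U" if "I U" for U by (rule IH[OF that incl.hyps])
    ultimately show ?case by blast
  next
    case (inv h)
    have hp: "h permutes {1..L}" by (rule H) (rule inv.hyps)
    have "inv\<^bsub>sym_group L\<^esub> h = pinv h"
    proof (rule group.inv_equality[OF sym_group_is_group])
      show "pinv h \<otimes>\<^bsub>sym_group L\<^esub> h = \<one>\<^bsub>sym_group L\<^esub>"
        using permutes_inv_o(2)[OF hp] by (simp add: sym_group_mult sym_group_one)
    qed (use hp in \<open>auto simp: sym_group_carrier intro: permutes_inv\<close>)
    then have e: "inv\<^bsub>sym_group L\<^esub> h = pinv h" .
    have "pinv h ` U \<subseteq> U" if "I U" for U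
      by (rule invariant_inv[OF hp Ifin[OF that] IH[OF that inv.hyps]])
    then show ?case unfolding e using permutes_inv[OF hp] by blast
  next
    case (eng p q)
    have "(p \<circ> q) ` U \<subseteq> U" if "I U" for U
    proof -
      have "p ` U \<subseteq> U" "q ` U \<subseteq> U" using eng.IH that by blast+
      then show ?thesis unfolding image_comp[symmetric] by blast
    qed
    moreover have "p \<circ> q permutes {1..L}" by (rule permutes_compose[OF conjunct1[OF eng.IH(2)] conjunct1[OF eng.IH(1)]])
    ultimately show ?case unfolding sym_group_mult by blast
  qed
  show ?thesis
  proof
    assume c: "connected_path L (\<tau>s, \<rho>)"
    show "transitive_on {1..L} ?H" unfolding transitive_on_def
    proof (intro allI impI)
      fix U assume U: "U \<subseteq> {1..L}" "U \<noteq> {}" "\<forall>h\<in>?H. h ` U \<subseteq> U"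
      obtain x where x: "x \<in> U" using U by auto
      have "y \<in> U" if y: "y \<in> {1..L}" for y
      proof -
        obtain p where "p \<in> generate (sym_group L) ?H" "p x = y"
          using c x y subsetD[OF U(1) x] unfolding connected_path_def by (auto simp del: atLeastAtMost_iff)
        moreover have "p ` U \<subseteq> U" using gen[OF calculation(1)] U(1,3) unfolding I_def by blast
        ultimately show ?thesis using x by blast
      qed
      then show "U = {1..L}" using U by blast
    qed
  next
    assume t: "transitive_on {1..L} ?H"
    have "\<exists>p\<in>generate (sym_group L) ?H. p x = y" if xy: "x \<in> {1..L}" "y \<in> {1..L}" for x y
    proof -
      let ?U = "{p x | p. p \<in> generate (sym_group L) ?H}"
      have "?U \<subseteq> {1..L}"
      proof
        fix z assume "z \<in> ?U"
        then obtain p where p: "p \<in> generate (sym_group L) ?H" "z = p x" by blast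
        have "p permutes {1..L}" using gen[OF p(1)] by blast
        then show "z \<in> {1..L}" using p(2) xy(1) permutes_in_image by metis
      qed
      moreover have "?U \<noteq> {}" using generate.one[of "sym_group L" ?H] by blast
      moreover have "h ` ?U \<subseteq> ?U" if "h \<in> ?H" for h
      proof
        fix z assume "z \<in> h ` ?U"
        then obtain p where p: "p \<in> generate (sym_group L) ?H" "z = h (p x)" by blast
        have "h \<circ> p \<in> generate (sym_group L) ?H"
          using generate.eng[OF generate.incl[OF that] p(1)] by (simp add: sym_group_mult)
        then show "z \<in> ?U" using p(2) by (metis (mono_tags, lifting) comp_apply mem_Collect_eq)
      qed
      ultimately have "?U = {1..L}" using t[unfolded transitive_on_def, rule_format, of ?U] by blast
      then have "y \<in> ?U" using xy by (simp only:)
      then show ?thesis by blast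
    qed
    then show "connected_path L (\<tau>s, \<rho>)" unfolding connected_path_def by simp
  qed
qed

section \<open>Counting pairings and conjugation\<close>

text \<open>A pairing is determined by the partner of \<open>z\<close> and the pairing of the
  remaining points. This one recursion serves both the number of pairings and Wick's
  formula.\<close>

lemma bij_betw_pairings_insert:
  assumes z: "z \<notin> D"
  shows "bij_betw (\<lambda>(y, \<beta>). \<beta> \<circ> swp z y) (SIGMA y:D. pairings (D - {y})) (pairings (insert z D))"
proof (rule bij_betw_byWitness[where f' = "\<lambda>\<alpha>. (\<alpha> z, \<alpha> \<circ> swp z (\<alpha> z))"])
  have e: "insert z D - {z, y} = D - {y}" for y using z by auto
  show "\<forall>x\<in>SIGMA y:D. pairings (D - {y}).
      (\<lambda>\<alpha>. (\<alpha> z, \<alpha> \<circ> swp z (\<alpha> z))) ((\<lambda>(y, \<beta>). \<beta> \<circ> swp z y) x) = x"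
  proof
    fix p assume "p \<in> (SIGMA y:D. pairings (D - {y}))"
    then obtain y \<beta> where p: "p = (y, \<beta>)" and y: "y \<in> D" and b: "\<beta> \<in> pairings (D - {y})" by blast
    have "\<beta> y = y" using pairings_permutes[OF b] by (intro permutes_not_in) auto
    then have "(\<beta> \<circ> swp z y) z = y" by simp
    moreover have "\<beta> \<circ> swp z y \<circ> swp z y = \<beta>" by (rule ext) simp
    ultimately show "(\<lambda>\<alpha>. (\<alpha> z, \<alpha> \<circ> swp z (\<alpha> z))) ((\<lambda>(y, \<beta>). \<beta> \<circ> swp z y) p) = p"
      unfolding p prod.case by (simp only:)
  qed
  show "\<forall>\<alpha>\<in>pairings (insert z D). (\<lambda>(y, \<beta>). \<beta> \<circ> swp z y)
      (\<alpha> z, \<alpha> \<circ> swp z (\<alpha> z)) = \<alpha>"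
    by (simp add: fun_eq_iff)
  show "(\<lambda>(y, \<beta>). \<beta> \<circ> swp z y) ` (SIGMA y:D. pairings (D - {y})) \<subseteq> pairings (insert z D)"
  proof (rule image_subsetI)
    fix p assume "p \<in> (SIGMA y:D. pairings (D - {y}))"
    then obtain y \<beta> where p: "p = (y, \<beta>)" and y: "y \<in> D" and b: "\<beta> \<in> pairings (D - {y})" by blast
    show "(\<lambda>(y, \<beta>). \<beta> \<circ> swp z y) p \<in> pairings (insert z D)"
      unfolding p prod.case by (rule pairings_insert_pair) (use y z b e[of y] in auto)
  qed
  show "(\<lambda>\<alpha>. (\<alpha> z, \<alpha> \<circ> swp z (\<alpha> z))) ` pairings (insert z D) \<subseteq> (SIGMA y:D. pairings (D - {y}))"
  proof (rule image_subsetI)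
    fix \<alpha> assume a: "\<alpha> \<in> pairings (insert z D)"
    have "\<alpha> z \<in> D" using pairings_in[OF a, of z] pairings_neq[OF a, of z] by auto
    moreover have "\<alpha> \<circ> swp z (\<alpha> z) \<in> pairings (D - {\<alpha> z})"
      using pairings_remove_pair[OF a, of z] by (simp only: e insertI1)
    ultimately show "(\<alpha> z, \<alpha> \<circ> swp z (\<alpha> z)) \<in> (SIGMA y:D. pairings (D - {y}))" by blast
  qed
qed

lemma sum_pairings_insert:
  assumes "finite D" "z \<notin> D"
  shows "(\<Sum>\<alpha>\<in>pairings (insert z D). f \<alpha>) =
    (\<Sum>y\<in>D. \<Sum>\<beta>\<in>pairings (D - {y}). f (\<beta> \<circ> swp z y))"
proof -
  have "(\<Sum>\<alpha>\<in>pairings (insert z D). f \<alpha>) =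
      (\<Sum>p\<in>(SIGMA y:D. pairings (D - {y})). f ((\<lambda>(y, \<beta>). \<beta> \<circ> swp z y) p))"
    by (rule sum.reindex_bij_betw[symmetric]) (rule bij_betw_pairings_insert[OF assms(2)])
  also have "\<dots> = (\<Sum>(y, \<beta>)\<in>(SIGMA y:D. pairings (D - {y})). f (\<beta> \<circ> swp z y))"
    by (simp add: case_prod_unfold)
  also have "\<dots> = (\<Sum>y\<in>D. \<Sum>\<beta>\<in>pairings (D - {y}). f (\<beta> \<circ> swp z y))"
    using assms by (subst sum.Sigma) (auto intro: finite_pairings)
  finally show ?thesis .
qed

text \<open>A point of a set with \<open>2m + 2\<close> elements has \<open>2m + 1\<close> possible
  partners. The factor \<open>2^m m!\<close>, moved to the left to avoid division, is the
  normalisation of the Hurwitz numbers.\<close>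

lemma card_pairings:
  "finite A \<Longrightarrow> card A = 2 * m \<Longrightarrow> card (pairings A) * (2 ^ m * fact m) = fact (2 * m)"
proof (induction m arbitrary: A)
  case 0
  then show ?case by (simp add: pairings_empty)
next
  case (Suc m)
  then obtain z where z: "z \<in> A" by fastforce
  let ?D = "A - {z}"
  have D: "finite ?D" "card ?D = 2 * m + 1" "insert z ?D = A" using Suc.prems z by auto
  have "card (pairings A) = (\<Sum>\<alpha>\<in>pairings (insert z ?D). 1)" unfolding D(3) by simp
  also have "\<dots> = (\<Sum>y\<in>?D. \<Sum>\<beta>\<in>pairings (?D - {y}). 1)" by (rule sum_pairings_insert) (use D in auto)
  also have "\<dots> = (\<Sum>y\<in>?D. card (pairings (?D - {y})))" by (simp only: card_eq_sum)
  finally have c: "card (pairings A) = (\<Sum>y\<in>?D. card (pairings (?D - {y})))" .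
  have IH: "card (pairings (?D - {y})) * (2 ^ m * fact m) = fact (2 * m)" if "y \<in> ?D" for y
    by (rule Suc.IH) (use that D in auto)
  have "card (pairings A) * (2 ^ m * fact m) = (\<Sum>y\<in>?D. card (pairings (?D - {y})) * (2 ^ m * fact m))"
    by (simp only: c sum_distrib_right)
  also have "\<dots> = (\<Sum>y\<in>?D. fact (2 * m))" by (rule sum.cong[OF refl]) (rule IH)
  also have "\<dots> = (2 * m + 1) * fact (2 * m)" using D(2) by simp
  finally have "card (pairings A) * (2 ^ m * fact m) * (2 * Suc m) = (2 * m + 1) * fact (2 * m) * (2 * Suc m)"
    by (simp only:)
  also have "\<dots> = fact (2 * Suc m)" by (simp add: algebra_simps)
  finally show ?case by (simp add: algebra_simps)
qed

text \<open>Pairs are matched one by one. Two different ground sets are allowed because, after a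
  pair has been removed on each side, the remaining sets differ even when the original ones
  agree.\<close>

lemma pairings_isomorphic:
  assumes "finite A" "finite B" "card A = card B" "\<alpha> \<in> pairings A" "\<beta> \<in> pairings B"
  shows "\<exists>h. bij_betw h A B \<and> (\<forall>x\<in>A. h (\<alpha> x) = \<beta> (h x))"
  using assms
proof (induction "card A" arbitrary: A B \<alpha> \<beta> rule: less_induct)
  case less
  show ?case
  proof (cases "A = {}")
    case True
    then show ?thesis using less.prems by (auto simp: bij_betw_def)
  next
    case False
    then obtain x where x: "x \<in> A" by auto
    have "B \<noteq> {}" using False less.prems by auto
    then obtain u where u: "u \<in> B" by auto
    define y where "y = \<alpha> x" define v where "v = \<beta> u"
    have y: "y \<in> A" "y \<noteq> x" "\<alpha> y = x" "\<alpha> x = y" unfolding y_def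
      using less.prems(4) x by (auto intro: pairings_in pairings_apply_apply dest: pairings_neq)
    have v: "v \<in> B" "v \<noteq> u" "\<beta> v = u" "\<beta> u = v" unfolding v_def
      using less.prems(5) u by (auto intro: pairings_in pairings_apply_apply dest: pairings_neq)
    let ?a = "\<alpha> \<circ> swp x y" and ?b = "\<beta> \<circ> swp u v"
    have c: "card (A - {x, y}) = card A - 2" using x y less.prems by (subst card_Diff_subset) auto
    have c': "card (B - {u, v}) = card B - 2" using u v less.prems by (subst card_Diff_subset) auto
    have c2: "2 \<le> card A" using card_mono[of A "{x, y}"] x y less.prems by simp
    have pa: "?a \<in> pairings (A - {x, y})" using pairings_remove_pair[OF less.prems(4) x] by (simp only: y_def)
    have pb: "?b \<in> pairings (B - {u, v})" using pairings_remove_pair[OF less.prems(5) u] by (simp only: v_def)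
    have "\<exists>h. bij_betw h (A - {x, y}) (B - {u, v}) \<and> (\<forall>z\<in>A - {x, y}. h (?a z) = ?b (h z))"
      by (rule less.hyps[OF _ _ _ _ pa pb]) (use c c' c2 less.prems in auto)
    then obtain h where h: "bij_betw h (A - {x, y}) (B - {u, v})" "\<And>z. z \<in> A - {x, y} \<Longrightarrow> h (?a z) = ?b (h z)"
      by blast
    define k where "k = h(x := u, y := v)"
    have kz: "k z = h z" if "z \<in> A - {x, y}" for z using that by (simp add: k_def)
    have kxy: "k x = u" "k y = v" using y by (auto simp: k_def)
    have "bij_betw k (A - {x, y}) (B - {u, v})" using h(1) kz by (metis bij_betw_cong)
    moreover have "bij_betw k {x, y} {u, v}" using kxy y v by (auto simp: bij_betw_def)
    ultimately have "bij_betw k (A - {x, y} \<union> {x, y}) (B - {u, v} \<union> {u, v})" by (rule bij_betw_combine) auto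
    moreover have "A - {x, y} \<union> {x, y} = A" "B - {u, v} \<union> {u, v} = B" using x y u v by auto
    moreover have "k (\<alpha> z) = \<beta> (k z)" if z: "z \<in> A" for z
    proof (cases "z = x \<or> z = y")
      case True
      then show ?thesis using kxy y v by auto
    next
      case False
      then have zA: "z \<in> A - {x, y}" using z by simp
      have hz: "h z \<in> B - {u, v}" using bij_betwE[OF h(1)] zA by blast
      have az: "?a z = \<alpha> z" using zA by simp
      have "\<alpha> z \<in> A - {x, y}" using pairings_in[OF pa zA] unfolding az .
      then have "k (\<alpha> z) = h (\<alpha> z)" by (rule kz)
      also have "\<dots> = ?b (h z)" using h(2)[OF zA] unfolding az .
      also have "\<dots> = \<beta> (h z)" using hz by simp
      finally show ?thesis using kz[OF zA] by simp
    qed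
    ultimately show ?thesis by auto
  qed
qed

lemma pairings_conjugate:
  assumes "finite S" "\<alpha> \<in> pairings S" "\<beta> \<in> pairings S"
  shows "\<exists>\<pi>. \<pi> permutes S \<and> \<pi> \<circ> \<alpha> = \<beta> \<circ> \<pi>"
proof -
  obtain h where h: "bij_betw h S S" "\<And>x. x \<in> S \<Longrightarrow> h (\<alpha> x) = \<beta> (h x)"
    using pairings_isomorphic[OF assms(1,1) refl assms(2,3)] by blast
  define \<pi> where "\<pi> x = (if x \<in> S then h x else x)" for x
  have "bij_betw \<pi> S S" using h(1) by (rule bij_betw_cong[THEN iffD1, rotated]) (simp add: \<pi>_def)
  then have p: "\<pi> permutes S" by (rule bij_imp_permutes) (simp add: \<pi>_def)
  have "\<pi> (\<alpha> x) = \<beta> (\<pi> x)" for x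
  proof (cases "x \<in> S")
    case True
    then show ?thesis using h(2) pairings_in[OF assms(2)] by (simp add: \<pi>_def)
  next
    case False
    then show ?thesis
      using permutes_not_in[OF pairings_permutes[OF assms(2)] False]
        permutes_not_in[OF pairings_permutes[OF assms(3)] False] by (simp add: \<pi>_def)
  qed
  then show ?thesis using p by (auto simp: fun_eq_iff)
qed

section \<open>Invariance under conjugation\<close>

lemma orbit_conjugate:
  assumes "\<And>x. h (f x) = g (h x)"
  shows "orbit g (h x) = h ` orbit f x"
proof (intro equalityI subsetI)
  fix y assume "y \<in> orbit g (h x)"
  then show "y \<in> h ` orbit f x"
  proof induction
    case base
    have "g (h x) = h (f x)" by (simp add: assms)
    then show ?case using orbit.base[of f x] by (metis image_eqI)
  next
    case (step y)
    then obtain z where z: "z \<in> orbit f x" "y = h z" by blast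
    then have "g y = h (f z)" by (simp add: assms)
    then show ?case using orbit.step[OF z(1)] by (metis image_eqI)
  qed
next
  fix y assume "y \<in> h ` orbit f x"
  then obtain z where "z \<in> orbit f x" "y = h z" by blast
  from this(1) have "h z \<in> orbit g (h x)"
    by induction (simp_all add: assms orbit.intros)
  then show "y \<in> orbit g (h x)" using \<open>y = h z\<close> by simp
qed

lemma orbits_conjugate:
  assumes "\<pi> permutes S" "\<And>x. \<pi> (f x) = g (\<pi> x)"
  shows "orbit g ` S = image \<pi> ` orbit f ` S"
proof -
  have "orbit g ` S = orbit g ` \<pi> ` S" using permutes_image[OF assms(1)] by simp
  also have "\<dots> = image \<pi> ` orbit f ` S" using orbit_conjugate[of \<pi> f g] assms(2) by (auto simp: image_image)
  finally show ?thesis .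
qed

lemma cyc_conjugate:
  assumes "\<pi> permutes S" "\<And>x. \<pi> (f x) = g (\<pi> x)"
  shows "cyc g S = cyc f S"
proof -
  have "inj_on (image \<pi>) X" for X :: "'a set set"
    using permutes_inj[OF assms(1)] by (meson inj_image_eq_iff inj_onI)
  then show ?thesis unfolding cyc_def orbits_conjugate[where f = f and g = g, OF assms] by (rule card_image)
qed

lemma transitive_on_conjugate:
  assumes \<pi>: "\<pi> permutes S" and c: "\<And>x. \<pi> (f x) = f' (\<pi> x)" "\<And>x. \<pi> (g x) = g' (\<pi> x)"
    and t: "transitive_on S {f, g}"
  shows "transitive_on S {f', g'}"
  unfolding transitive_on_def
proof (intro allI impI)
  fix U assume U: "U \<subseteq> S" "U \<noteq> {}" "\<forall>h\<in>{f', g'}. h ` U \<subseteq> U"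
  let ?V = "{x. \<pi> x \<in> U}"
  have "?V \<subseteq> S" using U(1) permutes_in_image[OF \<pi>] by blast
  moreover have "?V \<noteq> {}" using U(2) permutes_surj[OF \<pi>] by (metis Collect_empty_eq all_not_in_conv surjD)
  moreover have "\<forall>h\<in>{f, g}. h ` ?V \<subseteq> ?V" using U(3) c by auto
  ultimately have "?V = S" using t unfolding transitive_on_def by (metis (no_types, lifting))
  then have "\<pi> x \<in> U" if "x \<in> S" for x using that by blast
  then have "\<pi> ` S \<subseteq> U" by blast
  then show "U = S" using U(1) permutes_image[OF \<pi>] by blast
qed

section \<open>Conjugacy classes and cycle types\<close>

lemma conj_class_permutes: "\<rho> \<in> conj_class \<mu> \<Longrightarrow> \<rho> permutes {1..sum_list \<mu>}"
  by (simp add: conj_class_def)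

lemma conj_class_cyc: "\<rho> \<in> conj_class \<mu> \<Longrightarrow> cyc \<rho> {1..sum_list \<mu>} = length \<mu>"
proof -
  assume "\<rho> \<in> conj_class \<mu>"
  then have "size (cycle_type (sum_list \<mu>) \<rho>) = size (mset \<mu>)" by (simp add: conj_class_def)
  then show ?thesis by (simp add: cycle_type_def cyc_def)
qed

lemma finite_conj_class: "finite (conj_class \<mu>)"
  by (rule finite_subset[OF _ finite_permutations[of "{1..sum_list \<mu>}"]]) (auto simp: conj_class_def)

lemma conj_class_conjugate:
  assumes r: "\<rho> \<in> conj_class \<mu>" and \<pi>: "\<pi> permutes {1..sum_list \<mu>}"
  shows "\<pi> \<circ> \<rho> \<circ> pinv \<pi> \<in> conj_class \<mu>"
proof -
  let ?S = "{1..sum_list \<mu>}" and ?g = "\<pi> \<circ> \<rho> \<circ> pinv \<pi>"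
  have inj: "inj \<pi>" using \<pi> by (rule permutes_inj)
  have p: "?g permutes ?S"
    using permutes_inv[OF \<pi>] conj_class_permutes[OF r] \<pi> by (intro permutes_compose)
  have c: "\<pi> (\<rho> x) = ?g (\<pi> x)" for x using inj by simp
  have inji: "inj_on (image \<pi>) X" for X using inj by (meson inj_image_eq_iff inj_onI)
  have "cycle_type (sum_list \<mu>) ?g = image_mset card (mset_set (image \<pi> ` orbit \<rho> ` ?S))"
    unfolding cycle_type_def orbits_conjugate[where f = \<rho> and g = ?g, OF \<pi> c] ..
  also have "\<dots> = image_mset card (image_mset (image \<pi>) (mset_set (orbit \<rho> ` ?S)))"
    by (simp add: image_mset_mset_set[OF inji])
  also have "\<dots> = image_mset card (mset_set (orbit \<rho> ` ?S))"
    using inj by (simp add: image_mset.compositionality card_image inj_on_subset[OF _ subset_UNIV] cong: image_mset_cong)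
  finally show ?thesis using r p by (simp add: conj_class_def cycle_type_def)
qed

lemma conj_class_two_pairings:
  assumes "\<sigma> \<in> conj_class (replicate m 2)"
  shows "\<sigma> \<in> pairings {1..2 * m}"
proof -
  have s: "sum_list (replicate m 2) = 2 * m" by (simp add: sum_list_replicate)
  have p: "\<sigma> permutes {1..2 * m}" using conj_class_permutes[OF assms] by (simp only: s)
  then have pp: "permutation \<sigma>" by (auto simp: permutation_permutes)
  have "cycle_type (2 * m) \<sigma> = mset (replicate m 2)" using assms by (simp add: conj_class_def s)
  then have "set_mset (cycle_type (2 * m) \<sigma>) \<subseteq> {2}" by (simp add: set_replicate_conv_if)
  then have "card ` orbit \<sigma> ` {1..2 * m} \<subseteq> {2}" by (simp add: cycle_type_def)
  then have c: "card (orbit \<sigma> x) = 2" if "x \<in> {1..2 * m}" for x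
    using that by blast
  have "\<sigma> x \<noteq> x \<and> \<sigma> (\<sigma> x) = x" if x: "x \<in> {1..2 * m}" for x
  proof -
    have ne: "\<sigma> x \<noteq> x" using c[OF x] orbit_fixed[of \<sigma> x] by auto
    have "{x, \<sigma> x} \<subseteq> orbit \<sigma> x" using permutation_self_in_orbit[OF pp] orbit.base by fast
    then have "orbit \<sigma> x = {x, \<sigma> x}"
      using c[OF x] ne by (intro card_subset_eq[symmetric]) (auto intro: card_ge_0_finite)
    then have "\<sigma> (\<sigma> x) \<in> {x, \<sigma> x}" using orbit.step[OF orbit.base] by metis
    moreover have "\<sigma> (\<sigma> x) \<noteq> \<sigma> x" using ne permutes_inj[OF p] by (metis injD)
    ultimately show ?thesis using ne by simp
  qed
  then show ?thesis using p by (simp add: pairings_def)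
qed

text \<open>The cycle type fixes the lengths only as a multiset. The cumulant needs the cycles
  numbered so that cycle \<open>i\<close> belongs to the \<open>i\<close>-th trace; a permutation
  relating two lists with equal multisets provides the numbering.\<close>

lemma conj_class_enumerate_orbits:
  assumes r: "\<rho> \<in> conj_class \<mu>"
  shows "\<exists>b. bij_betw b {..<length \<mu>} (orbit \<rho> ` {1..sum_list \<mu>}) \<and> (\<forall>i<length \<mu>. card (b i) = \<mu> ! i)"
proof -
  let ?O = "orbit \<rho> ` {1..sum_list \<mu>}"
  obtain xs where xs: "set xs = ?O" "distinct xs" using finite_distinct_list[of ?O] by auto
  have "mset \<mu> = image_mset card (mset_set ?O)" using r by (simp add: conj_class_def cycle_type_def)
  also have "mset_set ?O = mset xs" using xs by (metis mset_set_set)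
  finally have m: "mset \<mu> = mset (map card xs)" by simp
  obtain f where f: "f permutes {..<length (map card xs)}" "permute_list f (map card xs) = \<mu>"
    using mset_eq_permutation[OF m] by blast
  have len: "length \<mu> = length xs" using mset_eq_length[OF m] by simp
  have f': "f permutes {..<length \<mu>}" using f(1) len by simp
  have "bij_betw (\<lambda>i. xs ! i) {..<length \<mu>} ?O" using xs len by (simp add: bij_betw_nth)
  then have "bij_betw ((\<lambda>i. xs ! i) \<circ> f) {..<length \<mu>} ?O"
    using permutes_imp_bij[OF f'] by (rule bij_betw_trans[rotated])
  moreover have "card (((\<lambda>i. xs ! i) \<circ> f) i) = \<mu> ! i" if "i < length \<mu>" for i
  proof -
    have "f i < length xs" using permutes_in_image[OF f', of i] that len by simp
    moreover have "permute_list f (map card xs) ! i = map card xs ! f i"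
      by (rule permute_list_nth) (use f(1) that len in auto)
    ultimately show ?thesis using f(2) by simp
  qed
  ultimately show ?thesis by blast
qed

section \<open>Connected paths and double counting\<close>

text \<open>With \<open>k = 2 * g - 2 + \<ell>(\<mu>) + L div 2\<close> this says that \<open>(\<rho>, \<alpha>)\<close> is connected of genus \<open>g\<close>.\<close>

definition genus_condition :: "nat \<Rightarrow> nat \<Rightarrow> (nat \<Rightarrow> nat) \<Rightarrow> (nat \<Rightarrow> nat) \<Rightarrow> bool" where
  "genus_condition L k \<rho> \<alpha> \<longleftrightarrow> k + cyc (\<rho> \<circ> \<alpha>) {1..L} = L \<and> transitive_on {1..L} {\<rho>, \<alpha>}"

lemma strictly_monotone_paths_iff:
  assumes \<sigma>: "\<sigma> permutes {1..sum_list \<mu>}"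
  shows "(\<tau>s, \<rho>) \<in> strictly_monotone_paths \<mu> k \<sigma> \<longleftrightarrow>
    \<rho> \<in> conj_class \<mu> \<and> length \<tau>s = k \<and> \<tau>s \<in> monotone_factorizations (sum_list \<mu>) (\<sigma> \<circ> pinv \<rho>)"
proof -
  have e: "foldr (\<circ>) \<tau>s \<rho> = \<sigma> \<longleftrightarrow> foldr (\<circ>) \<tau>s id = \<sigma> \<circ> pinv \<rho>" if "\<rho> \<in> conj_class \<mu>"
  proof -
    have p: "\<rho> permutes {1..sum_list \<mu>}" using that by (rule conj_class_permutes)
    have 1: "\<rho> \<circ> pinv \<rho> = id" "pinv \<rho> \<circ> \<rho> = id" using permutes_inv_o[OF p] by auto
    have "foldr (\<circ>) \<tau>s id \<circ> \<rho> = \<sigma> \<longleftrightarrow> foldr (\<circ>) \<tau>s id = \<sigma> \<circ> pinv \<rho>"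
    proof
      assume "foldr (\<circ>) \<tau>s id \<circ> \<rho> = \<sigma>"
      then have "\<sigma> \<circ> pinv \<rho> = foldr (\<circ>) \<tau>s id \<circ> (\<rho> \<circ> pinv \<rho>)" by (simp only: o_assoc)
      then show "foldr (\<circ>) \<tau>s id = \<sigma> \<circ> pinv \<rho>" by (simp only: 1 o_id)
    next
      assume "foldr (\<circ>) \<tau>s id = \<sigma> \<circ> pinv \<rho>"
      then have "foldr (\<circ>) \<tau>s id \<circ> \<rho> = \<sigma> \<circ> (pinv \<rho> \<circ> \<rho>)" by (simp only: o_assoc)
      then show "foldr (\<circ>) \<tau>s id \<circ> \<rho> = \<sigma>" by (simp only: 1 o_id)
    qed
    then show ?thesis using foldr_comp[of \<tau>s \<rho>] by simp
  qed
  show ?thesis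
    unfolding strictly_monotone_paths_def monotone_factorizations_def using e by blast
qed

text \<open>Both families preserve the same subsets. A set preserved by all factors is preserved by
  their product, and \<sigma> is this product after \<rho>; conversely the unique factorisation
  preserves whatever its product preserves.\<close>

lemma transitive_on_factorization:
  assumes \<rho>: "\<rho> permutes {1..L}" and \<sigma>: "\<sigma> permutes {1..L}"
    and t: "\<tau>s \<in> monotone_factorizations L (\<sigma> \<circ> pinv \<rho>)"
  shows "transitive_on {1..L} (insert \<rho> (set \<tau>s)) \<longleftrightarrow> transitive_on {1..L} {\<rho>, \<sigma>}"
proof -
  let ?w = "\<sigma> \<circ> pinv \<rho>"
  have w: "?w permutes {1..L}" using \<sigma> permutes_inv[OF \<rho>] by (intro permutes_compose)
  have inv: "\<tau> ` U \<subseteq> U" if "?w ` U \<subseteq> U" "\<tau> \<in> set \<tau>s" for \<tau> U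
  proof -
    obtain ts where "monotone_factorizations L ?w = {ts}" "\<forall>U. ?w ` U \<subseteq> U \<longrightarrow> (\<forall>\<tau>\<in>set ts. \<tau> ` U \<subseteq> U)"
      using monotone_factorization_unique[OF w] by blast
    then show ?thesis using t that by auto
  qed
  have fw: "foldr (\<circ>) \<tau>s id = ?w" using t unfolding monotone_factorizations_def by blast
  have "?w ` U \<subseteq> U" if "\<forall>\<tau>\<in>set \<tau>s. \<tau> ` U \<subseteq> U" for U
  proof -
    have "foldr (\<circ>) ts id ` U \<subseteq> U" if "\<forall>\<tau>\<in>set ts. \<tau> ` U \<subseteq> U" for ts :: "(nat \<Rightarrow> nat) list"
      using that
    proof (induction ts)
      case (Cons t ts)
      have "foldr (\<circ>) (t # ts) id ` U = t ` foldr (\<circ>) ts id ` U" by (simp add: image_comp)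
      also have "\<dots> \<subseteq> U" using Cons by (metis image_mono list.set_intros subset_trans)
      finally show ?case .
    qed simp
    from this[OF that] show ?thesis by (simp only: fw)
  qed
  note w_inv = this
  have "(\<forall>h\<in>insert \<rho> (set \<tau>s). h ` U \<subseteq> U) \<longleftrightarrow> (\<forall>h\<in>{\<rho>, \<sigma>}. h ` U \<subseteq> U)" if U: "U \<subseteq> {1..L}" for U
  proof
    assume h: "\<forall>h\<in>insert \<rho> (set \<tau>s). h ` U \<subseteq> U"
    have "\<sigma> = ?w \<circ> \<rho>" using permutes_inv_o(2)[OF \<rho>] by (simp add: o_assoc[symmetric])
    then have "\<sigma> ` U = ?w ` \<rho> ` U" by (simp only: image_comp)
    also have "\<dots> \<subseteq> ?w ` U" using h by (intro image_mono) simp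
    also have "\<dots> \<subseteq> U" using w_inv h by simp
    finally show "\<forall>h\<in>{\<rho>, \<sigma>}. h ` U \<subseteq> U" using h by simp
  next
    assume h: "\<forall>h\<in>{\<rho>, \<sigma>}. h ` U \<subseteq> U"
    have fin: "finite U" using U finite_subset by blast
    have "pinv \<rho> ` U \<subseteq> U" by (rule invariant_inv[OF \<rho> fin]) (use h in simp)
    then have "\<sigma> ` pinv \<rho> ` U \<subseteq> \<sigma> ` U" by (rule image_mono)
    also have "\<dots> \<subseteq> U" using h by simp
    finally have "?w ` U \<subseteq> U" by (simp only: image_comp)
    then show "\<forall>h\<in>insert \<rho> (set \<tau>s). h ` U \<subseteq> U" using inv h by simp
  qed
  then show ?thesis unfolding transitive_on_def by simp
qed

text \<open>Projecting a path to its starting point is injective because the factorisation is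
  unique, and the image is cut out by the length of this factorisation together with
  transitivity.\<close>

lemma card_connected_paths:
  assumes \<sigma>: "\<sigma> \<in> pairings {1..sum_list \<mu>}"
  shows "card {w \<in> strictly_monotone_paths \<mu> k \<sigma>. connected_path (sum_list \<mu>) w} =
    card {\<rho> \<in> conj_class \<mu>. genus_condition (sum_list \<mu>) k \<rho> \<sigma>}"
proof -
  let ?L = "sum_list \<mu>"
  have sp: "\<sigma> permutes {1..?L}" using \<sigma> by (rule pairings_permutes)
  have inv_s: "pinv \<sigma> = \<sigma>"
    using pairings_comp_self[OF \<sigma>] by (metis inv_unique_comp)
  have w: "\<sigma> \<circ> pinv \<rho> permutes {1..?L}" if "\<rho> \<in> conj_class \<mu>" for \<rho>
    using sp permutes_inv[OF conj_class_permutes[OF that]] by (intro permutes_compose)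
  \<comment> \<open>The two permutations are inverse to each other because \<sigma> is an
    involution, and a permutation and its inverse have the same cycles.\<close>
  have cyc: "cyc (\<sigma> \<circ> pinv \<rho>) {1..?L} = cyc (\<rho> \<circ> \<sigma>) {1..?L}" if "\<rho> \<in> conj_class \<mu>" for \<rho>
  proof -
    have r: "\<rho> permutes {1..?L}" using that by (rule conj_class_permutes)
    have "pinv (\<sigma> \<circ> pinv \<rho>) = pinv (pinv \<rho>) \<circ> pinv \<sigma>"
      using permutes_bij[OF sp] permutes_bij[OF r] by (intro o_inv_distrib) (auto intro: bij_imp_bij_inv)
    also have "\<dots> = \<rho> \<circ> \<sigma>" using permutes_bij[OF r] by (simp only: inv_s inv_inv_eq)
    finally show ?thesis using cyc_inv[of "\<sigma> \<circ> pinv \<rho>" "{1..?L}"] w[OF that]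
      by (metis finite_atLeastAtMost permutation_permutes)
  qed
  have conn: "connected_path ?L (\<tau>s, \<rho>) \<longleftrightarrow> transitive_on {1..?L} {\<rho>, \<sigma>}"
    if r: "\<rho> \<in> conj_class \<mu>" and t: "\<tau>s \<in> monotone_factorizations ?L (\<sigma> \<circ> pinv \<rho>)" for \<tau>s \<rho>
  proof -
    obtain ps where ps: "\<tau>s = map (case_prod swp) ps"
      "\<forall>(a, b)\<in>set ps. a \<in> {1..?L} \<and> b \<in> {1..?L} \<and> a \<noteq> b"
      using t unfolding monotone_factorizations_def by blast
    have "\<forall>\<tau>\<in>set \<tau>s. \<tau> permutes {1..?L}"
    proof
      fix \<tau> assume "\<tau> \<in> set \<tau>s"
      then obtain a b where "(a, b) \<in> set ps" "\<tau> = swp a b" using ps(1) by auto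
      moreover from this(1) have "a \<in> {1..?L}" "b \<in> {1..?L}" using ps(2) by auto
      ultimately show "\<tau> permutes {1..?L}" using permutes_swap_id by metis
    qed
    then show ?thesis
      using connected_path_iff[OF conj_class_permutes[OF r]] transitive_on_factorization[OF conj_class_permutes[OF r] sp t]
      by blast
  qed
  let ?A = "{w \<in> strictly_monotone_paths \<mu> k \<sigma>. connected_path ?L w}"
  have inj: "inj_on snd ?A"
  proof (rule inj_onI)
    fix v w assume v: "v \<in> ?A" and w': "w \<in> ?A" and e: "snd v = snd w"
    obtain a b c where vw: "v = (a, b)" "w = (c, b)" using e by (metis prod.collapse)
    have "b \<in> conj_class \<mu>" "a \<in> monotone_factorizations ?L (\<sigma> \<circ> pinv b)"
      "c \<in> monotone_factorizations ?L (\<sigma> \<circ> pinv b)"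
      using v w' unfolding vw by (auto simp: strictly_monotone_paths_iff[OF sp])
    then show "v = w" using monotone_factorization_unique[OF w] vw by fastforce
  qed
  have "snd ` ?A = {\<rho> \<in> conj_class \<mu>. genus_condition ?L k \<rho> \<sigma>}"
  proof (intro equalityI subsetI)
    fix \<rho> assume "\<rho> \<in> snd ` ?A"
    then obtain \<tau>s where "(\<tau>s, \<rho>) \<in> strictly_monotone_paths \<mu> k \<sigma>" and c: "connected_path ?L (\<tau>s, \<rho>)" by force
    then have r: "\<rho> \<in> conj_class \<mu>" and l: "length \<tau>s = k"
      and t: "\<tau>s \<in> monotone_factorizations ?L (\<sigma> \<circ> pinv \<rho>)"
      by (simp_all add: strictly_monotone_paths_iff[OF sp])
    obtain ts where "monotone_factorizations ?L (\<sigma> \<circ> pinv \<rho>) = {ts}"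
      "length ts + cyc (\<sigma> \<circ> pinv \<rho>) {1..?L} = ?L"
      using monotone_factorization_unique[OF w[OF r]] by blast
    then have "k + cyc (\<rho> \<circ> \<sigma>) {1..?L} = ?L" using t l cyc[OF r] by auto
    then show "\<rho> \<in> {\<rho> \<in> conj_class \<mu>. genus_condition ?L k \<rho> \<sigma>}"
      using r c conn[OF r t] by (simp add: genus_condition_def)
  next
    fix \<rho> assume "\<rho> \<in> {\<rho> \<in> conj_class \<mu>. genus_condition ?L k \<rho> \<sigma>}"
    then have r: "\<rho> \<in> conj_class \<mu>" and k: "k + cyc (\<rho> \<circ> \<sigma>) {1..?L} = ?L"
      and tr: "transitive_on {1..?L} {\<rho>, \<sigma>}" by (simp_all add: genus_condition_def)
    obtain ts where ts: "monotone_factorizations ?L (\<sigma> \<circ> pinv \<rho>) = {ts}"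
      "length ts + cyc (\<sigma> \<circ> pinv \<rho>) {1..?L} = ?L"
      using monotone_factorization_unique[OF w[OF r]] by blast
    then have t: "ts \<in> monotone_factorizations ?L (\<sigma> \<circ> pinv \<rho>)" by simp
    have "length ts = k" using ts(2) k cyc[OF r] by simp
    then have "(ts, \<rho>) \<in> ?A" using strictly_monotone_paths_iff[OF sp] r t conn[OF r t] tr by simp
    then show "\<rho> \<in> snd ` ?A" by force
  qed
  then show ?thesis using card_image[OF inj] by simp
qed

text \<open>Conjugating \<rho> by a permutation that carries \<alpha> to \<beta> is an injection. An
  inequality is enough, since \<alpha> and \<beta> can be exchanged.\<close>

lemma card_genus_condition_conjugate:
  assumes "\<alpha> \<in> pairings {1..sum_list \<mu>}" "\<beta> \<in> pairings {1..sum_list \<mu>}"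
  shows "card {\<rho> \<in> conj_class \<mu>. genus_condition (sum_list \<mu>) k \<rho> \<alpha>} \<le>
    card {\<rho> \<in> conj_class \<mu>. genus_condition (sum_list \<mu>) k \<rho> \<beta>}"
proof -
  let ?S = "{1..sum_list \<mu>}"
  obtain \<pi> where \<pi>: "\<pi> permutes ?S" "\<pi> \<circ> \<alpha> = \<beta> \<circ> \<pi>"
    using pairings_conjugate[OF _ assms] by blast
  have ca: "\<pi> (\<alpha> x) = \<beta> (\<pi> x)" for x using \<pi>(2) by (metis comp_apply)
  let ?f = "\<lambda>\<rho>. \<pi> \<circ> \<rho> \<circ> pinv \<pi>"
  have inj: "inj \<pi>" using \<pi>(1) by (rule permutes_inj)
  have c: "\<pi> (\<rho> x) = ?f \<rho> (\<pi> x)" for \<rho> x using inj by simp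
  have "inj_on ?f {\<rho> \<in> conj_class \<mu>. genus_condition (sum_list \<mu>) k \<rho> \<alpha>}"
  proof (rule inj_onI)
    fix \<rho> \<rho>' assume e: "?f \<rho> = ?f \<rho>'"
    have "\<pi> (\<rho> x) = \<pi> (\<rho>' x)" for x using c[of \<rho> x] c[of \<rho>' x] e by metis
    then show "\<rho> = \<rho>'" using inj by (auto simp: fun_eq_iff dest: injD)
  qed
  moreover have "?f ` {\<rho> \<in> conj_class \<mu>. genus_condition (sum_list \<mu>) k \<rho> \<alpha>} \<subseteq>
      {\<rho> \<in> conj_class \<mu>. genus_condition (sum_list \<mu>) k \<rho> \<beta>}"
  proof (rule image_subsetI)
    fix \<rho> assume "\<rho> \<in> {\<rho> \<in> conj_class \<mu>. genus_condition (sum_list \<mu>) k \<rho> \<alpha>}"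
    then have r: "\<rho> \<in> conj_class \<mu>" and g: "k + cyc (\<rho> \<circ> \<alpha>) ?S = sum_list \<mu>" "transitive_on ?S {\<rho>, \<alpha>}"
      by (simp_all add: genus_condition_def)
    have "\<pi> ((\<rho> \<circ> \<alpha>) x) = (?f \<rho> \<circ> \<beta>) (\<pi> x)" for x using c[of \<rho> "\<alpha> x"] ca[of x] by simp
    then have "cyc (?f \<rho> \<circ> \<beta>) ?S = cyc (\<rho> \<circ> \<alpha>) ?S" by (rule cyc_conjugate[OF \<pi>(1)])
    moreover have "transitive_on ?S {?f \<rho>, \<beta>}"
      by (rule transitive_on_conjugate[where f = \<rho> and g = \<alpha> and f' = "?f \<rho>" and g' = \<beta>, OF \<pi>(1) c ca g(2)])
    ultimately show "?f \<rho> \<in> {\<rho> \<in> conj_class \<mu>. genus_condition (sum_list \<mu>) k \<rho> \<beta>}"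
      using conj_class_conjugate[OF r \<pi>(1)] g(1) by (simp add: genus_condition_def)
  qed
  ultimately show ?thesis using finite_conj_class by (intro card_inj_on_le) auto
qed

text \<open>Counts the pairs of a permutation in the class and a pairing. Sums over pairings for
  fixed \<rho> are constant by assumption; sums over the class for a fixed pairing are constant by
  conjugation.\<close>

lemma double_count_genus_condition:
  assumes \<sigma>: "\<sigma> \<in> pairings {1..sum_list \<mu>}"
    and \<kappa>: "\<And>\<rho>. \<rho> \<in> conj_class \<mu> \<Longrightarrow> card {\<alpha> \<in> pairings {1..sum_list \<mu>}. genus_condition (sum_list \<mu>) k \<rho> \<alpha>} = \<kappa>"
  shows "card (conj_class \<mu>) * \<kappa> = card (pairings {1..sum_list \<mu>}) *
    card {\<rho> \<in> conj_class \<mu>. genus_condition (sum_list \<mu>) k \<rho> \<sigma>}"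
proof -
  let ?P = "pairings {1..sum_list \<mu>}" and ?C = "conj_class \<mu>" and ?G = "genus_condition (sum_list \<mu>) k"
  have fP: "finite ?P" by (simp add: finite_pairings)
  have fC: "finite ?C" by (rule finite_conj_class)
  have "card ?C * \<kappa> = (\<Sum>\<rho>\<in>?C. card {\<alpha> \<in> ?P. ?G \<rho> \<alpha>})" using \<kappa> by simp
  also have "\<dots> = (\<Sum>\<alpha>\<in>?P. card {\<rho> \<in> ?C. ?G \<rho> \<alpha>})"
  proof -
    have 1: "card {\<alpha> \<in> ?P. ?G \<rho> \<alpha>} = (\<Sum>\<alpha>\<in>?P. if ?G \<rho> \<alpha> then 1 else 0)" for \<rho>
      using fP by (simp add: sum.If_cases Int_def)
    have 2: "card {\<rho> \<in> ?C. ?G \<rho> \<alpha>} = (\<Sum>\<rho>\<in>?C. if ?G \<rho> \<alpha> then 1 else 0)" for \<alpha>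
      using fC by (simp add: sum.If_cases Int_def)
    show ?thesis unfolding 1 2 by (rule sum.swap)
  qed
  also have "\<dots> = (\<Sum>\<alpha>\<in>?P. card {\<rho> \<in> ?C. ?G \<rho> \<sigma>})"
    by (rule sum.cong[OF refl]) (intro antisym card_genus_condition_conjugate \<sigma>)
  finally show ?thesis by simp
qed

section \<open>Wick's formula\<close>

text \<open>Gaussian integration by parts for a monomial, obtained from the closed formula for the
  moments without any differentiation. For \<open>k = 0\<close> the truncated exponent
  \<open>k - 1\<close> is harmless because the factor in front vanishes.\<close>

lemma normal_moment_stein:
  assumes s: "0 < s"
  defines "m \<equiv> \<lambda>k. \<integral>t. normal_density 0 s t * t ^ k \<partial>lborel"
  shows "m (Suc k) = s\<^sup>2 * (real k * m (k - 1))"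
proof -
  have odd: "m (2 * j + 1) = 0" for j
    using integral_normal_moment_odd[OF s, of 0 j] by (simp add: m_def)
  have even: "m (2 * j) = fact (2 * j) / ((2 / s\<^sup>2) ^ j * fact j)" for j
    using integral_normal_moment_even[OF s, of 0 j] by (simp add: m_def)
  show ?thesis
  proof (cases "even k")
    case True
    then obtain j where j: "k = 2 * j" by blast
    show ?thesis
    proof (cases j)
      case 0 then show ?thesis using j odd[of 0] by simp
    next
      case (Suc i)
      then have "k - 1 = 2 * i + 1" using j by simp
      then show ?thesis using odd[of i] odd[of j] j by simp
    qed
  next
    case False
    then obtain j where j: "k = 2 * j + 1" using oddE by blast
    have "m (Suc k) = m (2 * Suc j)" by (simp add: j)
    also have "\<dots> = (2 * real j + 2) * (2 * real j + 1) * fact (2 * j) * s\<^sup>2 / (2 * (2 / s\<^sup>2) ^ j * ((real j + 1) * fact j))"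
      unfolding even using s by (simp add: field_simps)
    also have "\<dots> = s\<^sup>2 * (real k * m (2 * j))"
      unfolding even j using s by (simp add: divide_simps)
    finally show ?thesis using j by simp
  qed
qed

text \<open>The rows of \<open>c\<close> are complex linear forms in independent centred normal variables with
  standard deviations \<open>sd p\<close>; \<open>moment k D\<close> is the expectation of the monomial with exponents
  \<open>k\<close> times the product of the forms indexed by \<open>D\<close>.\<close>

locale gaussian_forms =
  fixes I :: "'i set" and sd :: "'i \<Rightarrow> real" and c :: "'x \<Rightarrow> 'i \<Rightarrow> complex"
  assumes finI: "finite I" and sd_pos: "\<And>p. p \<in> I \<Longrightarrow> 0 < sd p"
begin

definition gauss_density :: "('i \<Rightarrow> real) \<Rightarrow> real" where
  "gauss_density x = (\<Prod>p\<in>I. normal_density 0 (sd p) (x p))"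

definition form :: "'x \<Rightarrow> ('i \<Rightarrow> real) \<Rightarrow> complex" where
  "form y x = (\<Sum>p\<in>I. c y p * complex_of_real (x p))"

definition integrand :: "('i \<Rightarrow> nat) \<Rightarrow> 'x set \<Rightarrow> ('i \<Rightarrow> real) \<Rightarrow> complex" where
  "integrand k D x = complex_of_real (gauss_density x * (\<Prod>p\<in>I. x p ^ k p)) * (\<Prod>y\<in>D. form y x)"

abbreviation "lebI \<equiv> PiM I (\<lambda>_. lborel :: real measure)"

definition moment :: "('i \<Rightarrow> nat) \<Rightarrow> 'x set \<Rightarrow> complex" where
  "moment k D = (\<integral>x. integrand k D x \<partial>lebI)"

definition m1 :: "'i \<Rightarrow> nat \<Rightarrow> real" where
  "m1 p k = (\<integral>t. normal_density 0 (sd p) t * t ^ k \<partial>lborel)"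

lemma integrand_empty:
  "integrand k {} x = (\<Prod>p\<in>I. complex_of_real (normal_density 0 (sd p) (x p) * x p ^ k p))"
  by (simp add: integrand_def gauss_density_def prod.distrib)

lemma integrable_1dim:
  "p \<in> I \<Longrightarrow> integrable lborel (\<lambda>t. complex_of_real (normal_density 0 (sd p) t * t ^ k))"
  using integrable_normal_moment[OF sd_pos, of p 0 k] by (intro integrable_of_real) simp

lemma integrable_integrand_empty: "integrable lebI (integrand k {})"
proof -
  interpret product_sigma_finite "\<lambda>_ :: 'i. lborel :: real measure"
    by standard
  show ?thesis unfolding integrand_empty[abs_def]
    by (rule product_integrable_prod[OF finI]) (rule integrable_1dim)
qed

lemma moment_empty: "moment k {} = (\<Prod>p\<in>I. complex_of_real (m1 p (k p)))"
proof -
  interpret product_sigma_finite "\<lambda>_ :: 'i. lborel :: real measure"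
    by standard
  have "moment k {} = (\<Prod>p\<in>I. \<integral>t. complex_of_real (normal_density 0 (sd p) t * t ^ k p) \<partial>lborel)"
    unfolding moment_def integrand_empty
    by (rule product_integral_prod[OF finI]) (rule integrable_1dim)
  then show ?thesis by (simp only: integral_complex_of_real m1_def)
qed

lemma prod_pow_upd:
  "p \<in> I \<Longrightarrow> (\<Prod>q\<in>I. x q ^ (k(p := Suc (k p))) q) = x p * (\<Prod>q\<in>I. x q ^ k q)" for x :: "'i \<Rightarrow> real"
  using finI by (simp add: prod.remove[of I p] mult.assoc)

lemma integrand_insert:
  assumes "finite D" "z \<notin> D"
  shows "integrand k (insert z D) x = (\<Sum>q\<in>I. c z q * integrand (k(q := Suc (k q))) D x)"
proof -
  have "integrand k (insert z D) x =
      (\<Sum>q\<in>I. c z q * (complex_of_real (x q) * (complex_of_real (gauss_density x * (\<Prod>p\<in>I. x p ^ k p)) * (\<Prod>y\<in>D. form y x))))"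
    using assms by (simp add: integrand_def form_def sum_distrib_right sum_distrib_left mult_ac)
  also have "\<dots> = (\<Sum>q\<in>I. c z q * integrand (k(q := Suc (k q))) D x)"
    by (rule sum.cong[OF refl]) (simp only: integrand_def prod_pow_upd of_real_mult mult_ac)
  finally show ?thesis .
qed

lemma integrable_integrand: "finite D \<Longrightarrow> integrable lebI (integrand k D)"
proof (induction D arbitrary: k rule: finite_induct)
  case (insert z D)
  show ?case unfolding integrand_insert[OF insert.hyps(1,2), abs_def]
    using insert.IH by (intro Bochner_Integration.integrable_sum integrable_mult_right) auto
qed (rule integrable_integrand_empty)

lemma moment_insert:
  assumes "finite D" "z \<notin> D"
  shows "moment k (insert z D) = (\<Sum>q\<in>I. c z q * moment (k(q := Suc (k q))) D)"
  unfolding moment_def integrand_insert[OF assms]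
  using integrable_integrand[OF assms(1)]
  by (subst Bochner_Integration.integral_sum) (auto intro!: integrable_mult_right)

lemma moment_stein_empty:
  assumes p: "p \<in> I"
  shows "moment (k(p := Suc (k p))) {} = of_real ((sd p)\<^sup>2) * (of_nat (k p) * moment (k(p := k p - 1)) {})"
proof -
  have "m1 p (Suc (k p)) = (sd p)\<^sup>2 * (real (k p) * m1 p (k p - 1))"
    unfolding m1_def by (rule normal_moment_stein[OF sd_pos[OF p]])
  moreover have "(\<Prod>q\<in>I. complex_of_real (m1 q ((k(p := j)) q))) =
      complex_of_real (m1 p j) * (\<Prod>q\<in>I - {p}. complex_of_real (m1 q (k q)))" for j
    using finI p by (simp add: prod.remove[of I p])
  ultimately show ?thesis unfolding moment_empty by simp
qed

text \<open>Integration by parts in the coordinate \<open>p\<close>: the expectation of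
  \<open>x p\<close> times \<open>F\<close> is the variance times the expectation of the partial
  derivative of \<open>F\<close>. The product rule yields one term from the monomial and one from
  each form. Carrying exponents makes an algebraic induction possible: expanding one form only
  raises exponents and leaves a smaller \<open>D\<close>.\<close>

lemma moment_stein:
  assumes "finite D" and p: "p \<in> I"
  shows "moment (k(p := Suc (k p))) D = of_real ((sd p)\<^sup>2) *
    (of_nat (k p) * moment (k(p := k p - 1)) D + (\<Sum>y\<in>D. c y p * moment k (D - {y})))"
  using assms(1)
proof (induction D arbitrary: k rule: finite_induct)
  case empty
  show ?case by (subst moment_stein_empty[OF p]) simp
next
  case (insert z D)
  let ?u = "\<lambda>k :: 'i \<Rightarrow> nat. \<lambda>q. k(q := Suc (k q))"
  let ?s = "complex_of_real ((sd p)\<^sup>2)"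
  have comm: "?u (?u k p) q = ?u (?u k q) p" for q by (auto simp: fun_eq_iff)
  \<comment> \<open>The product rule for the extra factor \<open>x q\<close>: only
    \<open>q = p\<close> produces a surplus. Weighted by \<open>c z p\<close>, it is the derivative
    of the form \<open>z\<close> and becomes the summand \<open>y = z\<close>.\<close>
  have step: "of_nat (?u k q p) * moment ((?u k q)(p := ?u k q p - 1)) D =
      of_nat (k p) * moment (?u (k(p := k p - 1)) q) D + (if q = p then moment k D else 0)" for q
  proof (cases "q = p")
    case True
    show ?thesis
    proof (cases "k p")
      case 0
      then have "k(p := 0) = k" by (metis fun_upd_triv)
      then show ?thesis using True 0 by simp
    next
      case (Suc j)
      then have "k(p := Suc j) = k" by (metis fun_upd_triv)
      then show ?thesis using True Suc by (simp add: algebra_simps)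
    qed
  next
    case False
    then show ?thesis by (simp add: fun_upd_twist)
  qed
  have "moment (?u k p) (insert z D) = (\<Sum>q\<in>I. c z q * moment (?u (?u k p) q) D)"
    by (rule moment_insert[OF insert.hyps(1,2)])
  also have "\<dots> = (\<Sum>q\<in>I. c z q * (?s * (of_nat (?u k q p) * moment ((?u k q)(p := ?u k q p - 1)) D +
      (\<Sum>y\<in>D. c y p * moment (?u k q) (D - {y})))))"
    unfolding comm using insert.IH by (intro sum.cong refl) (simp only:)
  also have "\<dots> = ?s * (of_nat (k p) * (\<Sum>q\<in>I. c z q * moment (?u (k(p := k p - 1)) q) D) +
      (\<Sum>q\<in>I. if q = p then c z q * moment k D else 0) +
      (\<Sum>q\<in>I. c z q * (\<Sum>y\<in>D. c y p * moment (?u k q) (D - {y}))))"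
    unfolding step by (simp only: sum_distrib_left sum.distrib[symmetric], rule sum.cong[OF refl])
      (auto simp: algebra_simps sum_distrib_left)
  also have "(\<Sum>q\<in>I. c z q * moment (?u (k(p := k p - 1)) q) D) = moment (k(p := k p - 1)) (insert z D)"
    by (rule moment_insert[OF insert.hyps(1,2), symmetric])
  also have "(\<Sum>q\<in>I. if q = p then c z q * moment k D else 0) = c z p * moment k (insert z D - {z})"
    using finI p insert.hyps by simp
  also have "(\<Sum>q\<in>I. c z q * (\<Sum>y\<in>D. c y p * moment (?u k q) (D - {y}))) =
      (\<Sum>y\<in>D. c y p * (\<Sum>q\<in>I. c z q * moment (?u k q) (D - {y})))"
    unfolding sum_distrib_left by (subst sum.swap) (simp only: mult_ac)
  also have "\<dots> = (\<Sum>y\<in>D. c y p * moment k (insert z D - {y}))"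
  proof (rule sum.cong[OF refl])
    fix y assume y: "y \<in> D"
    have "insert z D - {y} = insert z (D - {y})" using y insert.hyps by auto
    then show "c y p * (\<Sum>q\<in>I. c z q * moment (?u k q) (D - {y})) = c y p * moment k (insert z D - {y})"
      using moment_insert[of "D - {y}" z k] insert.hyps by simp
  qed
  finally show ?case using insert.hyps by (simp add: algebra_simps)
qed

text \<open>Bilinear, with no complex conjugation: the expectation of the product of the two forms,
  as Wick's formula requires.\<close>

definition covariance :: "'x \<Rightarrow> 'x \<Rightarrow> complex" where
  "covariance x y = (\<Sum>p\<in>I. of_real ((sd p)\<^sup>2) * c x p * c y p)"

text \<open>Expand the form \<open>z\<close> into coordinates and integrate each by parts; with all
  exponents zero only the derivatives of the other forms survive.\<close>

lemma moment_wick_step: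
  assumes "finite D" "z \<notin> D"
  shows "moment (\<lambda>_. 0) (insert z D) = (\<Sum>y\<in>D. covariance z y * moment (\<lambda>_. 0) (D - {y}))"
proof -
  have "moment (\<lambda>_. 0) (insert z D) = (\<Sum>q\<in>I. c z q * moment ((\<lambda>_. 0)(q := Suc ((\<lambda>_. 0) q))) D)"
    by (rule moment_insert[OF assms])
  also have "\<dots> = (\<Sum>q\<in>I. c z q * (of_real ((sd q)\<^sup>2) * (\<Sum>y\<in>D. c y q * moment (\<lambda>_. 0) (D - {y}))))"
  proof (rule sum.cong[OF refl])
    fix q assume "q \<in> I"
    from moment_stein[OF assms(1) this, of "\<lambda>_. 0"]
    show "c z q * moment ((\<lambda>_. 0)(q := Suc ((\<lambda>_. 0) q))) D =
        c z q * (of_real ((sd q)\<^sup>2) * (\<Sum>y\<in>D. c y q * moment (\<lambda>_. 0) (D - {y})))" by simp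
  qed
  also have "\<dots> = (\<Sum>y\<in>D. covariance z y * moment (\<lambda>_. 0) (D - {y}))"
    unfolding covariance_def sum_distrib_left sum_distrib_right
    by (subst sum.swap) (simp only: mult_ac)
  finally show ?thesis .
qed

text \<open>The covariance has the shape met for matrix entries, where \<open>a\<close> and
  \<open>b\<close> give the row and the column index of a factor. A pairing then contributes
  \<open>s^2\<close> for each pair or nothing at all, and as \<alpha> is an involution the two index
  equations of a pair are the single condition \<open>a x = b (\<alpha> x)\<close> at its two
  points.\<close>

lemma wick:
  assumes "finite D"
    and cov: "\<And>x y. x \<in> D \<Longrightarrow> y \<in> D \<Longrightarrow> covariance x y = (if a x = b y \<and> a y = b x then of_real (s\<^sup>2) else 0)"
  shows "moment (\<lambda>_. 0) D = of_real (s ^ card D) * (\<Sum>\<alpha>\<in>pairings D. if \<forall>x\<in>D. a x = b (\<alpha> x) then 1 else 0)"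
  using assms
proof (induction "card D" arbitrary: D rule: less_induct)
  case less
  show ?case
  proof (cases "D = {}")
    case True
    have "m1 p 0 = 1" if "p \<in> I" for p
      using integral_normal_moment_even[OF sd_pos[OF that], of 0 0] by (simp add: m1_def)
    then have "moment (\<lambda>_. 0) {} = 1" by (simp add: moment_empty)
    then show ?thesis by (simp add: True pairings_empty)
  next
    case False
    then obtain z where "z \<in> D" by auto
    define E where "E = D - {z}"
    have E: "finite E" "z \<notin> E" "D = insert z E" using less.prems \<open>z \<in> D\<close> by (auto simp: E_def)
    let ?f = "\<lambda>\<alpha>. if \<forall>x\<in>D. a x = b (\<alpha> x) then 1 else 0 :: complex"
    let ?g = "\<lambda>y \<beta>. if \<forall>x\<in>E - {y}. a x = b (\<beta> x) then 1 else 0 :: complex"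
    \<comment> \<open>The covariance of \<open>z\<close> and \<open>y\<close> supplies exactly the
      conditions at these two points that are absent for the smaller pairing.\<close>
    have fg: "(if a z = b y \<and> a y = b z then 1 else 0) * ?g y \<beta> = ?f (\<beta> \<circ> swp z y)"
      if y: "y \<in> E" and b: "\<beta> \<in> pairings (E - {y})" for y \<beta>
    proof -
      have bz: "\<beta> z = z" "\<beta> y = y"
        using pairings_permutes[OF b] E(2) by (auto intro!: permutes_not_in)
      have "z \<noteq> y" using E(2) y by auto
      have o: "(\<beta> \<circ> swp z y) z = y" "(\<beta> \<circ> swp z y) y = z"
        "\<And>x. x \<in> E - {y} \<Longrightarrow> (\<beta> \<circ> swp z y) x = \<beta> x"
      proof -
        show "(\<beta> \<circ> swp z y) z = y" "(\<beta> \<circ> swp z y) y = z" using bz by simp_all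
        fix x assume "x \<in> E - {y}"
        then have "x \<noteq> z" "x \<noteq> y" using E(2) by auto
        then show "(\<beta> \<circ> swp z y) x = \<beta> x" by simp
      qed
      have D: "D = insert z (insert y (E - {y}))" using E y by auto
      have "(\<forall>x\<in>D. a x = b ((\<beta> \<circ> swp z y) x)) \<longleftrightarrow>
          a z = b y \<and> a y = b z \<and> (\<forall>x\<in>E - {y}. a x = b (\<beta> x))"
        unfolding D ball_simps(7) using o by metis
      then show ?thesis by simp
    qed
    have c: "card D = Suc (card E)" using E by simp
    have "moment (\<lambda>_. 0) D = (\<Sum>y\<in>E. covariance z y * moment (\<lambda>_. 0) (E - {y}))"
      unfolding E(3) by (rule moment_wick_step[OF E(1,2)])
    also have "\<dots> = (\<Sum>y\<in>E. of_real (s ^ card D) * (\<Sum>\<beta>\<in>pairings (E - {y}). ?f (\<beta> \<circ> swp z y)))"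
    proof (rule sum.cong[OF refl])
      fix y assume y: "y \<in> E"
      have cy: "Suc (card (E - {y})) = card E" using y E(1) by (metis card_Suc_Diff1)
      have IH: "moment (\<lambda>_. 0) (E - {y}) = of_real (s ^ card (E - {y})) * (\<Sum>\<beta>\<in>pairings (E - {y}). ?g y \<beta>)"
        by (rule less.hyps) (use cy c less.prems(2) E in auto)
      have "covariance z y = (if a z = b y \<and> a y = b z then of_real (s\<^sup>2) else 0)"
        using less.prems(2)[of z y] y E by simp
      also have "\<dots> = of_real (s\<^sup>2) * (if a z = b y \<and> a y = b z then 1 else 0)" by simp
      finally have "covariance z y * moment (\<lambda>_. 0) (E - {y}) = of_real (s\<^sup>2 * s ^ card (E - {y})) *
          (\<Sum>\<beta>\<in>pairings (E - {y}). (if a z = b y \<and> a y = b z then 1 else 0) * ?g y \<beta>)"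
        unfolding IH sum_distrib_left[symmetric] of_real_mult by (simp only: mult_ac)
      also have "s\<^sup>2 * s ^ card (E - {y}) = s ^ card D"
        unfolding c cy[symmetric] by (simp add: power2_eq_square)
      finally show "covariance z y * moment (\<lambda>_. 0) (E - {y}) =
          of_real (s ^ card D) * (\<Sum>\<beta>\<in>pairings (E - {y}). ?f (\<beta> \<circ> swp z y))"
        using fg[OF y] by (simp cong: sum.cong)
    qed
    also have "\<dots> = of_real (s ^ card D) * (\<Sum>\<alpha>\<in>pairings D. ?f \<alpha>)"
      unfolding E(3) sum_pairings_insert[OF E(1,2)] sum_distrib_left[symmetric] ..
    finally show ?thesis .
  qed
qed

end

section \<open>Traces of matrix powers\<close>

lemma sum_PiE_insert:
  fixes g :: "('a \<Rightarrow> 'b) \<Rightarrow> 'c :: comm_monoid_add"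
  assumes a: "a \<notin> S" and fin: "finite S" "finite T"
  shows "(\<Sum>f\<in>PiE (insert a S) (\<lambda>_. T). g f) = (\<Sum>f\<in>PiE S (\<lambda>_. T). \<Sum>v\<in>T. g (f(a := v)))"
proof -
  have "bij_betw (\<lambda>(f, v). f(a := v)) (PiE S (\<lambda>_. T) \<times> T) (PiE (insert a S) (\<lambda>_. T))"
  proof (rule bij_betw_byWitness[where f' = "\<lambda>h. (h(a := undefined), h a)"])
    show "\<forall>p\<in>PiE S (\<lambda>_. T) \<times> T. (\<lambda>h. (h(a := undefined), h a)) ((\<lambda>(f, v). f(a := v)) p) = p"
      using a by (auto simp: PiE_def extensional_def fun_eq_iff)
    show "\<forall>h\<in>PiE (insert a S) (\<lambda>_. T). (\<lambda>(f, v). f(a := v)) (h(a := undefined), h a) = h"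
      by (auto simp: fun_eq_iff)
    show "(\<lambda>(f, v). f(a := v)) ` (PiE S (\<lambda>_. T) \<times> T) \<subseteq> PiE (insert a S) (\<lambda>_. T)"
      by (auto simp: PiE_def extensional_def Pi_def)
    show "(\<lambda>h. (h(a := undefined), h a)) ` PiE (insert a S) (\<lambda>_. T) \<subseteq> PiE S (\<lambda>_. T) \<times> T"
      using a by (auto simp: PiE_def extensional_def Pi_def)
  qed
  from sum.reindex_bij_betw[OF this, of g]
  have "(\<Sum>f\<in>PiE (insert a S) (\<lambda>_. T). g f) = (\<Sum>(f, v)\<in>PiE S (\<lambda>_. T) \<times> T. g (f(a := v)))"
    by (simp add: case_prod_unfold)
  then show ?thesis using fin by (simp add: sum.cartesian_product)
qed

lemma sum_PiE_reindex:
  fixes F :: "('a \<Rightarrow> 'b) \<Rightarrow> 'c :: comm_monoid_add"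
  assumes e: "bij_betw e S Q"
  shows "(\<Sum>h\<in>PiE S (\<lambda>_. T). F h) = (\<Sum>f\<in>PiE Q (\<lambda>_. T). F (\<lambda>k\<in>S. f (e k)))"
proof -
  have "bij_betw (\<lambda>f. \<lambda>k\<in>S. f (e k)) (PiE Q (\<lambda>_. T)) (PiE S (\<lambda>_. T))"
  proof (rule bij_betw_byWitness[where f' = "\<lambda>h. \<lambda>x\<in>Q. h (inv_into S e x)"])
    have 1: "inv_into S e x \<in> S" "e (inv_into S e x) = x" if "x \<in> Q" for x
      using e that by (auto simp: bij_betw_def inv_into_into f_inv_into_f)
    have 2: "e k \<in> Q" "inv_into S e (e k) = k" if "k \<in> S" for k
      using e that by (auto simp: bij_betw_def)
    show "\<forall>f\<in>PiE Q (\<lambda>_. T). (\<lambda>x\<in>Q. (\<lambda>k\<in>S. f (e k)) (inv_into S e x)) = f"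
    proof
      fix f assume f: "f \<in> PiE Q (\<lambda>_. T)"
      show "(\<lambda>x\<in>Q. (\<lambda>k\<in>S. f (e k)) (inv_into S e x)) = f"
        by (rule PiE_ext[of _ Q "\<lambda>_. T" f]) (use 1 f in \<open>auto simp: PiE_iff\<close>)
    qed
    show "\<forall>h\<in>PiE S (\<lambda>_. T). (\<lambda>k\<in>S. (\<lambda>x\<in>Q. h (inv_into S e x)) (e k)) = h"
    proof
      fix h assume h: "h \<in> PiE S (\<lambda>_. T)"
      show "(\<lambda>k\<in>S. (\<lambda>x\<in>Q. h (inv_into S e x)) (e k)) = h"
        by (rule PiE_ext[of _ S "\<lambda>_. T" h]) (use 2 h in \<open>auto simp: PiE_iff\<close>)
    qed
    show "(\<lambda>f. \<lambda>k\<in>S. f (e k)) ` PiE Q (\<lambda>_. T) \<subseteq> PiE S (\<lambda>_. T)"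
      using 2(1) by (auto simp: PiE_iff)
    show "(\<lambda>h. \<lambda>x\<in>Q. h (inv_into S e x)) ` PiE S (\<lambda>_. T) \<subseteq> PiE Q (\<lambda>_. T)"
      using 1(1) by (auto simp: PiE_iff)
  qed
  then show ?thesis by (rule sum.reindex_bij_betw[symmetric])
qed

lemma sum_PiE_Un:
  fixes G H :: "('a \<Rightarrow> 'b) \<Rightarrow> 'c :: comm_semiring_1"
  assumes d: "S1 \<inter> S2 = {}"
  shows "(\<Sum>f\<in>PiE (S1 \<union> S2) (\<lambda>_. T). G (restrict f S1) * H (restrict f S2)) =
    (\<Sum>f\<in>PiE S1 (\<lambda>_. T). G f) * (\<Sum>f\<in>PiE S2 (\<lambda>_. T). H f)"
proof -
  have "bij_betw (\<lambda>f. (restrict f S1, restrict f S2)) (PiE (S1 \<union> S2) (\<lambda>_. T))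
      (PiE S1 (\<lambda>_. T) \<times> PiE S2 (\<lambda>_. T))"
  proof (rule bij_betw_byWitness[where f' = "\<lambda>(f, g). \<lambda>x\<in>S1 \<union> S2. if x \<in> S1 then f x else g x"])
    show "\<forall>f\<in>PiE (S1 \<union> S2) (\<lambda>_. T). (\<lambda>(f, g). \<lambda>x\<in>S1 \<union> S2. if x \<in> S1 then f x else g x) (restrict f S1, restrict f S2) = f"
      by (auto simp: fun_eq_iff PiE_def extensional_def restrict_def)
    show "\<forall>p\<in>PiE S1 (\<lambda>_. T) \<times> PiE S2 (\<lambda>_. T).
        (\<lambda>f. (restrict f S1, restrict f S2)) ((\<lambda>(f, g). \<lambda>x\<in>S1 \<union> S2. if x \<in> S1 then f x else g x) p) = p"
      using d by (auto simp: fun_eq_iff PiE_def extensional_def restrict_def)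
  qed (auto simp: PiE_iff extensional_def)
  from sum.reindex_bij_betw[OF this, of "\<lambda>(f, g). G f * H g"]
  show ?thesis by (simp add: sum_product sum.cartesian_product)
qed

lemma pow_mat_entry:
  fixes A :: "complex mat"
  assumes A: "A \<in> carrier_mat N N" and ij: "i < N" "j < N"
  shows "(A ^\<^sub>m m) $$ (i, j) = (\<Sum>f\<in>PiE {..m} (\<lambda>_. {..<N}).
    if f 0 = i \<and> f m = j then \<Prod>k<m. A $$ (f k, f (Suc k)) else 0)"
  using ij
proof (induction m arbitrary: j)
  case 0
  have e: "{..0::nat} = insert 0 {}" by auto
  have "(\<Sum>f\<in>PiE {..0::nat} (\<lambda>_. {..<N}). if f 0 = i \<and> f 0 = j then 1 else 0 :: complex) =
      (\<Sum>v<N. if v = i \<and> v = j then 1 else 0)"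
    unfolding e by (subst sum_PiE_insert) auto
  also have "\<dots> = (if i = j then 1 else 0)"
    using 0 by (auto simp: sum.delta intro!: sum.neutral)
  finally show ?case using A 0 by (simp cong: if_cong)
next
  case (Suc m)
  let ?W = "\<lambda>f. \<Prod>k<m. A $$ (f k, f (Suc k))"
  have Am: "A ^\<^sub>m m \<in> carrier_mat N N" using A by simp
  have "(A ^\<^sub>m Suc m) $$ (i, j) = (\<Sum>l<N. (A ^\<^sub>m m) $$ (i, l) * A $$ (l, j))"
    using A Am Suc.prems by (simp add: scalar_prod_def atLeast0LessThan)
  also have "\<dots> = (\<Sum>l<N. (\<Sum>f\<in>PiE {..m} (\<lambda>_. {..<N}). if f 0 = i \<and> f m = l then ?W f else 0) * A $$ (l, j))"
    using Suc.IH Suc.prems by simp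
  also have "\<dots> = (\<Sum>f\<in>PiE {..m} (\<lambda>_. {..<N}). \<Sum>l<N. (if f 0 = i \<and> f m = l then ?W f else 0) * A $$ (l, j))"
    unfolding sum_distrib_right by (rule sum.swap)
  also have "\<dots> = (\<Sum>f\<in>PiE {..m} (\<lambda>_. {..<N}). if f 0 = i then ?W f * A $$ (f m, j) else 0)"
  proof (rule sum.cong[OF refl])
    fix f assume "f \<in> PiE {..m} (\<lambda>_. {..<N})"
    then have "f m < N" by (auto simp: PiE_iff)
    have "(\<Sum>l<N. (if f 0 = i \<and> f m = l then ?W f else 0) * A $$ (l, j)) =
        (\<Sum>l<N. if l = f m then (if f 0 = i then ?W f * A $$ (f m, j) else 0) else 0)"
      by (rule sum.cong) auto
    then show "(\<Sum>l<N. (if f 0 = i \<and> f m = l then ?W f else 0) * A $$ (l, j)) =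
        (if f 0 = i then ?W f * A $$ (f m, j) else 0)" using \<open>f m < N\<close> by simp
  qed
  also have "\<dots> = (\<Sum>f\<in>PiE {..m} (\<lambda>_. {..<N}). \<Sum>v<N. if (f(Suc m := v)) 0 = i \<and> (f(Suc m := v)) (Suc m) = j
      then \<Prod>k<Suc m. A $$ ((f(Suc m := v)) k, (f(Suc m := v)) (Suc k)) else 0)"
  proof (rule sum.cong[OF refl])
    fix f
    have "(\<Sum>v<N. if (f(Suc m := v)) 0 = i \<and> (f(Suc m := v)) (Suc m) = j
      then \<Prod>k<Suc m. A $$ ((f(Suc m := v)) k, (f(Suc m := v)) (Suc k)) else 0) =
      (\<Sum>v<N. if v = j then (if f 0 = i then ?W f * A $$ (f m, j) else 0) else 0)"
      by (rule sum.cong) auto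
    then show "(if f 0 = i then ?W f * A $$ (f m, j) else 0) =
      (\<Sum>v<N. if (f(Suc m := v)) 0 = i \<and> (f(Suc m := v)) (Suc m) = j
      then \<Prod>k<Suc m. A $$ ((f(Suc m := v)) k, (f(Suc m := v)) (Suc k)) else 0)"
      using Suc.prems by simp
  qed
  also have "\<dots> = (\<Sum>f\<in>PiE {..Suc m} (\<lambda>_. {..<N}). if f 0 = i \<and> f (Suc m) = j
      then \<Prod>k<Suc m. A $$ (f k, f (Suc k)) else 0)"
    unfolding atMost_Suc by (rule sum_PiE_insert[symmetric]) auto
  finally show ?case .
qed

text \<open>Setting the last vertex of a walk equal to its first makes the walk cyclic. Positivity
  of \<open>m\<close> matters: for \<open>m = 0\<close> the right side would be 1, but the trace of
  the identity is \<open>N\<close>.\<close>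

lemma mat_trace_pow_cyclic:
  fixes A :: "complex mat"
  assumes A: "A \<in> carrier_mat N N" and m: "0 < m"
  shows "mat_trace (A ^\<^sub>m m) = (\<Sum>f\<in>PiE {..<m} (\<lambda>_. {..<N}). \<Prod>k<m. A $$ (f k, f (Suc k mod m)))"
proof -
  have d: "dim_row (A ^\<^sub>m m) = N" using A by simp
  have e: "{..m} = insert m {..<m}" by auto
  have "mat_trace (A ^\<^sub>m m) = (\<Sum>i<N. \<Sum>f\<in>PiE {..m} (\<lambda>_. {..<N}).
      if f 0 = i \<and> f m = i then \<Prod>k<m. A $$ (f k, f (Suc k)) else 0)"
    unfolding mat_trace_def d using pow_mat_entry[OF A] by simp
  also have "\<dots> = (\<Sum>f\<in>PiE {..m} (\<lambda>_. {..<N}). \<Sum>i<N.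
      if f 0 = i \<and> f m = i then \<Prod>k<m. A $$ (f k, f (Suc k)) else 0)" by (rule sum.swap)
  also have "\<dots> = (\<Sum>f\<in>PiE {..m} (\<lambda>_. {..<N}). if f m = f 0 then \<Prod>k<m. A $$ (f k, f (Suc k)) else 0)"
  proof (rule sum.cong[OF refl])
    fix f assume "f \<in> PiE {..m} (\<lambda>_. {..<N})"
    then have "f 0 < N" by (auto simp: PiE_iff)
    have "(\<Sum>i<N. if f 0 = i \<and> f m = i then \<Prod>k<m. A $$ (f k, f (Suc k)) else 0) =
      (\<Sum>i<N. if i = f 0 then (if f m = f 0 then \<Prod>k<m. A $$ (f k, f (Suc k)) else 0) else 0)"
      by (rule sum.cong) auto
    then show "(\<Sum>i<N. if f 0 = i \<and> f m = i then \<Prod>k<m. A $$ (f k, f (Suc k)) else 0) =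
      (if f m = f 0 then \<Prod>k<m. A $$ (f k, f (Suc k)) else 0)" using \<open>f 0 < N\<close> by simp
  qed
  also have "\<dots> = (\<Sum>f\<in>PiE {..<m} (\<lambda>_. {..<N}). \<Sum>v<N. if (f(m := v)) m = (f(m := v)) 0
      then \<Prod>k<m. A $$ ((f(m := v)) k, (f(m := v)) (Suc k)) else 0)"
    unfolding e by (rule sum_PiE_insert) auto
  also have "\<dots> = (\<Sum>f\<in>PiE {..<m} (\<lambda>_. {..<N}). \<Prod>k<m. A $$ (f k, f (Suc k mod m)))"
  proof (rule sum.cong[OF refl])
    fix f assume "f \<in> PiE {..<m} (\<lambda>_. {..<N})"
    then have "f 0 < N" using m by (auto simp: PiE_iff)
    have p: "(\<Prod>k<m. A $$ ((f(m := f 0)) k, (f(m := f 0)) (Suc k))) = (\<Prod>k<m. A $$ (f k, f (Suc k mod m)))"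
    proof (rule prod.cong[OF refl])
      fix k assume "k \<in> {..<m}"
      then show "A $$ ((f(m := f 0)) k, (f(m := f 0)) (Suc k)) = A $$ (f k, f (Suc k mod m))"
        by (cases "Suc k = m") auto
    qed
    have "(\<Sum>v<N. if (f(m := v)) m = (f(m := v)) 0
      then \<Prod>k<m. A $$ ((f(m := v)) k, (f(m := v)) (Suc k)) else 0) =
      (\<Sum>v<N. if v = f 0 then \<Prod>k<m. A $$ ((f(m := f 0)) k, (f(m := f 0)) (Suc k)) else 0)"
      by (rule sum.cong) (use m in auto)
    then show "(\<Sum>v<N. if (f(m := v)) m = (f(m := v)) 0
      then \<Prod>k<m. A $$ ((f(m := v)) k, (f(m := v)) (Suc k)) else 0) = (\<Prod>k<m. A $$ (f k, f (Suc k mod m)))"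
      using \<open>f 0 < N\<close> unfolding p by simp
  qed
  finally show ?thesis .
qed

text \<open>Positions in the trace are renamed along a cycle of \<rho>, so that moving to the next
  position becomes applying \<rho>. In this form several traces share a single permutation.\<close>

lemma mat_trace_pow_orbit:
  fixes A :: "complex mat" and \<rho> :: "nat \<Rightarrow> nat"
  assumes A: "A \<in> carrier_mat N N" and \<rho>: "permutation \<rho>"
  shows "mat_trace (A ^\<^sub>m card (orbit \<rho> x)) =
    (\<Sum>f\<in>PiE (orbit \<rho> x) (\<lambda>_. {..<N}). \<Prod>y\<in>orbit \<rho> x. A $$ (f y, f (\<rho> y)))"
proof -
  let ?Q = "orbit \<rho> x"
  let ?e = "\<lambda>n. (\<rho> ^^ n) x"
  have self: "x \<in> ?Q" using \<rho> by (rule permutation_self_in_orbit)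
  let ?m = "funpow_dist1 \<rho> x x"
  have b: "bij_betw ?e {..<?m} ?Q"
    unfolding bij_betw_def using inj_on_funpow_dist1[OF self] orbit_conv_funpow_dist1[OF self]
    by (simp add: atLeast0LessThan)
  have m: "card ?Q = ?m" using bij_betw_same_card[OF b] by simp
  have per: "(\<rho> ^^ ?m) x = x" by (rule funpow_dist1_prop[OF self])
  have step: "?e (Suc k mod ?m) = \<rho> (?e k)" if "k < ?m" for k
    using that per by (cases "Suc k = ?m") auto
  have "mat_trace (A ^\<^sub>m card ?Q) = (\<Sum>f\<in>PiE {..<?m} (\<lambda>_. {..<N}). \<Prod>k<?m. A $$ (f k, f (Suc k mod ?m)))"
    unfolding m by (rule mat_trace_pow_cyclic[OF A]) simp
  also have "\<dots> = (\<Sum>f\<in>PiE ?Q (\<lambda>_. {..<N}). \<Prod>k<?m. A $$ ((\<lambda>k\<in>{..<?m}. f (?e k)) k, (\<lambda>k\<in>{..<?m}. f (?e k)) (Suc k mod ?m)))"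
    by (rule sum_PiE_reindex[OF b])
  also have "\<dots> = (\<Sum>f\<in>PiE ?Q (\<lambda>_. {..<N}). \<Prod>y\<in>?Q. A $$ (f y, f (\<rho> y)))"
  proof (rule sum.cong[OF refl])
    fix f :: "nat \<Rightarrow> nat"
    have "(\<Prod>k<?m. A $$ ((\<lambda>k\<in>{..<?m}. f (?e k)) k, (\<lambda>k\<in>{..<?m}. f (?e k)) (Suc k mod ?m))) =
        (\<Prod>k<?m. A $$ (f (?e k), f (\<rho> (?e k))))"
      using step by (intro prod.cong refl) simp
    also have "\<dots> = (\<Prod>y\<in>?Q. A $$ (f y, f (\<rho> y)))" by (rule prod.reindex_bij_betw[OF b])
    finally show "(\<Prod>k<?m. A $$ ((\<lambda>k\<in>{..<?m}. f (?e k)) k, (\<lambda>k\<in>{..<?m}. f (?e k)) (Suc k mod ?m))) =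
        (\<Prod>y\<in>?Q. A $$ (f y, f (\<rho> y)))" .
  qed
  finally show ?thesis .
qed

text \<open>Index functions on disjoint cycles glue to one index function on their union, and no
  factor links different cycles.\<close>

lemma prod_mat_trace_pow:
  fixes A :: "complex mat" and \<rho> :: "nat \<Rightarrow> nat"
  assumes A: "A \<in> carrier_mat N N" and \<rho>: "permutation \<rho>" and fin: "finite B"
    and orb: "\<And>i. i \<in> B \<Longrightarrow> \<exists>x. b i = orbit \<rho> x" and inj: "inj_on b B"
  shows "(\<Prod>i\<in>B. mat_trace (A ^\<^sub>m card (b i))) =
    (\<Sum>f\<in>PiE (\<Union>(b ` B)) (\<lambda>_. {..<N}). \<Prod>y\<in>\<Union>(b ` B). A $$ (f y, f (\<rho> y)))"
  using fin orb inj
proof (induction B rule: finite_induct)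
  case empty
  then show ?case by simp
next
  case (insert i B)
  let ?w = "\<lambda>S f. \<Prod>y\<in>S. A $$ (f y, f (\<rho> y))"
  obtain x where x: "b i = orbit \<rho> x" using insert.prems(1) by blast
  have inv: "\<rho> y \<in> b j" if "y \<in> b j" "j \<in> insert i B" for y j
    using insert.prems(1)[OF that(2)] that(1) by (auto intro: orbit.step)
  have fin: "finite (b j)" if "j \<in> insert i B" for j
    using insert.prems(1)[OF that] finite_orbit permutation_self_in_orbit[OF \<rho>] by metis
  have disj: "b i \<inter> \<Union>(b ` B) = {}"
  proof (rule ccontr)
    assume "b i \<inter> \<Union>(b ` B) \<noteq> {}"
    then obtain z j where z: "z \<in> b i" "z \<in> b j" "j \<in> B" by blast
    obtain y where "b j = orbit \<rho> y" using insert.prems(1)[of j] z by blast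
    then have "b i = b j" using z x orbit_eq_orbit[OF \<rho>] by metis
    then show False using insert.prems(2) z(3) insert.hyps by (metis inj_onD insertCI)
  qed
  have "(\<Prod>i\<in>insert i B. mat_trace (A ^\<^sub>m card (b i))) =
      (\<Sum>f\<in>PiE (b i) (\<lambda>_. {..<N}). ?w (b i) f) * (\<Sum>f\<in>PiE (\<Union>(b ` B)) (\<lambda>_. {..<N}). ?w (\<Union>(b ` B)) f)"
    using insert mat_trace_pow_orbit[OF A \<rho>, of x] by (simp add: x)
  also have "\<dots> = (\<Sum>f\<in>PiE (b i \<union> \<Union>(b ` B)) (\<lambda>_. {..<N}). ?w (b i) (restrict f (b i)) * ?w (\<Union>(b ` B)) (restrict f (\<Union>(b ` B))))"
    by (rule sum_PiE_Un[OF disj, symmetric])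
  also have "\<dots> = (\<Sum>f\<in>PiE (b i \<union> \<Union>(b ` B)) (\<lambda>_. {..<N}). ?w (b i \<union> \<Union>(b ` B)) f)"
  proof (rule sum.cong[OF refl])
    fix f :: "nat \<Rightarrow> nat"
    have "?w (b i) (restrict f (b i)) = ?w (b i) f" using inv by (intro prod.cong refl) simp
    moreover have "?w (\<Union>(b ` B)) (restrict f (\<Union>(b ` B))) = ?w (\<Union>(b ` B)) f"
      using inv by (intro prod.cong refl) (auto simp: restrict_def)
    moreover have "?w (b i \<union> \<Union>(b ` B)) f = ?w (b i) f * ?w (\<Union>(b ` B)) f"
      using disj fin insert.hyps by (intro prod.union_disjoint) auto
    ultimately show "?w (b i) (restrict f (b i)) * ?w (\<Union>(b ` B)) (restrict f (\<Union>(b ` B))) = ?w (b i \<union> \<Union>(b ` B)) f"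
      by simp
  qed
  finally show ?case by simp
qed

lemma hermitian_mats_cnj:
  assumes "A \<in> hermitian_mats N" "i < N" "j < N"
  shows "cnj (A $$ (i, j)) = A $$ (j, i)"
proof -
  have A: "A \<in> carrier_mat N N" "mat_adjoint A = A" using assms(1) by (auto simp: hermitian_mats_def)
  have "mat_adjoint A $$ (j, i) = cnj (A $$ (i, j))"
    using A(1) assms(2,3) by (simp add: mat_adjoint_def mat_of_rows_def)
  then show ?thesis by (simp add: A(2))
qed

lemma mat_trace_pow_hermitian_real:
  assumes "A \<in> hermitian_mats N"
  shows "complex_of_real (Re (mat_trace (A ^\<^sub>m m))) = mat_trace (A ^\<^sub>m m)"
proof -
  have A: "A \<in> carrier_mat N N" using assms by (auto simp: hermitian_mats_def)
  \<comment> \<open>The power is built by multiplying with \<open>A\<close> on the right, whereas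
    conjugation reverses the order and puts \<open>A\<close> on the left.\<close>
  have comm: "A ^\<^sub>m k * A = A * A ^\<^sub>m k" for k
  proof (induction k)
    case 0 then show ?case using A by simp
  next
    case (Suc k)
    have "A ^\<^sub>m Suc k * A = (A * A ^\<^sub>m k) * A" using Suc by simp
    also have "\<dots> = A * (A ^\<^sub>m k * A)" using A by (intro assoc_mult_mat) auto
    finally show ?case by simp
  qed
  have c: "cnj ((A ^\<^sub>m k) $$ (i, j)) = (A ^\<^sub>m k) $$ (j, i)" if "i < N" "j < N" for k i j
    using that
  proof (induction k arbitrary: i j)
    case 0 then show ?case using A by simp
  next
    case (Suc k)
    have Ak: "A ^\<^sub>m k \<in> carrier_mat N N" using A by simp
    have "cnj ((A ^\<^sub>m Suc k) $$ (i, j)) = (\<Sum>l<N. cnj ((A ^\<^sub>m k) $$ (i, l)) * cnj (A $$ (l, j)))"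
      using A Ak Suc.prems by (simp add: scalar_prod_def atLeast0LessThan)
    also have "\<dots> = (\<Sum>l<N. A $$ (j, l) * (A ^\<^sub>m k) $$ (l, i))"
      using Suc hermitian_mats_cnj[OF assms] by (intro sum.cong refl) simp
    also have "\<dots> = (A * A ^\<^sub>m k) $$ (j, i)"
      using A Ak Suc.prems by (simp add: scalar_prod_def atLeast0LessThan)
    finally show ?case using comm[of k] by simp
  qed
  have "cnj (mat_trace (A ^\<^sub>m m)) = mat_trace (A ^\<^sub>m m)"
    unfolding mat_trace_def using A c by (simp add: cnj_sum)
  then show ?thesis by (simp add: complex_eq_iff)
qed

text \<open>The source of the powers of \<open>N\<close>: an invariant function is constant on
  cycles, so one value is chosen freely for each cycle.\<close>

lemma card_orbit_constant_functions:
  fixes q :: "nat \<Rightarrow> nat"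
  assumes q: "permutation q" and D: "finite D" "q ` D \<subseteq> D"
  shows "card {f \<in> PiE D (\<lambda>_. {..<N::nat}). \<forall>x\<in>D. f x = f (q x)} = N ^ cyc q D"
proof -
  let ?F = "{f \<in> PiE D (\<lambda>_. {..<N}). \<forall>x\<in>D. f x = f (q x)}"
  let ?Q = "orbit q ` D"
  have sub: "orbit q x \<subseteq> D" if "x \<in> D" for x using orbit_subset_invariant[OF D(2) that] .
  have const: "f y = f x" if "\<forall>x\<in>D. f x = f (q x)" "x \<in> D" "y \<in> orbit q x" for f :: "nat \<Rightarrow> nat" and x y
    using that(3) that(1,2)
  proof induction
    case (step y)
    then have "y \<in> D" using sub by blast
    then show ?case using step by metis
  qed simp
  \<comment> \<open>A representative of each cycle, used to read off the value of an invariant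
    function there.\<close>
  have some: "(SOME y. y \<in> X) \<in> X" if "X \<in> ?Q" for X
    using that orbit_nonempty by (metis ex_in_conv imageE someI_ex)
  have "bij_betw (\<lambda>g. \<lambda>x\<in>D. g (orbit q x)) (PiE ?Q (\<lambda>_. {..<N})) ?F"
  proof (rule bij_betw_byWitness[where f' = "\<lambda>f. \<lambda>X\<in>?Q. f (SOME y. y \<in> X)"])
    show "\<forall>g\<in>PiE ?Q (\<lambda>_. {..<N}). (\<lambda>X\<in>?Q. (\<lambda>x\<in>D. g (orbit q x)) (SOME y. y \<in> X)) = g"
    proof
      fix g assume g: "g \<in> PiE ?Q (\<lambda>_. {..<N})"
      show "(\<lambda>X\<in>?Q. (\<lambda>x\<in>D. g (orbit q x)) (SOME y. y \<in> X)) = g"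
      proof
        fix X
        show "(\<lambda>X\<in>?Q. (\<lambda>x\<in>D. g (orbit q x)) (SOME y. y \<in> X)) X = g X"
        proof (cases "X \<in> ?Q")
          case True
          then obtain x where x: "x \<in> D" "X = orbit q x" by blast
          let ?y = "SOME y. y \<in> X"
          have y: "?y \<in> orbit q x" using some[OF True] x(2) by simp
          then have "?y \<in> D" "orbit q ?y = X" using sub[OF x(1)] orbit_eq_orbit[OF q y] x(2) by auto
          then show ?thesis using True by simp
        next
          case False
          then have "g X = undefined" using g by (metis PiE_arb)
          then show ?thesis using False by simp
        qed
      qed
    qed
    show "\<forall>f\<in>?F. (\<lambda>x\<in>D. (\<lambda>X\<in>?Q. f (SOME y. y \<in> X)) (orbit q x)) = f"
    proof
      fix f assume f: "f \<in> ?F"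
      show "(\<lambda>x\<in>D. (\<lambda>X\<in>?Q. f (SOME y. y \<in> X)) (orbit q x)) = f"
      proof
        fix x
        show "(\<lambda>x\<in>D. (\<lambda>X\<in>?Q. f (SOME y. y \<in> X)) (orbit q x)) x = f x"
        proof (cases "x \<in> D")
          case True
          then have "f (SOME y. y \<in> orbit q x) = f x" using f const[of f x] some[of "orbit q x"] by blast
          then show ?thesis using True by simp
        next
          case False
          then have "f x = undefined" using f by (metis (no_types, lifting) PiE_arb mem_Collect_eq)
          then show ?thesis using False by simp
        qed
      qed
    qed
    show "(\<lambda>g. \<lambda>x\<in>D. g (orbit q x)) ` PiE ?Q (\<lambda>_. {..<N}) \<subseteq> ?F"
    proof (rule image_subsetI)
      fix g assume g: "g \<in> PiE ?Q (\<lambda>_. {..<N})"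
      have "g (orbit q x) < N" if "x \<in> D" for x using PiE_mem[OF g, of "orbit q x"] that by simp
      moreover have "orbit q (q x) = orbit q x" for x using permutation_orbit_step[OF q] .
      ultimately show "(\<lambda>x\<in>D. g (orbit q x)) \<in> ?F" using D(2) by (auto simp: PiE_iff)
    qed
    show "(\<lambda>f. \<lambda>X\<in>?Q. f (SOME y. y \<in> X)) ` ?F \<subseteq> PiE ?Q (\<lambda>_. {..<N})"
    proof (rule image_subsetI)
      fix f assume f: "f \<in> ?F"
      have "f (SOME y. y \<in> X) < N" if "X \<in> ?Q" for X
      proof -
        have "(SOME y. y \<in> X) \<in> D" using some[OF that] that sub by blast
        then show ?thesis using f by (auto simp: PiE_iff)
      qed
      then show "(\<lambda>X\<in>?Q. f (SOME y. y \<in> X)) \<in> PiE ?Q (\<lambda>_. {..<N})" by (simp add: restrict_PiE_iff)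
    qed
  qed
  then have "card ?F = card (PiE ?Q (\<lambda>_. {..<N}))" by (rule bij_betw_same_card[symmetric])
  also have "\<dots> = N ^ cyc q D" using D by (simp add: card_PiE cyc_def)
  finally show ?thesis .
qed

section \<open>Moments of the GUE\<close>

text \<open>The coefficient of the real coordinate \<open>p\<close> in the matrix entry \<open>e\<close>, see
  \<open>hermitian_of_coords\<close>.\<close>

definition entry_coeff :: "nat \<times> nat \<Rightarrow> nat \<times> nat \<Rightarrow> complex" where
  "entry_coeff e p = (case e of (i, j) \<Rightarrow>
     if i = j then (if p = (i, i) then 1 else 0)
     else if i < j then (if p = (i, j) then 1 else 0) + (if p = (j, i) then \<i> else 0)
     else (if p = (j, i) then 1 else 0) + (if p = (i, j) then - \<i> else 0))"

text \<open>In the trace of the square each diagonal coordinate occurs once and each off-diagonal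
  one twice, so the weight gives the variances \<open>1 / N\<close> and
  \<open>1 / (2 N)\<close>.\<close>

definition coord_sd :: "nat \<Rightarrow> nat \<times> nat \<Rightarrow> real" where
  "coord_sd N p = sqrt (1 / (real N * (if fst p = snd p then 1 else 2)))"

lemma coord_sd_pos: "1 \<le> N \<Longrightarrow> 0 < coord_sd N p"
  by (simp add: coord_sd_def)

lemma coord_sd_sq: "(coord_sd N p)\<^sup>2 = 1 / (real N * (if fst p = snd p then 1 else 2))"
  by (simp add: coord_sd_def)

lemma hermitian_of_coords_entry:
  assumes "i < N" "j < N"
  shows "hermitian_of_coords N x $$ (i, j) =
    (\<Sum>p\<in>{..<N} \<times> {..<N}. entry_coeff (i, j) p * complex_of_real (x p))"
proof -
  have d: "(\<Sum>p\<in>{..<N} \<times> {..<N}. (if p = q then z else 0) * complex_of_real (x p)) = z * x q"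
    if "q \<in> {..<N} \<times> {..<N}" for q z
    using that by (subst sum.remove[of _ q]) auto
  consider "i = j" | "i < j" | "j < i" by linarith
  then show ?thesis
  proof cases
    case 1
    then show ?thesis using assms d[of "(i, i)" 1] by (simp add: hermitian_of_coords_def entry_coeff_def)
  next
    case 2
    then show ?thesis using assms d[of "(i, j)" 1] d[of "(j, i)" \<i>]
      by (simp add: hermitian_of_coords_def entry_coeff_def distrib_right sum.distrib Complex_eq)
  next
    case 3
    then show ?thesis using assms d[of "(j, i)" 1] d[of "(i, j)" "- \<i>"]
      by (simp add: hermitian_of_coords_def entry_coeff_def distrib_right sum.distrib Complex_eq)
  qed
qed

lemma entry_coeff_diag: "entry_coeff (k, l) (i, i) = (if k = i \<and> l = i then 1 else 0)"
  unfolding entry_coeff_def by (cases k l rule: linorder_cases) auto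

lemma entry_coeff_upper:
  assumes "a < b"
  shows "entry_coeff (k, l) (a, b) = (if k = a \<and> l = b \<or> k = b \<and> l = a then 1 else 0)"
  unfolding entry_coeff_def using assms by (cases k l rule: linorder_cases) auto

lemma entry_coeff_lower:
  assumes "a < b"
  shows "entry_coeff (k, l) (b, a) = (if k = a \<and> l = b then \<i> else if k = b \<and> l = a then - \<i> else 0)"
  unfolding entry_coeff_def using assms by (cases k l rule: linorder_cases) auto

lemma entry_coeff_eq_0: "p \<noteq> (i, j) \<Longrightarrow> p \<noteq> (j, i) \<Longrightarrow> entry_coeff (i, j) p = 0"
  unfolding entry_coeff_def by (cases i j rule: linorder_cases) auto

text \<open>The GUE propagator. Off the diagonal, the contributions of real and imaginary part
  cancel when \<open>(k, l) = (i, j)\<close>, since the square of the imaginary unit is -1, and add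
  up when \<open>(k, l) = (j, i)\<close>.\<close>

lemma entry_covariance:
  assumes N: "1 \<le> N" and "i < N" "j < N"
  shows "(\<Sum>p\<in>{..<N} \<times> {..<N}. of_real ((coord_sd N p)\<^sup>2) * entry_coeff (i, j) p * entry_coeff (k, l) p) =
    (if i = l \<and> k = j then of_real (1 / real N) else 0)"
proof -
  let ?I = "{..<N} \<times> {..<N}" and ?s = "\<lambda>p. complex_of_real ((coord_sd N p)\<^sup>2)"
  have d: "(\<Sum>p\<in>?I. ?s p * entry_coeff (i, j) p * entry_coeff (k, l) p) =
      (\<Sum>p\<in>{(i, j), (j, i)}. ?s p * entry_coeff (i, j) p * entry_coeff (k, l) p)"
    by (rule sum.mono_neutral_right) (use assms in \<open>auto simp: entry_coeff_eq_0\<close>)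
  have off: "?s (a, b) = of_real (1 / (2 * real N))" if "a \<noteq> b" for a b
    using that by (simp add: coord_sd_sq mult.commute)
  have e: "of_real (1 / (2 * real N)) * z + of_real (1 / (2 * real N)) * z = of_real (1 / real N) * z" for z :: complex
    using N by (simp add: field_simps)
  consider "i = j" | "i < j" | "j < i" by linarith
  then show ?thesis
  proof cases
    case 1
    then show ?thesis unfolding d by (auto simp: entry_coeff_diag coord_sd_sq)
  next
    case 2
    then have "(\<Sum>p\<in>{(i, j), (j, i)}. ?s p * entry_coeff (i, j) p * entry_coeff (k, l) p) =
        of_real (1 / (2 * real N)) * entry_coeff (k, l) (i, j) + of_real (1 / (2 * real N)) * (\<i> * entry_coeff (k, l) (j, i))"
      using off[of i j] off[of j i] by (simp add: entry_coeff_upper[OF 2, of i j] entry_coeff_lower[OF 2, of i j] mult.assoc)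
    also have "\<dots> = (if i = l \<and> k = j then of_real (1 / real N) else 0)"
    proof (cases "k = j \<and> l = i")
      case True
      then show ?thesis using e[of 1] 2 by (simp add: entry_coeff_upper[OF 2] entry_coeff_lower[OF 2])
    next
      case False
      then show ?thesis unfolding entry_coeff_upper[OF 2] entry_coeff_lower[OF 2]
        by (cases "k = i \<and> l = j") (use 2 in auto)
    qed
    finally show ?thesis unfolding d .
  next
    case 3
    then have "(\<Sum>p\<in>{(i, j), (j, i)}. ?s p * entry_coeff (i, j) p * entry_coeff (k, l) p) =
        of_real (1 / (2 * real N)) * entry_coeff (k, l) (j, i) - of_real (1 / (2 * real N)) * (\<i> * entry_coeff (k, l) (i, j))"
      using off[of i j] off[of j i] by (simp add: entry_coeff_upper[OF 3, of i j] entry_coeff_lower[OF 3, of i j] mult.assoc)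
    also have "\<dots> = (if i = l \<and> k = j then of_real (1 / real N) else 0)"
    proof (cases "k = j \<and> l = i")
      case True
      then show ?thesis using e[of 1] 3 by (simp add: entry_coeff_upper[OF 3] entry_coeff_lower[OF 3])
    next
      case False
      then show ?thesis unfolding entry_coeff_upper[OF 3] entry_coeff_lower[OF 3]
        by (cases "k = i \<and> l = j") (use 3 in auto)
    qed
    finally show ?thesis unfolding d .
  qed
qed

text \<open>The trace of the square is a diagonal quadratic form in the real coordinates, so the
  weight factorises into normal densities up to a constant.\<close>

lemma gue_weight_coords:
  assumes "1 \<le> N"
  shows "gue_weight N (hermitian_of_coords N x) =
    (\<Prod>p\<in>{..<N} \<times> {..<N}. sqrt (2 * pi * (coord_sd N p)\<^sup>2)) *
    (\<Prod>p\<in>{..<N} \<times> {..<N}. normal_density 0 (coord_sd N p) (x p))"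
proof -
  let ?I = "{..<N} \<times> {..<N}" and ?H = "hermitian_of_coords N x"
  have H: "?H \<in> carrier_mat N N" "?H \<in> hermitian_mats N"
    using hermitian_of_coords_in[of N x] by (auto simp: hermitian_mats_def)
  have "mat_trace (?H ^\<^sub>m 2) = (\<Sum>i<N. \<Sum>j<N. ?H $$ (i, j) * ?H $$ (j, i))"
    using H(1) by (simp add: mat_trace_def numeral_2_eq_2 scalar_prod_def atLeast0LessThan)
  also have "\<dots> = (\<Sum>i<N. \<Sum>j<N. of_real (if i = j then (x (i, i))\<^sup>2
      else if i < j then (x (i, j))\<^sup>2 + (x (j, i))\<^sup>2 else (x (j, i))\<^sup>2 + (x (i, j))\<^sup>2))"
  proof (intro sum.cong refl)
    fix i j assume "i \<in> {..<N}" "j \<in> {..<N}"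
    then show "?H $$ (i, j) * ?H $$ (j, i) = of_real (if i = j then (x (i, i))\<^sup>2
      else if i < j then (x (i, j))\<^sup>2 + (x (j, i))\<^sup>2 else (x (j, i))\<^sup>2 + (x (i, j))\<^sup>2)"
      by (cases i j rule: linorder_cases) (simp_all add: hermitian_of_coords_def complex_eq_iff power2_eq_square)
  qed
  \<comment> \<open>Off the diagonal a summand is the sum of two squares, whichever index is larger.
    The two orders of indices together produce each square twice.\<close>
  also have "\<dots> = of_real (\<Sum>i<N. \<Sum>j<N. (x (i, j))\<^sup>2 + (if i = j then 0 else (x (j, i))\<^sup>2))"
    unfolding of_real_sum by (intro sum.cong refl) auto
  also have "(\<Sum>i<N. \<Sum>j<N. (x (i, j))\<^sup>2 + (if i = j then 0 else (x (j, i))\<^sup>2)) =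
      (\<Sum>i<N. \<Sum>j<N. (x (i, j))\<^sup>2) + (\<Sum>i<N. \<Sum>j<N. if i = j then 0 else (x (i, j))\<^sup>2)"
  proof -
    have "(\<Sum>i<N. \<Sum>j<N. if i = j then 0 else (x (j, i))\<^sup>2) = (\<Sum>j<N. \<Sum>i<N. if i = j then 0 else (x (j, i))\<^sup>2)"
      by (rule sum.swap)
    also have "\<dots> = (\<Sum>i<N. \<Sum>j<N. if i = j then 0 else (x (i, j))\<^sup>2)"
      by (intro sum.cong refl) auto
    finally show ?thesis by (simp only: sum.distrib)
  qed
  also have "\<dots> = (\<Sum>i<N. \<Sum>j<N. (if i = j then 1 else 2) * (x (i, j))\<^sup>2)"
    unfolding sum.distrib[symmetric] by (intro sum.cong refl) auto
  also have "\<dots> = (\<Sum>p\<in>?I. (if fst p = snd p then 1 else 2) * (x p)\<^sup>2)"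
    by (simp add: sum.cartesian_product case_prod_unfold)
  finally have tr: "Re (mat_trace (?H ^\<^sub>m 2)) = (\<Sum>p\<in>?I. (if fst p = snd p then 1 else 2) * (x p)\<^sup>2)"
    by simp
  have "gue_weight N ?H = exp (\<Sum>p\<in>?I. - real N * ((if fst p = snd p then 1 else 2) * (x p)\<^sup>2) / 2)"
    unfolding gue_weight_def tr by (simp add: sum_distrib_left sum_divide_distrib sum_negf)
  also have "\<dots> = (\<Prod>p\<in>?I. exp (- real N * ((if fst p = snd p then 1 else 2) * (x p)\<^sup>2) / 2))"
    by (rule exp_sum) simp
  also have "\<dots> = (\<Prod>p\<in>?I. sqrt (2 * pi * (coord_sd N p)\<^sup>2) * normal_density 0 (coord_sd N p) (x p))"
  proof (rule prod.cong[OF refl])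
    fix p
    have s: "0 < coord_sd N p" using assms by (rule coord_sd_pos)
    have "exp (- real N * ((if fst p = snd p then 1 else 2) * (x p)\<^sup>2) / 2) = exp (- (x p)\<^sup>2 / (2 * (coord_sd N p)\<^sup>2))"
      using assms by (simp add: coord_sd_sq)
    then show "exp (- real N * ((if fst p = snd p then 1 else 2) * (x p)\<^sup>2) / 2) =
        sqrt (2 * pi * (coord_sd N p)\<^sup>2) * normal_density 0 (coord_sd N p) (x p)"
      using s by (simp add: normal_density_def real_sqrt_mult)
  qed
  finally show ?thesis by (simp add: prod.distrib)
qed

section \<open>Measurability and integration with respect to the GUE\<close>

lemma measurable_hermitian_entry:
  assumes "p \<in> {..<N} \<times> {..<N}"
  shows "(\<lambda>A. A $$ p) \<in> borel_measurable (hermitian_borel N)"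
proof -
  let ?I = "{..<N} \<times> {..<N}" and ?h = "\<lambda>A :: complex mat. \<lambda>p\<in>{..<N} \<times> {..<N}. A $$ p"
  have "?h \<in> measurable (hermitian_borel N) (PiM ?I (\<lambda>_. borel))"
    unfolding hermitian_borel_def by (rule measurable_vimage_algebra1) (auto simp: space_PiM)
  from measurable_compose[OF this measurable_component_singleton[OF assms]]
  show ?thesis using assms by (simp add: case_prod_unfold)
qed

lemma space_hermitian_borel: "space (hermitian_borel N) = hermitian_mats N"
  by (simp add: hermitian_borel_def)

lemma measurable_mat_trace_pow:
  assumes "0 < m"
  shows "(\<lambda>A. Re (mat_trace (A ^\<^sub>m m))) \<in> borel_measurable (hermitian_borel N)"
proof -
  have "(\<lambda>A. Re (\<Sum>f\<in>PiE {..<m} (\<lambda>_. {..<N}). \<Prod>k<m. A $$ (f k, f (Suc k mod m)))) \<in> borel_measurable (hermitian_borel N)"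
  proof (intro borel_measurable_Re[THEN measurable_compose[rotated]] borel_measurable_sum borel_measurable_prod measurable_hermitian_entry)
    fix f k assume "f \<in> PiE {..<m} (\<lambda>_. {..<N})" "k \<in> {..<m}"
    then show "(f k, f (Suc k mod m)) \<in> {..<N} \<times> {..<N}" using assms by (auto simp: PiE_iff)
  qed
  moreover have "Re (mat_trace (A ^\<^sub>m m)) = Re (\<Sum>f\<in>PiE {..<m} (\<lambda>_. {..<N}). \<Prod>k<m. A $$ (f k, f (Suc k mod m)))"
    if "A \<in> space (hermitian_borel N)" for A
    using that mat_trace_pow_cyclic[OF _ assms, of A N] by (simp add: space_hermitian_borel hermitian_mats_def)
  ultimately show ?thesis by (subst measurable_cong) auto
qed

text \<open>The constant between the weight and the product of normal densities equals the partition
  function, because that product integrates to 1; the two cancel.\<close>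

lemma integral_GUE:
  fixes f :: "complex mat \<Rightarrow> real"
  assumes N: "1 \<le> N" and f: "f \<in> borel_measurable (hermitian_borel N)"
  shows "(\<integral>A. f A \<partial>GUE N) = (\<integral>x. (\<Prod>p\<in>{..<N} \<times> {..<N}. normal_density 0 (coord_sd N p) (x p)) *
    f (hermitian_of_coords N x) \<partial>PiM ({..<N} \<times> {..<N}) (\<lambda>_. lborel))"
proof -
  let ?I = "{..<N} \<times> {..<N}" and ?H = "hermitian_of_coords N"
  let ?M = "PiM ?I (\<lambda>_. lborel :: real measure)"
  let ?g = "\<lambda>x. \<Prod>p\<in>?I. normal_density 0 (coord_sd N p) (x p)"
  define K where "K = (\<Prod>p\<in>?I. sqrt (2 * pi * (coord_sd N p)\<^sup>2))"
  have K: "0 < K" unfolding K_def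
  proof (rule prod_pos)
    fix p
    show "0 < sqrt (2 * pi * (coord_sd N p)\<^sup>2)" using coord_sd_pos[OF N, of p] by (simp add: mult_pos_pos)
  qed
  have w: "gue_weight N (?H x) = K * ?g x" for x unfolding K_def by (rule gue_weight_coords[OF N])
  have wm: "gue_weight N \<in> borel_measurable (hermitian_borel N)"
    unfolding gue_weight_def[abs_def] using measurable_mat_trace_pow[of 2 N] by measurable
  have Hm: "?H \<in> measurable ?M (hermitian_borel N)" by (rule measurable_hermitian_of_coords)
  interpret product_sigma_finite "\<lambda>_ :: nat \<times> nat. lborel :: real measure"
    by standard
  have one: "(\<integral>x. ?g x \<partial>?M) = 1"
  proof -
    have "(\<integral>x. ?g x \<partial>?M) = (\<Prod>p\<in>?I. \<integral>t. normal_density 0 (coord_sd N p) t \<partial>lborel)"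
      using coord_sd_pos[OF N] by (intro product_integral_prod) auto
    then show ?thesis using coord_sd_pos[OF N] by simp
  qed
  define Z where "Z = (\<integral>B. gue_weight N B \<partial>hermitian_lebesgue N)"
  have "Z = (\<integral>x. gue_weight N (?H x) \<partial>?M)"
    unfolding Z_def hermitian_lebesgue_def by (rule integral_distr[OF Hm wm])
  then have Z: "Z = K" by (simp add: w one)
  have "(\<integral>A. f A \<partial>GUE N) = (\<integral>A. (gue_weight N A / Z) *\<^sub>R f A \<partial>hermitian_lebesgue N)"
    unfolding GUE_def Z_def[symmetric]
  proof (rule integral_density)
    show "f \<in> borel_measurable (hermitian_lebesgue N)" using f by (simp add: hermitian_lebesgue_def)
    show "(\<lambda>A. gue_weight N A / Z) \<in> borel_measurable (hermitian_lebesgue N)"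
      using wm by (simp add: hermitian_lebesgue_def)
    show "AE A in hermitian_lebesgue N. 0 \<le> gue_weight N A / Z"
      using K by (simp add: Z gue_weight_def)
  qed
  also have "\<dots> = (\<integral>x. (gue_weight N (?H x) / Z) *\<^sub>R f (?H x) \<partial>?M)"
    unfolding hermitian_lebesgue_def by (rule integral_distr[OF Hm]) (use wm f in measurable)
  also have "\<dots> = (\<integral>x. ?g x * f (?H x) \<partial>?M)" using K by (simp add: w Z)
  finally show ?thesis .
qed

text \<open>For a fixed index function \<open>f\<close>, Wick's formula keeps the pairings for which
  \<open>f\<close> is constant on the cycles of \<open>\<rho> \<circ> \<alpha>\<close>; exchanging
  the sums leaves the number of such \<open>f\<close>. The square root in the prefactor avoids
  halving the number of points and treats odd numbers, which admit no pairing, uniformly.\<close>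

lemma gue_moment:
  fixes \<rho> :: "nat \<Rightarrow> nat"
  assumes N: "1 \<le> N" and \<rho>: "permutation \<rho>" and fin: "finite B"
    and orb: "\<And>i. i \<in> B \<Longrightarrow> \<exists>x. b i = orbit \<rho> x" and inj: "inj_on b B"
  shows "(\<integral>A. (\<Prod>i\<in>B. Re (mat_trace (A ^\<^sub>m card (b i)))) \<partial>GUE N) =
    (\<Sum>\<alpha>\<in>pairings (\<Union>(b ` B)). sqrt (1 / real N) ^ card (\<Union>(b ` B)) * real N ^ cyc (\<rho> \<circ> \<alpha>) (\<Union>(b ` B)))"
proof -
  let ?I = "{..<N} \<times> {..<N}" and ?H = "hermitian_of_coords N"
  let ?M = "PiM ?I (\<lambda>_. lborel :: real measure)"
  let ?g = "\<lambda>x. \<Prod>p\<in>?I. normal_density 0 (coord_sd N p) (x p)"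
  define D where "D = \<Union>(b ` B)"
  have bfin: "finite (b i)" "b i \<noteq> {}" if "i \<in> B" for i
    using orb[OF that] finite_orbit permutation_self_in_orbit[OF \<rho>] orbit_nonempty by metis+
  have D: "finite D" unfolding D_def using fin bfin by blast
  have inv: "\<rho> y \<in> D" if "y \<in> D" for y
    using that orb unfolding D_def by (metis UN_E UN_I orbit.step)
  have "0 < card (b i)" if "i \<in> B" for i using bfin[OF that] by (simp add: card_gt_0_iff)
  then have meas: "(\<lambda>A. \<Prod>i\<in>B. Re (mat_trace (A ^\<^sub>m card (b i)))) \<in> borel_measurable (hermitian_borel N)"
    by (intro borel_measurable_prod measurable_mat_trace_pow)
  let ?F = "PiE D (\<lambda>_. {..<N})"
  let ?s = "sqrt (1 / real N)"
  have gf: "gaussian_forms ?I (coord_sd N)"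
    by unfold_locales (use coord_sd_pos[OF N] in auto)
  \<comment> \<open>Forms are indexed by points and not by matrix entries, so an entry that occurs
    several times in the product gives separate factors.\<close>
  let ?c = "\<lambda>f y. entry_coeff (f y, f (\<rho> y))"
  have fN: "f y < N" if "f \<in> ?F" "y \<in> D" for f y using that by (auto simp: PiE_iff)
  have form: "gaussian_forms.form ?I (?c f) y x = ?H x $$ (f y, f (\<rho> y))" if "f \<in> ?F" "y \<in> D" for f y x
    unfolding gaussian_forms.form_def[OF gf]
    by (rule hermitian_of_coords_entry[symmetric]) (use fN that inv in auto)
  have integrand: "gaussian_forms.integrand ?I (coord_sd N) (?c f) (\<lambda>_. 0) D x =
      of_real (?g x) * (\<Prod>y\<in>D. ?H x $$ (f y, f (\<rho> y)))" if "f \<in> ?F" for f x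
    unfolding gaussian_forms.integrand_def[OF gf] gaussian_forms.gauss_density_def[OF gf]
    using form[OF that] by simp
  have wick: "gaussian_forms.moment ?I (coord_sd N) (?c f) (\<lambda>_. 0) D =
      of_real (?s ^ card D) * (\<Sum>\<alpha>\<in>pairings D. if \<forall>x\<in>D. f x = f (\<rho> (\<alpha> x)) then 1 else 0)" if "f \<in> ?F" for f
  proof (rule gaussian_forms.wick[OF gf D, where a = f and b = "\<lambda>x. f (\<rho> x)"])
    fix x y assume "x \<in> D" "y \<in> D"
    then show "gaussian_forms.covariance ?I (coord_sd N) (?c f) x y =
        (if f x = f (\<rho> y) \<and> f y = f (\<rho> x) then of_real (?s\<^sup>2) else 0)"
      unfolding gaussian_forms.covariance_def[OF gf]
      using entry_covariance[OF N, of "f x" "f (\<rho> x)" "f y" "f (\<rho> y)"] fN[OF that] inv N by simp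
  qed
  have tr: "complex_of_real (\<Prod>i\<in>B. Re (mat_trace (?H x ^\<^sub>m card (b i)))) =
      (\<Sum>f\<in>?F. \<Prod>y\<in>D. ?H x $$ (f y, f (\<rho> y)))" for x
  proof -
    have H: "?H x \<in> hermitian_mats N" by (rule hermitian_of_coords_in)
    then have "?H x \<in> carrier_mat N N" by (simp add: hermitian_mats_def)
    from prod_mat_trace_pow[OF this \<rho> fin orb inj] show ?thesis
      unfolding of_real_prod mat_trace_pow_hermitian_real[OF H] D_def .
  qed
  have "complex_of_real (\<integral>A. (\<Prod>i\<in>B. Re (mat_trace (A ^\<^sub>m card (b i)))) \<partial>GUE N) =
      (\<integral>x. complex_of_real (?g x * (\<Prod>i\<in>B. Re (mat_trace (?H x ^\<^sub>m card (b i))))) \<partial>?M)"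
    unfolding integral_GUE[OF N meas] by (simp only: integral_complex_of_real)
  also have "\<dots> = (\<integral>x. (\<Sum>f\<in>?F. gaussian_forms.integrand ?I (coord_sd N) (?c f) (\<lambda>_. 0) D x) \<partial>?M)"
    unfolding of_real_mult tr sum_distrib_left using integrand by (simp cong: sum.cong)
  also have "\<dots> = (\<Sum>f\<in>?F. gaussian_forms.moment ?I (coord_sd N) (?c f) (\<lambda>_. 0) D)"
    unfolding gaussian_forms.moment_def[OF gf]
    by (rule Bochner_Integration.integral_sum) (rule gaussian_forms.integrable_integrand[OF gf D])
  also have "\<dots> = (\<Sum>f\<in>?F. of_real (?s ^ card D) * (\<Sum>\<alpha>\<in>pairings D. if \<forall>x\<in>D. f x = f (\<rho> (\<alpha> x)) then 1 else 0))"
    by (rule sum.cong[OF refl]) (rule wick)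
  also have "\<dots> = of_real (?s ^ card D) * (\<Sum>\<alpha>\<in>pairings D. \<Sum>f\<in>?F. if \<forall>x\<in>D. f x = f (\<rho> (\<alpha> x)) then 1 else 0)"
    unfolding sum_distrib_left[symmetric] by (subst sum.swap) simp
  also have "\<dots> = of_real (?s ^ card D) * (\<Sum>\<alpha>\<in>pairings D. of_nat (N ^ cyc (\<rho> \<circ> \<alpha>) D))"
  proof -
    have "(\<Sum>f\<in>?F. if \<forall>x\<in>D. f x = f (\<rho> (\<alpha> x)) then 1 else 0 :: complex) = of_nat (N ^ cyc (\<rho> \<circ> \<alpha>) D)"
      if a: "\<alpha> \<in> pairings D" for \<alpha>
    proof -
      have "permutation \<alpha>" using pairings_permutes[OF a] D by (auto simp: permutation_permutes)
      then have "permutation (\<rho> \<circ> \<alpha>)" using \<rho> by (intro permutation_compose)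
      moreover have "(\<rho> \<circ> \<alpha>) ` D \<subseteq> D" using pairings_in[OF a] inv by auto
      ultimately have "card {f \<in> ?F. \<forall>x\<in>D. f x = f ((\<rho> \<circ> \<alpha>) x)} = N ^ cyc (\<rho> \<circ> \<alpha>) D"
        by (intro card_orbit_constant_functions D)
      moreover have "(\<Sum>f\<in>?F. if \<forall>x\<in>D. f x = f (\<rho> (\<alpha> x)) then 1 else 0 :: complex) =
          of_nat (card {f \<in> ?F. \<forall>x\<in>D. f x = f ((\<rho> \<circ> \<alpha>) x)})"
        using D by (simp add: sum.If_cases finite_PiE Int_def)
      ultimately show ?thesis by simp
    qed
    then show ?thesis by (simp cong: sum.cong)
  qed
  also have "\<dots> = complex_of_real (\<Sum>\<alpha>\<in>pairings D. ?s ^ card D * real N ^ cyc (\<rho> \<circ> \<alpha>) D)"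
    by (simp add: sum_distrib_left)
  finally show ?thesis unfolding D_def by (simp only: of_real_eq_iff)
qed

section \<open>Moebius inversion over closed partitions\<close>

text \<open>The Moebius function of the partition lattice, from a partition with \<open>n\<close>
  blocks up to the partition with a single block.\<close>

abbreviation moebius_weight :: "nat \<Rightarrow> real" where
  "moebius_weight n \<equiv> (-1) ^ (n - 1) * fact (n - 1)"

lemma moebius_weight_cancel: "n \<noteq> 0 \<Longrightarrow> moebius_weight (Suc n) + real n * moebius_weight n = 0"
  by (cases n) (auto simp: algebra_simps)

lemma partition_on_block_unique:
  "partition_on A P \<Longrightarrow> X \<in> P \<Longrightarrow> Y \<in> P \<Longrightarrow> x \<in> X \<Longrightarrow> x \<in> Y \<Longrightarrow> X = Y"
  using disjointD[OF partition_onD2] by blast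

text \<open>\<open>X = {}\<close> stands for the choice of making \<open>K\<close> a block of its
  own; every other \<open>X\<close> is the block that absorbs \<open>K\<close>.\<close>

lemma partition_on_add_block:
  assumes P: "partition_on (I - K) P" and K: "K \<subseteq> I" "K \<noteq> {}" and X: "X \<in> insert {} P"
  shows "partition_on I (insert (X \<union> K) (P - {X}))"
proof (rule partition_onI)
  have U: "\<Union> P = I - K" using partition_onD1[OF P] by simp
  show "\<Union> (insert (X \<union> K) (P - {X})) = I" using U K X by blast
  have e: "disjnt (X \<union> K) Y" if Y: "Y \<in> P - {X}" for Y
  proof -
    have "Y \<subseteq> I - K" using Y U by blast
    moreover have "disjnt X Y"
      using X Y partition_on_block_unique[OF P, of X Y] by (auto simp: disjnt_iff)
    ultimately show ?thesis by (auto simp: disjnt_iff)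
  qed
  fix Y Z assume YZ: "Y \<in> insert (X \<union> K) (P - {X})" "Z \<in> insert (X \<union> K) (P - {X})" "Y \<noteq> Z"
  show "disjnt Y Z"
  proof (cases "Y = X \<union> K \<or> Z = X \<union> K")
    case True
    then show ?thesis using e YZ disjnt_sym by (metis insertE)
  next
    case False
    then have "Y \<in> P" "Z \<in> P" using YZ by auto
    then show ?thesis using partition_on_block_unique[OF P, of Y Z] YZ(3) by (auto simp: disjnt_iff)
  qed
next
  show "{} \<notin> insert (X \<union> K) (P - {X})" using partition_onD3[OF P] K(2) by auto
qed

text \<open>The inverse of the previous construction. Deleting the empty set covers the case that
  \<open>K\<close> was a whole block.\<close>

lemma partition_on_remove_from_block:
  assumes P: "partition_on I P" and B: "B \<in> P" "K \<subseteq> B"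
  shows "partition_on (I - K) (insert (B - K) (P - {B}) - {{}})"
proof (rule partition_onI)
  have U: "\<Union> P = I" using partition_onD1[OF P] by simp
  have dis: "X = B" if "X \<in> P" "x \<in> X" "x \<in> B" for X x
    using partition_on_block_unique[OF P that(1) B(1) that(2,3)] .
  show "\<Union> (insert (B - K) (P - {B}) - {{}}) = I - K"
  proof (intro equalityI subsetI)
    fix x assume "x \<in> \<Union> (insert (B - K) (P - {B}) - {{}})"
    then obtain Y where "Y \<in> insert (B - K) (P - {B})" "x \<in> Y" by blast
    then consider "x \<in> B - K" | "Y \<in> P" "Y \<noteq> B" "x \<in> Y" by blast
    then show "x \<in> I - K"
    proof cases
      case 1 then show ?thesis using U B by blast
    next
      case 2
      then have "x \<notin> B" using dis by blast
      then show ?thesis using U B 2 by blast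
    qed
  next
    fix x assume x: "x \<in> I - K"
    then obtain Y where Y: "Y \<in> P" "x \<in> Y" using U by blast
    show "x \<in> \<Union> (insert (B - K) (P - {B}) - {{}})"
    proof (cases "Y = B")
      case True
      then show ?thesis using Y x by blast
    next
      case False
      then show ?thesis using Y by blast
    qed
  qed
  fix Y Z assume YZ: "Y \<in> insert (B - K) (P - {B}) - {{}}" "Z \<in> insert (B - K) (P - {B}) - {{}}" "Y \<noteq> Z"
  show "disjnt Y Z"
  proof (rule ccontr)
    assume "\<not> disjnt Y Z"
    then obtain x where x: "x \<in> Y" "x \<in> Z" by (auto simp: disjnt_iff)
    show False
    proof (cases "x \<in> B")
      case True
      then have "Y = B - K" "Z = B - K" using x YZ(1,2) dis by blast+
      then show False using YZ(3) by simp
    next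
      case False
      then have "Y \<in> P" "Z \<in> P" using x YZ(1,2) by blast+
      then show False using partition_on_block_unique[OF P _ _ x] YZ(3) by blast
    qed
  qed
qed simp

text \<open>A minimal closed set \<open>K\<close> lies inside one block. Removing it from its block is a map onto the
  closed partitions of \<open>I - K\<close>, and the fibre over a partition with \<open>n\<close> blocks contributes
  \<open>moebius_weight (Suc n) + n * moebius_weight n = 0\<close>.\<close>

lemma sum_moebius_closed_partitions:
  fixes closed_set :: "'a set \<Rightarrow> bool"
  assumes I: "finite I" "I \<noteq> {}" and cI: "closed_set I"
    and compl: "\<And>U. U \<subseteq> I \<Longrightarrow> closed_set U \<Longrightarrow> closed_set (I - U)"
    and inter: "\<And>U V. U \<subseteq> I \<Longrightarrow> V \<subseteq> I \<Longrightarrow> closed_set U \<Longrightarrow> closed_set V \<Longrightarrow> closed_set (U \<inter> V)"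
  shows "(\<Sum>P | partition_on I P \<and> (\<forall>B\<in>P. closed_set B). moebius_weight (card P)) =
    (if \<forall>U\<subseteq>I. U \<noteq> {} \<longrightarrow> closed_set U \<longrightarrow> U = I then 1 else 0)"
proof (cases "\<forall>U\<subseteq>I. U \<noteq> {} \<longrightarrow> closed_set U \<longrightarrow> U = I")
  case True
  have 1: "P = {I}" if P: "partition_on I P" "\<forall>B\<in>P. closed_set B" for P
  proof -
    have "B = I" if "B \<in> P" for B
      using True P(2) that partition_onD1[OF P(1)] partition_onD3[OF P(1)] by blast
    moreover have "P \<noteq> {}" using partition_onD1[OF P(1)] I(2) by auto
    ultimately show ?thesis by blast
  qed
  have 2: "partition_on I {I}" using I(2) by (rule partition_on_space)
  have "{P. partition_on I P \<and> (\<forall>B\<in>P. closed_set B)} = {{I}}"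
  proof (intro equalityI subsetI)
    fix P assume "P \<in> {{I}}"
    then show "P \<in> {P. partition_on I P \<and> (\<forall>B\<in>P. closed_set B)}" using 2 cI by simp
  qed (use 1 in blast)
  then show ?thesis using True by simp
next
  case False
  then obtain U where U: "U \<subseteq> I" "U \<noteq> {}" "closed_set U" "U \<noteq> I" by blast
  define Q where "Q V \<longleftrightarrow> V \<subseteq> U \<and> V \<noteq> {} \<and> closed_set V" for V
  have "Q U" using U by (simp add: Q_def)
  from ex_has_least_nat[of Q, OF this, of card]
  obtain K where "Q K \<and> (\<forall>V. Q V \<longrightarrow> card K \<le> card V)" ..
  then have K: "Q K" "\<And>V. Q V \<Longrightarrow> card K \<le> card V" by auto
  have KI: "K \<subseteq> I" "K \<noteq> {}" "K \<noteq> I" "closed_set K" using K(1) U by (auto simp: Q_def)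
  have fK: "finite K" using KI(1) I(1) by (rule finite_subset)
  have min: "V = K" if "V \<subseteq> K" "V \<noteq> {}" "closed_set V" for V
  proof -
    have "Q V" using that K(1) by (auto simp: Q_def)
    then have "card K \<le> card V" by (rule K(2))
    then show ?thesis using that(1) fK by (metis card_seteq)
  qed
  have empty: "closed_set {}" using compl[OF _ cI] by simp
  have un: "closed_set (V \<union> W)" if "V \<subseteq> I" "W \<subseteq> I" "closed_set V" "closed_set W" for V W
  proof -
    have "V \<union> W = I - ((I - V) \<inter> (I - W))" using that by blast
    then show ?thesis using compl inter that by (metis Diff_subset Int_lower1 order.trans)
  qed
  have diff: "closed_set (V - W)" if "V \<subseteq> I" "W \<subseteq> I" "closed_set V" "closed_set W" for V W
  proof -
    have "V - W = V \<inter> (I - W)" using that by blast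
    then show ?thesis using compl inter that by (metis Diff_subset)
  qed
  define \<P> where "\<P> J = {P. partition_on J P \<and> (\<forall>B\<in>P. closed_set B)}" for J
  define blk where "blk P = (THE B. B \<in> P \<and> K \<subseteq> B)" for P
  have sub: "B \<subseteq> J" if "P \<in> \<P> J" "B \<in> P" for P J B
    using that partition_onD1[of J P] by (auto simp: \<P>_def)
  have blk: "blk P \<in> P \<and> K \<subseteq> blk P" if P: "P \<in> \<P> I" for P
  proof -
    have p: "partition_on I P" using P by (simp add: \<P>_def)
    obtain x where x: "x \<in> K" using KI(2) by blast
    then obtain B where B: "B \<in> P" "x \<in> B" using partition_onD1[OF p] KI(1) by blast
    \<comment> \<open>The intersection is closed and contains \<open>x\<close>, so minimality of
      \<open>K\<close> forces it to be all of \<open>K\<close>.\<close>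
    have "B \<inter> K = K"
    proof (rule min)
      show "closed_set (B \<inter> K)" using P B(1) sub[OF P B(1)] KI by (intro inter) (auto simp: \<P>_def)
    qed (use x B in auto)
    then have 1: "B \<in> P \<and> K \<subseteq> B" using B by blast
    have "C = B" if "C \<in> P \<and> K \<subseteq> C" for C
      using partition_on_block_unique[OF p, of C B x] that B x by blast
    then show ?thesis unfolding blk_def using 1 by (rule theI[rotated])
  qed
  have blkI: "blk P = B" if P: "P \<in> \<P> I" and B: "B \<in> P" "K \<subseteq> B" for P B
  proof -
    obtain x where "x \<in> K" using KI(2) by blast
    then show ?thesis
      using partition_on_block_unique[of I P "blk P" B x] blk[OF P] P B by (auto simp: \<P>_def)
  qed
  have fP: "finite (\<P> J)" if "finite J" for J
    using finitely_many_partition_on[OF that] by (rule finite_subset[rotated]) (auto simp: \<P>_def)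
  have ne: "{} \<notin> P" if "P \<in> \<P> J" for P J using that partition_onD3 by (auto simp: \<P>_def)
  let ?f = "\<lambda>(P, X). insert (X \<union> K) (P - {X})"
  let ?S = "SIGMA P:\<P> (I - K). insert {} P"
  have fin: "?f p \<in> \<P> I" if p: "p \<in> ?S" for p
  proof -
    obtain P X where e: "p = (P, X)" and P: "P \<in> \<P> (I - K)" and X: "X \<in> insert {} P" using p by blast
    have cX: "closed_set X" using X P empty by (auto simp: \<P>_def)
    have XI: "X \<subseteq> I" using X sub[OF P] by blast
    have "closed_set (X \<union> K)" using un[OF XI KI(1) cX KI(4)] .
    then show ?thesis
      using partition_on_add_block[OF _ KI(1,2) X] P unfolding e by (auto simp: \<P>_def)
  qed
  have KX: "X \<union> K - K = X" "X \<union> K \<notin> P - {X}" if "P \<in> \<P> (I - K)" "X \<in> insert {} P" for P X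
    using that sub[OF that(1)] KI(2) by blast+
  \<comment> \<open>The inverse returns the shrunken partition together with what remains of the
    block of \<open>K\<close>; the remainder, possibly empty, records where \<open>K\<close> has to
    be put back.\<close>
  have bij: "bij_betw ?f ?S (\<P> I)"
  proof (rule bij_betw_byWitness[where f' = "\<lambda>P. (insert (blk P - K) (P - {blk P}) - {{}}, blk P - K)"])
    show "\<forall>p\<in>?S. (\<lambda>P. (insert (blk P - K) (P - {blk P}) - {{}}, blk P - K)) (?f p) = p"
    proof
      fix p assume p: "p \<in> ?S"
      then obtain P X where e: "p = (P, X)" and P: "P \<in> \<P> (I - K)" and X: "X \<in> insert {} P" by blast
      have fp: "?f p = insert (X \<union> K) (P - {X})" by (simp add: e)
      have b: "blk (insert (X \<union> K) (P - {X})) = X \<union> K"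
        using fin[OF p] unfolding fp by (rule blkI) auto
      have 1: "insert (X \<union> K) (P - {X}) - {X \<union> K} = P - {X}" using KX(2)[OF P X] by auto
      have "insert X (P - {X}) - {{}} = P" using X ne[OF P] by auto
      then show "(\<lambda>P. (insert (blk P - K) (P - {blk P}) - {{}}, blk P - K)) (?f p) = p"
        unfolding fp unfolding b 1 KX(1)[OF P X] by (simp add: e)
    qed
    show "\<forall>P\<in>\<P> I. ?f (insert (blk P - K) (P - {blk P}) - {{}}, blk P - K) = P"
    proof
      fix P assume P: "P \<in> \<P> I"
      have p: "partition_on I P" using P by (simp add: \<P>_def)
      have b: "blk P \<in> P" "K \<subseteq> blk P" using blk[OF P] by auto
      have "blk P - K \<notin> P - {blk P}"
      proof
        assume a: "blk P - K \<in> P - {blk P}"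
        then have "blk P - K \<noteq> {}" using ne[OF P] by (metis DiffD1)
        then obtain x where "x \<in> blk P - K" by blast
        then show False using partition_on_block_unique[OF p, of "blk P - K" "blk P" x] a b by blast
      qed
      then have "insert (blk P - K) (P - {blk P}) - {{}} - {blk P - K} = P - {blk P}"
        using ne[OF P] by blast
      then show "?f (insert (blk P - K) (P - {blk P}) - {{}}, blk P - K) = P"
        using b by (simp add: Un_absorb2 insert_absorb)
    qed
    show "?f ` ?S \<subseteq> \<P> I" using fin by blast
    show "(\<lambda>P. (insert (blk P - K) (P - {blk P}) - {{}}, blk P - K)) ` \<P> I \<subseteq> ?S"
    proof (rule image_subsetI)
      fix P assume P: "P \<in> \<P> I"
      have p: "partition_on I P" using P by (simp add: \<P>_def)
      have b: "blk P \<in> P" "K \<subseteq> blk P" using blk[OF P] by auto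
      have "closed_set (blk P - K)" using P b sub[OF P b(1)] KI by (intro diff) (auto simp: \<P>_def)
      then have "insert (blk P - K) (P - {blk P}) - {{}} \<in> \<P> (I - K)"
        using partition_on_remove_from_block[OF p b] P by (auto simp: \<P>_def)
      then show "(insert (blk P - K) (P - {blk P}) - {{}}, blk P - K) \<in> ?S" by blast
    qed
  qed
  have "(\<Sum>P\<in>\<P> I. moebius_weight (card P)) = (\<Sum>p\<in>?S. moebius_weight (card (?f p)))"
    by (rule sum.reindex_bij_betw[OF bij, symmetric])
  also have "\<dots> = (\<Sum>P\<in>\<P> (I - K). \<Sum>X\<in>insert {} P. moebius_weight (card (insert (X \<union> K) (P - {X}))))"
  proof (subst sum.Sigma)
    show "finite (\<P> (I - K))" using fP I(1) by simp
    show "\<forall>P\<in>\<P> (I - K). finite (insert {} P)"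
      using finite_elements[of "I - K"] I(1) by (auto simp: \<P>_def)
  qed (simp add: case_prod_unfold)
  also have "\<dots> = (\<Sum>P\<in>\<P> (I - K). 0)"
  proof (rule sum.cong[OF refl])
    fix P assume P: "P \<in> \<P> (I - K)"
    have finP: "finite P" using P finite_elements[of "I - K"] I(1) by (auto simp: \<P>_def)
    \<comment> \<open>\<open>K\<close> is a proper subset of \<open>I\<close>, so at least one block
      remains, as the cancellation of weights requires.\<close>
    have "P \<noteq> {}" using P partition_onD1[of "I - K" P] KI by (auto simp: \<P>_def)
    then have n: "card P \<noteq> 0" using finP by simp
    have "card (insert (X \<union> K) (P - {X})) = card P" if "X \<in> P" for X
      using KX(2)[OF P, of X] finP that card_Suc_Diff1[OF finP that] by simp
    moreover have "card (insert ({} \<union> K) (P - {{}})) = Suc (card P)"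
      using KX(2)[OF P, of "{}"] finP ne[OF P] by simp
    ultimately show "(\<Sum>X\<in>insert {} P. moebius_weight (card (insert (X \<union> K) (P - {X})))) = 0"
      using finP ne[OF P] moebius_weight_cancel[OF n] by (simp del: Un_empty_left)
  qed
  finally show ?thesis using False by (simp add: \<P>_def)
qed

section \<open>Pairings that preserve the blocks of a partition\<close>

lemma perm_restrict_pairings:
  assumes a: "\<alpha> \<in> pairings A" and E: "E \<subseteq> A" "\<alpha> ` E \<subseteq> E"
  shows "perm_restrict \<alpha> E \<in> pairings E"
proof -
  have 1: "perm_restrict \<alpha> E (perm_restrict \<alpha> E x) = x" for x
    using E(2) pairings_apply_apply[OF a, of x] by (auto simp: perm_restrict_def)
  have "bij_betw (perm_restrict \<alpha> E) E E"
    by (rule bij_betw_byWitness[where f' = "perm_restrict \<alpha> E"]) (use E(2) pairings_apply_apply[OF a] in \<open>auto simp: perm_restrict_def\<close>)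
  then have "perm_restrict \<alpha> E permutes E" by (rule bij_imp_permutes) (simp add: perm_restrict_def)
  moreover have "perm_restrict \<alpha> E x \<noteq> x" if "x \<in> E" for x
    using that E pairings_neq[OF a, of x] by (auto simp: perm_restrict_def)
  ultimately show ?thesis using 1 by (simp add: pairings_def)
qed

lemma comp_pairings:
  assumes a: "\<alpha> \<in> pairings E" and b: "\<beta> \<in> pairings F" and d: "E \<inter> F = {}"
  shows "\<alpha> \<circ> \<beta> \<in> pairings (E \<union> F)" "x \<in> E \<Longrightarrow> (\<alpha> \<circ> \<beta>) x = \<alpha> x" "x \<in> F \<Longrightarrow> (\<alpha> \<circ> \<beta>) x = \<beta> x"
proof -
  have e: "(\<alpha> \<circ> \<beta>) x = \<alpha> x" if "x \<in> E" for x
  proof -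
    have "x \<notin> F" using that d by blast
    then show ?thesis using permutes_not_in[OF pairings_permutes[OF b], of x] by simp
  qed
  have f: "(\<alpha> \<circ> \<beta>) x = \<beta> x" if "x \<in> F" for x
    using permutes_not_in[OF pairings_permutes[OF a]] pairings_in[OF b that] d by auto
  show "x \<in> E \<Longrightarrow> (\<alpha> \<circ> \<beta>) x = \<alpha> x" "x \<in> F \<Longrightarrow> (\<alpha> \<circ> \<beta>) x = \<beta> x" using e f by auto
  have "\<alpha> \<circ> \<beta> permutes (E \<union> F)"
    using permutes_subset[OF pairings_permutes[OF a], of "E \<union> F"] permutes_subset[OF pairings_permutes[OF b], of "E \<union> F"]
    by (intro permutes_compose) auto
  moreover have "(\<alpha> \<circ> \<beta>) x \<noteq> x \<and> (\<alpha> \<circ> \<beta>) ((\<alpha> \<circ> \<beta>) x) = x" if "x \<in> E \<union> F" for x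
  proof (cases "x \<in> E")
    case True
    then have "(\<alpha> \<circ> \<beta>) x = \<alpha> x" "(\<alpha> \<circ> \<beta>) (\<alpha> x) = \<alpha> (\<alpha> x)" using e pairings_in[OF a] by blast+
    then show ?thesis using pairings_neq[OF a True] pairings_apply_apply[OF a] by metis
  next
    case False
    then have F: "x \<in> F" using that by blast
    then have "(\<alpha> \<circ> \<beta>) x = \<beta> x" "(\<alpha> \<circ> \<beta>) (\<beta> x) = \<beta> (\<beta> x)" using f pairings_in[OF b] by blast+
    then show ?thesis using pairings_neq[OF b F] pairings_apply_apply[OF b] by metis
  qed
  ultimately show "\<alpha> \<circ> \<beta> \<in> pairings (E \<union> F)" by (simp add: pairings_def)
qed

lemma cyc_cong:
  assumes "\<And>x. x \<in> E \<Longrightarrow> f x \<in> E" "\<And>x. x \<in> E \<Longrightarrow> f x = g x"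
  shows "cyc f E = cyc g E"
proof -
  have "orbit f x = orbit g x" if "x \<in> E" for x
    by (rule orbit_cong0[OF that]) (use assms in auto)
  then show ?thesis by (simp add: cyc_def cong: image_cong)
qed

lemma cyc_Un:
  assumes E: "\<And>x. x \<in> E \<Longrightarrow> f x \<in> E" and F: "\<And>x. x \<in> F \<Longrightarrow> f x \<in> F"
    and d: "E \<inter> F = {}" and fin: "finite E" "finite F"
  shows "cyc f (E \<union> F) = cyc f E + cyc f F"
proof -
  have "orbit f x \<noteq> orbit f y" if "x \<in> E" "y \<in> F" for x y
  proof
    assume e: "orbit f x = orbit f y"
    have "f x \<in> E" using E that by blast
    moreover have "f x \<in> orbit f y" using orbit.base[of f x] by (simp only: e)
    moreover have "orbit f y \<subseteq> F" by (rule orbit_subset_invariant) (use F that in auto)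
    ultimately show False using d by blast
  qed
  then have "orbit f ` E \<inter> orbit f ` F = {}" by blast
  then show ?thesis unfolding cyc_def image_Un using fin by (intro card_Un_disjoint) auto
qed

text \<open>Pairings of the single blocks combine to the pairings of the union that preserve each
  block. The weight is multiplicative because points and cycles add up over disjoint invariant
  sets.\<close>

lemma prod_sum_pairings:
  fixes \<rho> :: "'a \<Rightarrow> 'a" and s N :: real
  assumes "finite \<D>" and "\<And>E. E \<in> \<D> \<Longrightarrow> finite E" and "\<And>E x. E \<in> \<D> \<Longrightarrow> x \<in> E \<Longrightarrow> \<rho> x \<in> E"
    and "\<And>E F. E \<in> \<D> \<Longrightarrow> F \<in> \<D> \<Longrightarrow> E \<noteq> F \<Longrightarrow> E \<inter> F = {}"
  shows "(\<Prod>E\<in>\<D>. \<Sum>\<alpha>\<in>pairings E. s ^ card E * N ^ cyc (\<rho> \<circ> \<alpha>) E) =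
    (\<Sum>\<alpha> | \<alpha> \<in> pairings (\<Union>\<D>) \<and> (\<forall>E\<in>\<D>. \<alpha> ` E \<subseteq> E). s ^ card (\<Union>\<D>) * N ^ cyc (\<rho> \<circ> \<alpha>) (\<Union>\<D>))"
  using assms
proof (induction \<D> rule: finite_induct)
  case empty
  then show ?case by (simp add: pairings_empty cyc_def)
next
  case (insert E \<D>)
  let ?F = "\<Union>\<D>"
  let ?S = "{\<alpha>. \<alpha> \<in> pairings ?F \<and> (\<forall>E\<in>\<D>. \<alpha> ` E \<subseteq> E)}"
  let ?T = "{\<alpha>. \<alpha> \<in> pairings (E \<union> ?F) \<and> (\<forall>G\<in>insert E \<D>. \<alpha> ` G \<subseteq> G)}"
  let ?w = "\<lambda>E \<alpha>. s ^ card E * N ^ cyc (\<rho> \<circ> \<alpha>) E"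
  have fin: "finite E" "finite ?F" using insert.prems(1) insert.hyps by auto
  have rE: "\<rho> x \<in> E" if "x \<in> E" for x using insert.prems(2) that by blast
  have rF: "\<rho> x \<in> ?F" if "x \<in> ?F" for x using insert.prems(2) that by blast
  have d: "E \<inter> ?F = {}" using insert.prems(3) insert.hyps by blast
  have "bij_betw (\<lambda>(\<alpha>, \<beta>). \<alpha> \<circ> \<beta>) (pairings E \<times> ?S) ?T"
  proof (rule bij_betw_byWitness[where f' = "\<lambda>\<alpha>. (perm_restrict \<alpha> E, perm_restrict \<alpha> ?F)"])
    show "\<forall>p\<in>pairings E \<times> ?S. (\<lambda>\<alpha>. (perm_restrict \<alpha> E, perm_restrict \<alpha> ?F)) ((\<lambda>(\<alpha>, \<beta>). \<alpha> \<circ> \<beta>) p) = p"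
    proof
      fix p assume "p \<in> pairings E \<times> ?S"
      then obtain \<alpha> \<beta> where p: "p = (\<alpha>, \<beta>)" and a: "\<alpha> \<in> pairings E" and b: "\<beta> \<in> pairings ?F" by blast
      have "perm_restrict (\<alpha> \<circ> \<beta>) E x = \<alpha> x" for x
        using comp_pairings(2)[OF a b d] permutes_not_in[OF pairings_permutes[OF a]] by (simp add: perm_restrict_def)
      moreover have "perm_restrict (\<alpha> \<circ> \<beta>) ?F x = \<beta> x" for x
        using comp_pairings(3)[OF a b d] permutes_not_in[OF pairings_permutes[OF b], of x] unfolding perm_restrict_def by metis
      ultimately show "(\<lambda>\<alpha>. (perm_restrict \<alpha> E, perm_restrict \<alpha> ?F)) ((\<lambda>(\<alpha>, \<beta>). \<alpha> \<circ> \<beta>) p) = p"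
        unfolding p prod.case by (metis ext)
    qed
    show "\<forall>\<alpha>\<in>?T. (\<lambda>(\<alpha>, \<beta>). \<alpha> \<circ> \<beta>) (perm_restrict \<alpha> E, perm_restrict \<alpha> ?F) = \<alpha>"
    proof
      fix \<alpha> assume "\<alpha> \<in> ?T"
      then have a: "\<alpha> \<in> pairings (E \<union> ?F)" and i: "\<alpha> ` ?F \<subseteq> ?F" by blast+
      have "(perm_restrict \<alpha> E \<circ> perm_restrict \<alpha> ?F) x = \<alpha> x" for x
      proof (cases "x \<in> ?F")
        case True
        then have "\<alpha> x \<in> ?F" using i by blast
        then have "\<alpha> x \<notin> E" using d by blast
        then show ?thesis using True by (simp add: perm_restrict_def)
      next
        case False
        then show ?thesis using permutes_not_in[OF pairings_permutes[OF a], of x] by (simp add: perm_restrict_def)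
      qed
      then show "(\<lambda>(\<alpha>, \<beta>). \<alpha> \<circ> \<beta>) (perm_restrict \<alpha> E, perm_restrict \<alpha> ?F) = \<alpha>" unfolding prod.case by (rule ext)
    qed
    show "(\<lambda>(\<alpha>, \<beta>). \<alpha> \<circ> \<beta>) ` (pairings E \<times> ?S) \<subseteq> ?T"
    proof (rule image_subsetI)
      fix p assume "p \<in> pairings E \<times> ?S"
      then obtain \<alpha> \<beta> where p: "p = (\<alpha>, \<beta>)" and a: "\<alpha> \<in> pairings E" and b: "\<beta> \<in> pairings ?F"
        and i: "\<And>G. G \<in> \<D> \<Longrightarrow> \<beta> ` G \<subseteq> G" by blast
      have "(\<alpha> \<circ> \<beta>) x \<in> E" if "x \<in> E" for x using comp_pairings(2)[OF a b d that] pairings_in[OF a that] by metis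
      moreover have "(\<alpha> \<circ> \<beta>) x \<in> G" if "G \<in> \<D>" "x \<in> G" for G x
        using comp_pairings(3)[OF a b d, of x] i[OF that(1)] that by (metis UnionI image_subset_iff)
      ultimately show "(\<lambda>(\<alpha>, \<beta>). \<alpha> \<circ> \<beta>) p \<in> ?T" unfolding p prod.case using comp_pairings(1)[OF a b d] by blast
    qed
    show "(\<lambda>\<alpha>. (perm_restrict \<alpha> E, perm_restrict \<alpha> ?F)) ` ?T \<subseteq> pairings E \<times> ?S"
    proof (rule image_subsetI)
      fix \<alpha> assume "\<alpha> \<in> ?T"
      then have a: "\<alpha> \<in> pairings (E \<union> ?F)" and i: "\<alpha> ` ?F \<subseteq> ?F" "\<alpha> ` E \<subseteq> E" "\<And>G. G \<in> \<D> \<Longrightarrow> \<alpha> ` G \<subseteq> G" by blast+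
      have "perm_restrict \<alpha> E \<in> pairings E" by (rule perm_restrict_pairings[OF a _ i(2)]) simp
      moreover have "perm_restrict \<alpha> ?F \<in> pairings ?F" by (rule perm_restrict_pairings[OF a _ i(1)]) simp
      moreover have "perm_restrict \<alpha> ?F ` G \<subseteq> G" if "G \<in> \<D>" for G
        using i(3)[OF that] by (auto simp: perm_restrict_def)
      ultimately show "(perm_restrict \<alpha> E, perm_restrict \<alpha> ?F) \<in> pairings E \<times> ?S" by blast
    qed
  qed
  from sum.reindex_bij_betw[OF this, of "?w (E \<union> ?F)"]
  have "(\<Sum>\<alpha>\<in>?T. ?w (E \<union> ?F) \<alpha>) = (\<Sum>(\<alpha>, \<beta>)\<in>pairings E \<times> ?S. ?w (E \<union> ?F) (\<alpha> \<circ> \<beta>))"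
    by (simp add: case_prod_unfold)
  also have "\<dots> = (\<Sum>(\<alpha>, \<beta>)\<in>pairings E \<times> ?S. ?w E \<alpha> * ?w ?F \<beta>)"
  proof (rule sum.cong[OF refl])
    fix p assume "p \<in> pairings E \<times> ?S"
    then obtain \<alpha> \<beta> where p: "p = (\<alpha>, \<beta>)" and a: "\<alpha> \<in> pairings E" and b: "\<beta> \<in> pairings ?F" by blast
    have 1: "(\<rho> \<circ> (\<alpha> \<circ> \<beta>)) x = (\<rho> \<circ> \<alpha>) x" "(\<rho> \<circ> (\<alpha> \<circ> \<beta>)) x \<in> E" if "x \<in> E" for x
      using comp_pairings(2)[OF a b d that] rE[OF pairings_in[OF a that]] by simp_all
    have 2: "(\<rho> \<circ> (\<alpha> \<circ> \<beta>)) x = (\<rho> \<circ> \<beta>) x" "(\<rho> \<circ> (\<alpha> \<circ> \<beta>)) x \<in> ?F" if "x \<in> ?F" for x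
      using comp_pairings(3)[OF a b d that] rF[OF pairings_in[OF b that]] by (simp_all only: o_apply)
    have "cyc (\<rho> \<circ> (\<alpha> \<circ> \<beta>)) (E \<union> ?F) = cyc (\<rho> \<circ> (\<alpha> \<circ> \<beta>)) E + cyc (\<rho> \<circ> (\<alpha> \<circ> \<beta>)) ?F"
      by (rule cyc_Un[OF 1(2) 2(2) d fin])
    also have "cyc (\<rho> \<circ> (\<alpha> \<circ> \<beta>)) E = cyc (\<rho> \<circ> \<alpha>) E" by (rule cyc_cong[OF 1(2) 1(1)])
    also have "cyc (\<rho> \<circ> (\<alpha> \<circ> \<beta>)) ?F = cyc (\<rho> \<circ> \<beta>) ?F" by (rule cyc_cong[OF 2(2) 2(1)])
    finally have c: "cyc (\<rho> \<circ> (\<alpha> \<circ> \<beta>)) (E \<union> ?F) = cyc (\<rho> \<circ> \<alpha>) E + cyc (\<rho> \<circ> \<beta>) ?F" .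
    have "card (E \<union> ?F) = card E + card ?F" using fin d by (rule card_Un_disjoint)
    then show "(case p of (\<alpha>, \<beta>) \<Rightarrow> ?w (E \<union> ?F) (\<alpha> \<circ> \<beta>)) = (case p of (\<alpha>, \<beta>) \<Rightarrow> ?w E \<alpha> * ?w ?F \<beta>)"
      unfolding p prod.case c by (simp add: power_add)
  qed
  also have "\<dots> = (\<Sum>\<alpha>\<in>pairings E. ?w E \<alpha>) * (\<Sum>\<beta>\<in>?S. ?w ?F \<beta>)"
    by (simp only: sum_product sum.cartesian_product)
  also have "(\<Sum>\<beta>\<in>?S. ?w ?F \<beta>) = (\<Prod>E\<in>\<D>. \<Sum>\<alpha>\<in>pairings E. ?w E \<alpha>)"
    by (rule insert.IH[OF insert.prems(1)[OF insertI2] insert.prems(2)[OF insertI2] insert.prems(3)[OF insertI2 insertI2], symmetric])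
  finally show ?case by (simp only: prod.insert[OF insert.hyps(1,2)] Union_insert)
qed

section \<open>Cumulants and the topological expansion\<close>

text \<open>Each set partition contributes the pairings preserving all its blocks. With the sums
  exchanged, a fixed \<alpha> collects the Moebius weights of the partitions whose blocks it
  preserves, and their total is 1 or 0 according to transitivity.\<close>

lemma gue_cumulant_eq_sum_pairings:
  assumes \<rho>: "\<rho> \<in> conj_class \<mu>" and N: "1 \<le> N" and \<mu>: "\<mu> \<noteq> []"
  shows "gue_cumulant N \<mu> =
    (\<Sum>\<alpha> | \<alpha> \<in> pairings {1..sum_list \<mu>} \<and> transitive_on {1..sum_list \<mu>} {\<rho>, \<alpha>}.
      sqrt (1 / real N) ^ sum_list \<mu> * real N ^ cyc (\<rho> \<circ> \<alpha>) {1..sum_list \<mu>})"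
proof -
  let ?S = "{1..sum_list \<mu>}" and ?I = "{..<length \<mu>}" and ?s = "sqrt (1 / real N)"
  have rp: "\<rho> permutes ?S" using \<rho> by (rule conj_class_permutes)
  have pr: "permutation \<rho>" using rp by (auto simp: permutation_permutes)
  obtain b where b: "bij_betw b ?I (orbit \<rho> ` ?S)" and cb: "\<And>i. i < length \<mu> \<Longrightarrow> card (b i) = \<mu> ! i"
    using conj_class_enumerate_orbits[OF \<rho>] by blast
  have orb: "\<exists>x. b i = orbit \<rho> x" if "i \<in> ?I" for i using bij_betwE[OF b] that by blast
  have inj: "inj_on b ?I" using b by (rule bij_betw_imp_inj_on)
  have SI: "\<Union>(b ` ?I) = ?S"
    using partition_onD1[OF partition_on_orbits[OF rp]] bij_betw_imp_surj_on[OF b] by simp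
  have bne: "b i \<noteq> {}" if "i \<in> ?I" for i using orb[OF that] orbit_nonempty by metis
  have bdis: "b i \<inter> b j = {}" if "i \<in> ?I" "j \<in> ?I" "i \<noteq> j" for i j
  proof (rule ccontr)
    assume "b i \<inter> b j \<noteq> {}"
    then obtain z where "z \<in> b i" "z \<in> b j" by blast
    then have "b i = b j" using orb[OF that(1)] orb[OF that(2)] orbit_eq_orbit[OF pr] by metis
    then show False using inj that by (metis inj_onD)
  qed
  define D where "D B = \<Union>(b ` B)" for B
  have DI: "D ?I = ?S" using SI by (simp add: D_def)
  have rD: "\<rho> x \<in> D B" if B: "B \<subseteq> ?I" and x: "x \<in> D B" for B x
  proof -
    obtain i where i: "i \<in> B" "x \<in> b i" using x unfolding D_def by blast
    obtain y where "b i = orbit \<rho> y" using orb[OF subsetD[OF B i(1)]] by blast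
    then have "\<rho> x \<in> b i" using i(2) orbit.step[of x \<rho> y] by simp
    then show ?thesis using i(1) unfolding D_def by blast
  qed
  have D_in: "i \<in> B" if x: "x \<in> b i" "x \<in> D B" and i: "i \<in> ?I" and B: "B \<subseteq> ?I" for x i B
  proof -
    obtain j where "j \<in> B" "x \<in> b j" using x(2) unfolding D_def by blast
    then show ?thesis using bdis[OF i, of j] x(1) B by blast
  qed
  have D_sub: "B \<subseteq> C" if BC: "D B \<subseteq> D C" "B \<subseteq> ?I" "C \<subseteq> ?I" for B C
  proof
    fix i assume i: "i \<in> B"
    then have iI: "i \<in> ?I" using BC(2) by blast
    obtain x where x: "x \<in> b i" using bne[OF iI] by blast
    then have "x \<in> D C" using i BC(1) unfolding D_def by blast
    then show "i \<in> C" using D_in[OF x _ iI BC(3)] by blast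
  qed
  have D_Diff: "D (?I - B) = ?S - D B" if "B \<subseteq> ?I" for B
  proof (intro equalityI subsetI)
    fix x assume "x \<in> D (?I - B)"
    then obtain i where i: "i \<in> ?I" "i \<notin> B" "x \<in> b i" unfolding D_def by blast
    then have "x \<notin> D B" using D_in[OF i(3) _ i(1) that] by blast
    moreover have "x \<in> D ?I" using i unfolding D_def by blast
    ultimately show "x \<in> ?S - D B" unfolding DI by blast
  next
    fix x assume x: "x \<in> ?S - D B"
    then have "x \<in> D ?I" unfolding DI by blast
    then obtain i where "i \<in> ?I" "x \<in> b i" unfolding D_def by blast
    then show "x \<in> D (?I - B)" using x unfolding D_def by blast
  qed
  have D_Int: "D (B \<inter> C) = D B \<inter> D C" if "B \<subseteq> ?I" "C \<subseteq> ?I" for B C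
  proof (intro equalityI subsetI)
    fix x assume "x \<in> D B \<inter> D C"
    then obtain i where i: "i \<in> B" "x \<in> b i" "x \<in> D C" unfolding D_def by blast
    then have "i \<in> C" using D_in[OF i(2,3)] that by blast
    then show "x \<in> D (B \<inter> C)" using i unfolding D_def by blast
  qed (auto simp: D_def)
  \<comment> \<open>Since \<alpha> is an involution and the cycles are disjoint, these index sets
    are stable under complement and intersection, as the Moebius lemma demands.\<close>
  define cl where "cl \<alpha> B \<longleftrightarrow> \<alpha> ` D B \<subseteq> D B" for \<alpha> :: "nat \<Rightarrow> nat" and B
  have key: "(\<Sum>P | partition_on ?I P \<and> (\<forall>B\<in>P. cl \<alpha> B). moebius_weight (card P)) =
      (if transitive_on ?S {\<rho>, \<alpha>} then 1 else 0)" if a: "\<alpha> \<in> pairings ?S" for \<alpha>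
  proof -
    have "(\<forall>U\<subseteq>?I. U \<noteq> {} \<longrightarrow> cl \<alpha> U \<longrightarrow> U = ?I) \<longleftrightarrow> transitive_on ?S {\<rho>, \<alpha>}"
    proof
      assume h: "\<forall>U\<subseteq>?I. U \<noteq> {} \<longrightarrow> cl \<alpha> U \<longrightarrow> U = ?I"
      show "transitive_on ?S {\<rho>, \<alpha>}" unfolding transitive_on_def
      proof (intro allI impI)
        fix V assume V: "V \<subseteq> ?S" "V \<noteq> {}" "\<forall>h\<in>{\<rho>, \<alpha>}. h ` V \<subseteq> V"
        \<comment> \<open>A set invariant under \<rho> is a union of cycles; \<open>U\<close> lists
          their numbers, which translates subsets of points into subsets of the index set.\<close>
        define U where "U = {i \<in> ?I. b i \<subseteq> V}"
        have "x \<in> D U" if x: "x \<in> V" for x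
        proof -
          have "x \<in> D ?I" using x V(1) unfolding DI by blast
          then obtain i where i: "i \<in> ?I" "x \<in> b i" unfolding D_def by blast
          then obtain y where "b i = orbit \<rho> y" using orb by blast
          then have "b i = orbit \<rho> x" using i(2) orbit_eq_orbit[OF pr] by metis
          then have "b i \<subseteq> V" using orbit_subset_invariant[of \<rho> V x] V(3) x by simp
          then show ?thesis using i unfolding D_def U_def by blast
        qed
        moreover have "D U \<subseteq> V" unfolding D_def U_def by blast
        ultimately have DU: "D U = V" by blast
        have "U \<noteq> {}" using DU V(2) unfolding D_def by blast
        moreover have "cl \<alpha> U" using V(3) unfolding cl_def DU by simp
        moreover have "U \<subseteq> ?I" unfolding U_def by blast
        ultimately have "U = ?I" using h by blast
        then show "V = ?S" using DU DI by simp
      qed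
    next
      assume t: "transitive_on ?S {\<rho>, \<alpha>}"
      show "\<forall>U\<subseteq>?I. U \<noteq> {} \<longrightarrow> cl \<alpha> U \<longrightarrow> U = ?I"
      proof (intro allI impI)
        fix U assume U: "U \<subseteq> ?I" "U \<noteq> {}" "cl \<alpha> U"
        obtain i where "i \<in> U" using U(2) by blast
        then have 1: "D U \<noteq> {}" using U(1) bne[of i] unfolding D_def by blast
        have 2: "D U \<subseteq> ?S" unfolding DI[symmetric] D_def using U(1) by blast
        have "\<rho> ` D U \<subseteq> D U" using rD[OF U(1)] by blast
        then have 3: "\<forall>h\<in>{\<rho>, \<alpha>}. h ` D U \<subseteq> D U" using U(3) unfolding cl_def by simp
        have "D U = ?S" by (rule transitive_onD[OF t 2 1 3])
        then have "D ?I \<subseteq> D U" unfolding DI by simp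
        then have "?I \<subseteq> U" by (rule D_sub) (use U(1) in simp_all)
        then show "U = ?I" using U(1) by blast
      qed
    qed
    moreover have "(\<Sum>P | partition_on ?I P \<and> (\<forall>B\<in>P. cl \<alpha> B). moebius_weight (card P)) =
        (if \<forall>U\<subseteq>?I. U \<noteq> {} \<longrightarrow> cl \<alpha> U \<longrightarrow> U = ?I then 1 else 0)"
    proof (rule sum_moebius_closed_partitions[where closed_set = "cl \<alpha>" and I = ?I])
      show "?I \<noteq> {}" using \<mu> by (simp add: lessThan_empty_iff)
      show "cl \<alpha> ?I" unfolding cl_def DI using pairings_in[OF a] by blast
      fix U assume U: "U \<subseteq> ?I" "cl \<alpha> U"
      show "cl \<alpha> (?I - U)" unfolding cl_def D_Diff[OF U(1)]
      proof (rule image_subsetI)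
        fix x assume x: "x \<in> ?S - D U"
        have "\<alpha> x \<notin> D U"
        proof
          assume "\<alpha> x \<in> D U"
          then have "\<alpha> (\<alpha> x) \<in> D U" using U(2) unfolding cl_def by blast
          then show False using x pairings_apply_apply[OF a] by simp
        qed
        then show "\<alpha> x \<in> ?S - D U" using x pairings_in[OF a] by blast
      qed
    next
      fix U V assume UV: "U \<subseteq> ?I" "V \<subseteq> ?I" "cl \<alpha> U" "cl \<alpha> V"
      show "cl \<alpha> (U \<inter> V)" unfolding cl_def D_Int[OF UV(1,2)] using UV(3,4) unfolding cl_def by blast
    qed simp
    ultimately show ?thesis by simp
  qed
  let ?w = "\<lambda>E \<alpha>. ?s ^ card E * real N ^ cyc (\<rho> \<circ> \<alpha>) E"
  have prod: "(\<Prod>B\<in>P. \<integral>A. (\<Prod>i\<in>B. Re (mat_trace (A ^\<^sub>m (\<mu> ! i)))) \<partial>GUE N) =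
      (\<Sum>\<alpha>\<in>pairings ?S. if \<forall>B\<in>P. cl \<alpha> B then ?w ?S \<alpha> else 0)" if P: "partition_on ?I P" for P
  proof -
    have BI: "B \<subseteq> ?I" if "B \<in> P" for B using partition_onD1[OF P] that by blast
    \<comment> \<open>Cycles are nonempty and disjoint, so a block is recovered from its points; the
      product over blocks can thus be taken over the sets of points.\<close>
    have injD: "inj_on D P" using D_sub BI by (intro inj_onI) (metis order_refl subset_antisym)
    have UD: "\<Union>(D ` P) = ?S" unfolding DI[symmetric] D_def partition_onD1[OF P] by blast
    have finP: "finite P" using P by (rule finite_elements[rotated]) simp
    have "(\<Prod>B\<in>P. \<integral>A. (\<Prod>i\<in>B. Re (mat_trace (A ^\<^sub>m (\<mu> ! i)))) \<partial>GUE N) =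
        (\<Prod>B\<in>P. \<Sum>\<alpha>\<in>pairings (D B). ?w (D B) \<alpha>)"
    proof (rule prod.cong[OF refl])
      fix B assume "B \<in> P"
      note B = BI[OF this]
      have "(\<integral>A. (\<Prod>i\<in>B. Re (mat_trace (A ^\<^sub>m (\<mu> ! i)))) \<partial>GUE N) =
          (\<integral>A. (\<Prod>i\<in>B. Re (mat_trace (A ^\<^sub>m card (b i)))) \<partial>GUE N)"
        using cb B by (intro Bochner_Integration.integral_cong refl prod.cong) auto
      also have "\<dots> = (\<Sum>\<alpha>\<in>pairings (D B). ?w (D B) \<alpha>)" unfolding D_def
      proof (rule gue_moment[OF N pr])
        show "finite B" using B finite_subset by blast
        show "\<exists>x. b i = orbit \<rho> x" if "i \<in> B" for i using orb B that by blast
        show "inj_on b B" using inj B by (rule inj_on_subset)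
      qed
      finally show "(\<integral>A. (\<Prod>i\<in>B. Re (mat_trace (A ^\<^sub>m (\<mu> ! i)))) \<partial>GUE N) = (\<Sum>\<alpha>\<in>pairings (D B). ?w (D B) \<alpha>)" .
    qed
    also have "\<dots> = (\<Prod>E\<in>D ` P. \<Sum>\<alpha>\<in>pairings E. ?w E \<alpha>)"
      using prod.reindex[OF injD, of "\<lambda>E. \<Sum>\<alpha>\<in>pairings E. ?w E \<alpha>"] by (simp only: o_def)
    also have "\<dots> = (\<Sum>\<alpha> | \<alpha> \<in> pairings (\<Union>(D ` P)) \<and> (\<forall>E\<in>D ` P. \<alpha> ` E \<subseteq> E). ?w (\<Union>(D ` P)) \<alpha>)"
    proof (rule prod_sum_pairings)
      show "finite (D ` P)" using finP by simp
      have DS: "D B \<subseteq> ?S" if "B \<in> P" for B using UD that by blast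
      show "finite E" if "E \<in> D ` P" for E
        using that DS finite_subset[of _ ?S] by blast
      show "\<rho> x \<in> E" if "E \<in> D ` P" "x \<in> E" for E x using rD BI that by blast
      show "E \<inter> F = {}" if EF: "E \<in> D ` P" "F \<in> D ` P" "E \<noteq> F" for E F
      proof -
        obtain B C where BC: "B \<in> P" "C \<in> P" "E = D B" "F = D C" using EF(1,2) by blast
        then have "B \<inter> C = {}" using EF(3) disjointD[OF partition_onD2[OF P]] by blast
        then show ?thesis using D_Int[OF BI[OF BC(1)] BI[OF BC(2)]] BC(3,4) by (simp add: D_def)
      qed
    qed
    also have "\<dots> = (\<Sum>\<alpha> | \<alpha> \<in> pairings ?S \<and> (\<forall>B\<in>P. cl \<alpha> B). ?w ?S \<alpha>)"
      unfolding UD cl_def by (simp only: ball_simps)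
    also have "\<dots> = (\<Sum>\<alpha>\<in>pairings ?S. if \<forall>B\<in>P. cl \<alpha> B then ?w ?S \<alpha> else 0)"
      by (rule sum.inter_filter) (simp add: finite_pairings)
    finally show ?thesis .
  qed
  have finPs: "finite {P. partition_on ?I P}" by (rule finitely_many_partition_on) simp
  have "gue_cumulant N \<mu> = (\<Sum>P | partition_on ?I P. moebius_weight (card P) *
      (\<Sum>\<alpha>\<in>pairings ?S. if \<forall>B\<in>P. cl \<alpha> B then ?w ?S \<alpha> else 0))"
    unfolding gue_cumulant_def joint_cumulant_def by (rule sum.cong[OF refl]) (use prod in simp)
  also have "\<dots> = (\<Sum>\<alpha>\<in>pairings ?S. \<Sum>P | partition_on ?I P.
      moebius_weight (card P) * (if \<forall>B\<in>P. cl \<alpha> B then ?w ?S \<alpha> else 0))"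
    unfolding sum_distrib_left by (rule sum.swap)
  also have "\<dots> = (\<Sum>\<alpha>\<in>pairings ?S. if transitive_on ?S {\<rho>, \<alpha>} then ?w ?S \<alpha> else 0)"
  proof (rule sum.cong[OF refl])
    fix \<alpha> assume a: "\<alpha> \<in> pairings ?S"
    have "(\<Sum>P | partition_on ?I P. moebius_weight (card P) * (if \<forall>B\<in>P. cl \<alpha> B then ?w ?S \<alpha> else 0)) =
        (\<Sum>P | partition_on ?I P. if \<forall>B\<in>P. cl \<alpha> B then moebius_weight (card P) * ?w ?S \<alpha> else 0)"
      by (rule sum.cong) auto
    also have "\<dots> = (\<Sum>P | P \<in> {P. partition_on ?I P} \<and> (\<forall>B\<in>P. cl \<alpha> B). moebius_weight (card P) * ?w ?S \<alpha>)"
      by (rule sum.inter_filter[OF finPs, symmetric])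
    also have "\<dots> = (\<Sum>P | partition_on ?I P \<and> (\<forall>B\<in>P. cl \<alpha> B). moebius_weight (card P)) * ?w ?S \<alpha>"
      by (simp only: sum_distrib_right mem_Collect_eq)
    also have "\<dots> = (if transitive_on ?S {\<rho>, \<alpha>} then ?w ?S \<alpha> else 0)" unfolding key[OF a] by simp
    finally show "(\<Sum>P | partition_on ?I P. moebius_weight (card P) * (if \<forall>B\<in>P. cl \<alpha> B then ?w ?S \<alpha> else 0)) =
        (if transitive_on ?S {\<rho>, \<alpha>} then ?w ?S \<alpha> else 0)" .
  qed
  also have "\<dots> = (\<Sum>\<alpha> | \<alpha> \<in> pairings ?S \<and> transitive_on ?S {\<rho>, \<alpha>}. ?w ?S \<alpha>)"
    by (rule sum.inter_filter[symmetric]) (simp add: finite_pairings)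
  finally show ?thesis by simp
qed

text \<open>The pairings in the cumulant formula are grouped by genus; Euler's relation turns the
  power of \<open>N\<close> into the exponent prescribed for that genus.\<close>

lemma topological_expansion_pairings:
  assumes \<rho>: "\<rho> \<in> conj_class \<mu>" and \<mu>: "\<mu> \<noteq> []" "0 < sum_list \<mu>"
  shows "topological_expansion \<mu> (\<lambda>g. real (card {\<alpha> \<in> pairings {1..sum_list \<mu>}.
    genus_condition (sum_list \<mu>) (2 * g + length \<mu> + sum_list \<mu> div 2 - 2) \<rho> \<alpha>}))"
proof -
  let ?L = "sum_list \<mu>" and ?n = "length \<mu>"
  let ?S = "{1..?L}"
  let ?G = "\<lambda>g. {\<alpha> \<in> pairings ?S. genus_condition ?L (2 * g + ?n + ?L div 2 - 2) \<rho> \<alpha>}"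
  define T where "T = {\<alpha>. \<alpha> \<in> pairings ?S \<and> transitive_on ?S {\<rho>, \<alpha>}}"
  \<comment> \<open>The genus solved from Euler's relation. On \<open>T\<close> the difference is
    nonnegative and even by \<open>genus_exists\<close>, so neither the truncated subtraction nor
    \<open>div\<close> loses anything.\<close>
  define \<gamma> where "\<gamma> \<alpha> = (?L div 2 + 2 - cyc (\<rho> \<circ> \<alpha>) ?S - ?n) div 2" for \<alpha>
  have fT: "finite T" unfolding T_def by (rule finite_subset[OF _ finite_pairings[of ?S]]) auto
  have rp: "\<rho> permutes ?S" using \<rho> by (rule conj_class_permutes)
  have n: "1 \<le> ?n" using \<mu> by (cases \<mu>) auto
  have even: "even ?L \<and> 1 \<le> ?L div 2" if "\<alpha> \<in> pairings ?S" for \<alpha>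
    using pairings_even_card[OF _ that] \<mu>(2) by auto
  have gen: "cyc (\<rho> \<circ> \<alpha>) ?S + ?n + 2 * \<gamma> \<alpha> = ?L div 2 + 2" if "\<alpha> \<in> T" for \<alpha>
  proof -
    have a: "\<alpha> \<in> pairings ?S" "transitive_on ?S {\<rho>, \<alpha>}" using that by (auto simp: T_def)
    have "?S \<noteq> {}" using \<mu>(2) by simp
    from genus_exists[OF rp _ this a] obtain g where "cyc (\<rho> \<circ> \<alpha>) ?S + cyc \<rho> ?S + 2 * g = card ?S div 2 + 2"
      by blast
    then have "cyc (\<rho> \<circ> \<alpha>) ?S + ?n + 2 * g = ?L div 2 + 2" unfolding conj_class_cyc[OF \<rho>] by simp
    moreover from this have "\<gamma> \<alpha> = g" unfolding \<gamma>_def by (simp flip: calculation)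
    ultimately show ?thesis by simp
  qed
  have G: "?G g = {\<alpha> \<in> T. \<gamma> \<alpha> = g}" for g
  proof (intro equalityI subsetI)
    fix \<alpha> assume "\<alpha> \<in> ?G g"
    then have a: "\<alpha> \<in> pairings ?S" "transitive_on ?S {\<rho>, \<alpha>}"
      and k: "2 * g + ?n + ?L div 2 - 2 + cyc (\<rho> \<circ> \<alpha>) ?S = ?L" by (auto simp: genus_condition_def)
    then have "\<alpha> \<in> T" by (simp add: T_def)
    \<comment> \<open>The subtraction of 2 in the step number is exact because \<open>\<mu>\<close>
      has a part and half the number of points is at least 1.\<close>
    moreover have "\<gamma> \<alpha> = g" using gen[OF \<open>\<alpha> \<in> T\<close>] k even[OF a(1)] n by auto
    ultimately show "\<alpha> \<in> {\<alpha> \<in> T. \<gamma> \<alpha> = g}" by simp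
  next
    fix \<alpha> assume "\<alpha> \<in> {\<alpha> \<in> T. \<gamma> \<alpha> = g}"
    then have t: "\<alpha> \<in> T" "\<gamma> \<alpha> = g" by auto
    then have a: "\<alpha> \<in> pairings ?S" "transitive_on ?S {\<rho>, \<alpha>}" by (auto simp: T_def)
    have "2 * g + ?n + ?L div 2 - 2 + cyc (\<rho> \<circ> \<alpha>) ?S = ?L" using gen[OF t(1)] t(2) even[OF a(1)] n by auto
    then show "\<alpha> \<in> ?G g" using a by (simp add: genus_condition_def)
  qed
  have nz: "{g. real (card (?G g)) \<noteq> 0} = \<gamma> ` T" unfolding G using fT by auto
  have "gue_cumulant N \<mu> = (\<Sum>g | real (card (?G g)) \<noteq> 0. real N powi (2 - 2 * int g - int ?n) * real (card (?G g)))"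
    if N: "1 \<le> N" for N
  proof -
    have w: "sqrt (1 / real N) ^ ?L * real N ^ cyc (\<rho> \<circ> \<alpha>) ?S = real N powi (2 - 2 * int (\<gamma> \<alpha>) - int ?n)"
      if t: "\<alpha> \<in> T" for \<alpha>
    proof -
      have a: "\<alpha> \<in> pairings ?S" using t by (simp add: T_def)
      obtain m where m: "?L = 2 * m" using even[OF a] by blast
      have "sqrt (1 / real N) ^ ?L = (1 / real N) ^ m" unfolding m power_mult by simp
      also have "\<dots> = real N powi (- int m)" by (simp add: power_int_minus power_one_over inverse_eq_divide)
      finally have "sqrt (1 / real N) ^ ?L * real N ^ cyc (\<rho> \<circ> \<alpha>) ?S = real N powi (- int m + int (cyc (\<rho> \<circ> \<alpha>) ?S))"
        using N by (subst power_int_add) simp_all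
      moreover have "- int m + int (cyc (\<rho> \<circ> \<alpha>) ?S) = 2 - 2 * int (\<gamma> \<alpha>) - int ?n" using gen[OF t] m by simp
      ultimately show ?thesis by simp
    qed
    have "gue_cumulant N \<mu> = (\<Sum>\<alpha>\<in>T. real N powi (2 - 2 * int (\<gamma> \<alpha>) - int ?n))"
      unfolding gue_cumulant_eq_sum_pairings[OF \<rho> N \<mu>(1)] T_def[symmetric] by (rule sum.cong[OF refl]) (rule w)
    also have "\<dots> = (\<Sum>g\<in>\<gamma> ` T. \<Sum>\<alpha> | \<alpha> \<in> T \<and> \<gamma> \<alpha> = g. real N powi (2 - 2 * int (\<gamma> \<alpha>) - int ?n))"
      by (rule sum.image_gen[OF fT])
    also have "\<dots> = (\<Sum>g\<in>\<gamma> ` T. real N powi (2 - 2 * int g - int ?n) * real (card (?G g)))"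
      unfolding G by (rule sum.cong[OF refl]) simp
    finally show ?thesis unfolding nz .
  qed
  moreover have "finite {g. real (card (?G g)) \<noteq> 0}" unfolding nz using fT by simp
  ultimately show ?thesis unfolding topological_expansion_def by blast
qed

text \<open>The left side does not mention \<rho>. Hence the number of pairings on the right is the
  same for all \<rho> in the class, which is the constancy needed for the double count.\<close>

lemma gue_cumulant_genus_eq_card:
  assumes "\<rho> \<in> conj_class \<mu>" "\<mu> \<noteq> []" "0 < sum_list \<mu>"
  shows "gue_cumulant_genus g \<mu> = real (card {\<alpha> \<in> pairings {1..sum_list \<mu>}.
    genus_condition (sum_list \<mu>) (2 * g + length \<mu> + sum_list \<mu> div 2 - 2) \<rho> \<alpha>})"
proof -
  note t = topological_expansion_pairings[OF assms]
  have "(THE c. topological_expansion \<mu> c) = (\<lambda>g. real (card {\<alpha> \<in> pairings {1..sum_list \<mu>}.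
      genus_condition (sum_list \<mu>) (2 * g + length \<mu> + sum_list \<mu> div 2 - 2) \<rho> \<alpha>}))"
    by (rule the_equality) (rule t, erule topological_expansion_unique[OF _ t])
  then show ?thesis by (simp only: gue_cumulant_genus_def)
qed

theorem proposition12p1:
  fixes g n :: nat and \<mu> :: "nat list" and \<sigma> :: "nat \<Rightarrow> nat"
  assumes "n \<ge> 1"
    and "is_partition \<mu>"
    and "length \<mu> = n"
    and "even (sum_list \<mu>) \<Longrightarrow> \<sigma> \<in> conj_class (replicate (sum_list \<mu> div 2) 2)"
  shows "gue_cumulant_genus g \<mu> / aut_order \<mu> = connected_monotone_hurwitz g \<mu> \<sigma>"
proof (cases "conj_class \<mu> = {}")
  case True
  \<comment> \<open>With an empty class \<open>aut_order\<close> is a division by zero and hence 0,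
    so the left side is 0 too; on the right there are no paths. This case stands in for a
    construction of a permutation of given cycle type.\<close>
  then have "strictly_monotone_paths \<mu> k \<sigma> = {}" for k by (auto simp: strictly_monotone_paths_def)
  then show ?thesis using True by (simp add: aut_order_def connected_monotone_hurwitz_def Let_def)
next
  case False
  let ?L = "sum_list \<mu>"
  let ?k = "2 * g + length \<mu> + ?L div 2 - 2"
  obtain \<rho> where \<rho>: "\<rho> \<in> conj_class \<mu>" using False by blast
  have \<mu>: "\<mu> \<noteq> []" using assms(1,3) by auto
  then have L: "0 < ?L" using assms(2) by (cases \<mu>) (auto simp: is_partition_def)
  note count = gue_cumulant_genus_eq_card[OF _ \<mu> L]
  show ?thesis
  proof (cases "even ?L")
    case False
    \<comment> \<open>An odd number of points has no pairing, which agrees with the convention for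
      the Hurwitz number.\<close>
    then have "pairings {1..?L} = {}" using pairings_even_card[of "{1..?L}"] by auto
    then show ?thesis using False count[OF \<rho>, of g] by (simp add: connected_monotone_hurwitz_def Let_def)
  next
    case True
    then obtain m where m: "?L = 2 * m" by blast
    have \<sigma>: "\<sigma> \<in> pairings {1..?L}" using conj_class_two_pairings assms(4)[OF True] m by simp
    let ?X = "card {\<rho> \<in> conj_class \<mu>. genus_condition ?L ?k \<rho> \<sigma>}"
    let ?\<kappa> = "card {\<alpha> \<in> pairings {1..?L}. genus_condition ?L ?k \<rho> \<alpha>}"
    \<comment> \<open>Replacing \<open>L!\<close> by the number of pairings times
      \<open>2^m m!\<close> in \<open>aut_order\<close> reduces the theorem to this
      identity.\<close>
    have "card (conj_class \<mu>) * ?\<kappa> = card (pairings {1..?L}) * ?X"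
    proof (rule double_count_genus_condition[OF \<sigma>])
      fix \<rho>' assume "\<rho>' \<in> conj_class \<mu>"
      \<comment> \<open>Both counts equal the same coefficient of the expansion, whichever member of
        the class is used.\<close>
      from count[OF this, of g] count[OF \<rho>, of g]
      show "card {\<alpha> \<in> pairings {1..?L}. genus_condition ?L ?k \<rho>' \<alpha>} = ?\<kappa>" by simp
    qed
    then have "real (card (conj_class \<mu>)) * real ?\<kappa> = real (card (pairings {1..?L})) * real ?X"
      by (simp only: of_nat_mult[symmetric])
    moreover have "real (card (pairings {1..?L})) * (2 ^ m * fact m) = fact ?L"
    proof -
      have "card (pairings {1..?L}) * (2 ^ m * fact m) = fact (2 * m)"
        by (rule card_pairings) (use m in auto)
      then have "real (card (pairings {1..?L}) * (2 ^ m * fact m)) = real (fact (2 * m))" by (simp only:)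
      then show ?thesis by (simp add: m)
    qed
    ultimately have "real ?\<kappa> * real (card (conj_class \<mu>)) * (2 ^ m * fact m) = fact ?L * real ?X"
      by (simp add: ac_simps)
    then have "real ?\<kappa> * real (card (conj_class \<mu>)) / fact ?L = real ?X / (2 ^ m * fact m)"
      by (subst frac_eq_eq) (simp_all add: ac_simps)
    moreover have "card {w \<in> strictly_monotone_paths \<mu> ?k \<sigma>. connected_path ?L w} = ?X"
      by (rule card_connected_paths[OF \<sigma>])
    ultimately show ?thesis
      using True m unfolding count[OF \<rho>] by (simp add: connected_monotone_hurwitz_def Let_def aut_order_def)
  qed
qed

end
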